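(* Let $(\phi_t)_{t\ge 0}$ be a non-elliptic semigroup in the unit disc $\mathbb D$ with Denjoy-Wolff point $\tau\in\partial\mathbb D$ and Koenigs function $h$, and let $\Omega:=h(\mathbb D)$. Let $\{t_n\}_{n\in\mathbb N}\subset[0,+\infty)$ be a sequence converging to $+\infty$. Then: (1) The following are equivalent: (a) for some $z\in\mathbb D$, $\{\phi_{t_n}(z)\}$ converges non-tangentially to $\tau$ as $n\to\infty$; (b) for every $z\in\mathbb D$, $\{\phi_{t_n}(z)\}$ converges non-tangentially to $\tau$ as $n\to\infty$; (c) for some $p\in\Omega$ there exist $0<c<C$ such that $c\,\delta^+_{\Omega,p}(t_n)\le \delta^-_{\Omega,p}(t_n)\le C\,\delta^+_{\Omega,p}(t_n)$ for all $n\in\mathbb N$; (d) for every $p\in\Omega$ there exist $0<c<C$ such that $c\,\delta^+_{\Omega,p}(t_n)\le \delta^-_{\Omega,p}(t_n)\le C\,\delta^+_{\Omega,p}(t_n)$ for all $n\in\mathbb N$. (2) The following are equivalent: (a) for some $z\in\mathbb D$, $\lim_{n\to\infty}\mathrm{Arg}(1-\overline{\tau}\phi_{t_n}(z))=\frac{\pi}{2}$ (in particular $\{\phi_{t_n}(z)\}$ converges tangentially to $\tau$); (b) the same holds for every $z\in\mathbb D$; (c) for some $p\in\Omega$, $\lim_{n\to\infty}\frac{\delta^+_{\Omega,p}(t_n)}{\delta^-_{\Omega,p}(t_n)}=0$; (d) the same holds for every $p\in\Omega$. Likewise the following are equivalent: (a') for some $z\in\mathbb D$, $\lim_{n\to\infty}\mathrm{Arg}(1-\overline{\tau}\phi_{t_n}(z))=-\frac{\pi}{2}$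 (in particular $\{\phi_{t_n}(z)\}$ converges tangentially to $\tau$); (b') the same holds for every $z\in\mathbb D$; (c') for some $p\in\Omega$, $\lim_{n\to\infty}\frac{\delta^+_{\Omega,p}(t_n)}{\delta^-_{\Omega,p}(t_n)}=+\infty$; (d') the same holds for every $p\in\Omega$.
   Context: A semigroup in $\mathbb D$ is a family $(\phi_t)_{t\ge0}$ of holomorphic self-maps of the unit disc $\mathbb D$ with $\phi_0=\mathrm{id}$, $\phi_{t+s}=\phi_t\circ\phi_s$, and $t\mapsto\phi_t$ continuous for the topology of uniform convergence on compacta. It is non-elliptic with Denjoy-Wolff point $\tau\in\partial\mathbb D$ if $\phi_t\to\tau$ uniformly on compacta of $\mathbb D$ as $t\to+\infty$. A Koenigs function of a non-elliptic semigroup is a univalent (injective holomorphic) function $h:\mathbb D\to\mathbb C$ such that $h(\phi_t(z))=h(z)+it$ for all $t\ge0$, $z\in\mathbb D$ (it exists and is unique up to an additive constant). Its image $\Omega=h(\mathbb D)$ is starlike at infinity, i.e. it is a simply connected domain $\Omega\subsetneq\mathbb C$ with $\Omega+it\subseteq\Omega$ for all $t\ge0$. A sequence $\{z_n\}\subset\mathbb D$ converging to $\tau\in\partial \mathbb D$ converges non-tangentially if the set of cluster points of $\mathrm{Arg}(1-\overline\tau z_n)$ as $n\to\infty$ is contained in the open interval $(-\pi/2,\pi/2)$. For a domain $\Omega\subsetneq\mathbb C$ starlike at infinity, $p\in\mathbb C$ and $t\ge0$: $$\delta^+_{\Omega,p}(t):=\min\{t,\ \inf\{|z-(p+it)|: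 z\in\partial\Omega,\ \mathrm{Re}\,z\ge\mathrm{Re}\,p\}\},$$ $$\delta^-_{\Omega,p}(t):=\min\{t,\ \inf\{|z-(p+it)|: z\in\partial\Omega,\ \mathrm{Re}\,z\le\mathrm{Re}\,p\}\},$$ with $\inf\emptyset=+\infty$. *)

theory Defs
  imports "HOL-Complex_Analysis.Complex_Analysis"
begin

text \<open>The unit disc is \<^term>\<open>ball 0 1 :: complex set\<close>. A family \<open>\<phi>\<close> is indexed by \<^typ>\<open>real\<close>; only its
  values at times \<open>t \<ge> 0\<close> and at points of the disc are constrained.\<close>

definition holomorphic_semigroup :: "(real \<Rightarrow> complex \<Rightarrow> complex) \<Rightarrow> bool" where
  "holomorphic_semigroup \<phi> \<longleftrightarrow>
     (\<forall>t\<ge>0. \<phi> t holomorphic_on ball 0 1 \<and> \<phi> t ` ball 0 1 \<subseteq> ball 0 1) \<and>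
     (\<forall>z\<in>ball 0 1. \<phi> 0 z = z) \<and>
     (\<forall>t\<ge>0. \<forall>s\<ge>0. \<forall>z\<in>ball 0 1. \<phi> (t + s) z = \<phi> t (\<phi> s z)) \<and>
     (\<forall>K. compact K \<and> K \<subseteq> ball 0 1 \<longrightarrow>
        (\<forall>t\<ge>0. uniform_limit K \<phi> (\<phi> t) (at t within {0..})))"

definition nonelliptic_semigroup :: "(real \<Rightarrow> complex \<Rightarrow> complex) \<Rightarrow> complex \<Rightarrow> bool" where
  "nonelliptic_semigroup \<phi> \<tau> \<longleftrightarrow>
     holomorphic_semigroup \<phi> \<and> \<tau> \<in> sphere 0 1 \<and>
     (\<forall>K. compact K \<and> K \<subseteq> ball 0 1 \<longrightarrow> uniform_limit K \<phi> (\<lambda>z. \<tau>) at_top)"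

definition koenigs_function :: "(real \<Rightarrow> complex \<Rightarrow> complex) \<Rightarrow> (complex \<Rightarrow> complex) \<Rightarrow> bool" where
  "koenigs_function \<phi> h \<longleftrightarrow>
     h holomorphic_on ball 0 1 \<and> inj_on h (ball 0 1) \<and>
     (\<forall>t\<ge>0. \<forall>z\<in>ball 0 1. h (\<phi> t z) = h z + \<i> * of_real t)"

definition cluster_points :: "(nat \<Rightarrow> 'a::topological_space) \<Rightarrow> 'a set" where
  "cluster_points x = {l. \<forall>U. open U \<and> l \<in> U \<longrightarrow> (\<exists>\<^sub>F n in sequentially. x n \<in> U)}"

text \<open>For \<open>w\<close> in the disc and \<open>\<tau>\<close> on the unit circle, \<open>1 - cnj \<tau> * w\<close> has positive real part, so its
  principal argument lies in the open interval \<open>(-\<pi>/2, \<pi>/2)\<close> and no branch issue arises.\<close>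

definition converges_nontangentially :: "(nat \<Rightarrow> complex) \<Rightarrow> complex \<Rightarrow> bool" where
  "converges_nontangentially w \<tau> \<longleftrightarrow>
     (\<forall>n. w n \<in> ball 0 1) \<and> w \<longlonglongrightarrow> \<tau> \<and>
     cluster_points (\<lambda>n. Arg (1 - cnj \<tau> * w n)) \<subseteq> {-(pi/2)<..<pi/2}"

definition converges_tangentially :: "(nat \<Rightarrow> complex) \<Rightarrow> complex \<Rightarrow> bool" where
  "converges_tangentially w \<tau> \<longleftrightarrow>
     (\<forall>n. w n \<in> ball 0 1) \<and> w \<longlonglongrightarrow> \<tau> \<and>
     cluster_points (\<lambda>n. Arg (1 - cnj \<tau> * w n)) \<subseteq> {-(pi/2), pi/2}"

text \<open>The infimum is taken in \<^typ>\<open>ereal\<close>, so that it is \<open>\<infinity>\<close> when the indicated part of the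
  boundary is empty; the minimum with \<open>t\<close> is finite for \<open>t \<ge> 0\<close>
  (see \<open>ereal_delta_plus\<close>, \<open>ereal_delta_minus\<close>).\<close>

definition delta_plus :: "complex set \<Rightarrow> complex \<Rightarrow> real \<Rightarrow> real" where
  "delta_plus \<Omega> p t = real_of_ereal (min (ereal t)
     (INF z\<in>{z \<in> frontier \<Omega>. Re z \<ge> Re p}. ereal (cmod (z - (p + \<i> * of_real t)))))"

definition delta_minus :: "complex set \<Rightarrow> complex \<Rightarrow> real \<Rightarrow> real" where
  "delta_minus \<Omega> p t = real_of_ereal (min (ereal t)
     (INF z\<in>{z \<in> frontier \<Omega>. Re z \<le> Re p}. ereal (cmod (z - (p + \<i> * of_real t)))))"

lemma ereal_real_min_INF:
  fixes f :: "'a \<Rightarrow> real"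
  assumes "t \<ge> 0" "\<And>z. f z \<ge> 0"
  shows "ereal (real_of_ereal (min (ereal t) (INF z\<in>S. ereal (f z)))) = min (ereal t) (INF z\<in>S. ereal (f z))"
proof -
  have "0 \<le> (INF z\<in>S. ereal (f z))"
    by (rule INF_greatest) (simp add: assms)
  then have "0 \<le> min (ereal t) (INF z\<in>S. ereal (f z))"
    using assms by simp
  moreover have "min (ereal t) (INF z\<in>S. ereal (f z)) \<le> ereal t"
    by simp
  ultimately have "\<bar>min (ereal t) (INF z\<in>S. ereal (f z))\<bar> \<noteq> \<infinity>"
    by (cases "min (ereal t) (INF z\<in>S. ereal (f z))") auto
  then show ?thesis
    by (rule ereal_real')
qed

lemma ereal_delta_plus:
  "t \<ge> 0 \<Longrightarrow> ereal (delta_plus \<Omega> p t) = min (ereal t)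
     (INF z\<in>{z \<in> frontier \<Omega>. Re z \<ge> Re p}. ereal (cmod (z - (p + \<i> * of_real t))))"
  unfolding delta_plus_def by (rule ereal_real_min_INF) auto

lemma ereal_delta_minus:
  "t \<ge> 0 \<Longrightarrow> ereal (delta_minus \<Omega> p t) = min (ereal t)
     (INF z\<in>{z \<in> frontier \<Omega>. Re z \<le> Re p}. ereal (cmod (z - (p + \<i> * of_real t))))"
  unfolding delta_minus_def by (rule ereal_real_min_INF) auto

definition all_equivalent :: "bool list \<Rightarrow> bool" where
  "all_equivalent Ps \<longleftrightarrow> (\<forall>P\<in>set Ps. \<forall>Q\<in>set Ps. P \<longleftrightarrow> Q)"

end

theory Submission
  imports Defs "HOL-Real_Asymp.Real_Asymp"
begin

text \<open>
  Let \<open>F = 1 / (1 - cnj \<tau> * h\<^sup>-\<^sup>1) - 1 / 2\<close>, a conformal map of \<open>\<Omega>\<close> onto the right half-plane sending the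
  Denjoy-Wolff point to \<open>\<infinity>\<close>, and let \<open>k\<close> be its inverse. Then \<open>Arg (1 - cnj \<tau> * \<phi>\<^sub>t(z))\<close> is minus the arctangent
  of the slope \<open>Im F / (Re F + 1 / 2)\<close> at \<open>h z + \<i> * t\<close>. By Julia's lemma \<open>Re F\<close> increases on upward vertical rays, so
  \<open>Im F' \<le> 0\<close> and \<open>Re k\<close> decreases on upward vertical lines of the half-plane: this replaces all topological
  arguments about the left and right sides of the boundary.

  The harmonic measure of a boundary part seen from \<open>p + \<i> * t\<close> is encoded by \<open>Arg (F - \<omega>)\<close> on the region
  \<open>Re F > Re \<omega>\<close>, where \<open>\<omega>\<close> is a base point at a level below the orbit, on the appropriate side of the vertical
  line through \<open>p\<close>. Since the ray below a point \<open>q\<close> outside \<open>\<Omega>\<close> misses \<open>\<Omega>\<close>, the maximum principle compares it with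
  explicit functions of a slit disc or a slit half-plane. If the left distance is much smaller than the right one,
  the slope is therefore large; if the right distance is at most a multiple of the left one, the slope is bounded
  above. These two facts and their mirror images under \<open>z \<mapsto> - cnj z\<close> give all the equivalences.
\<close>


text \<open>The obstacle is that \<open>Arg (F - \<omega>)\<close> reflects the slope of
  \<open>F\<close> itself only if \<open>Re \<omega>\<close> lies below \<open>Re F\<close> by a
  definite factor, and such an \<omega> on the prescribed side need not exist. If
  \<open>Re F\<close> is unbounded along an orbit, the orbit outgrows every fixed level, so any
  point on the prescribed side serves. If \<open>Re F\<close> is bounded, \<open>F\<close> tends to
  infinity vertically and the slope tends to plus or minus infinity whatever the distances are: one
  sign settles the estimate in question at once, and for the other sign a Phragmen-Lindelof argument
  produces base points at arbitrarily low levels.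

  Two estimates are enough because "small ratio forces extreme slope" and the contrapositive of
  "bounded ratio forces bounded slope" are the two implications of each equivalence. Independence of
  the starting point is a separate matter: by Schwarz-Pick two orbits stay at bounded hyperbolic
  distance, which changes slopes only within affine bounds. The summand \<open>1 / 2\<close> in the
  slope comes from \<open>1 / (1 - v)\<close>, which maps the disc onto the half-plane to the right
  of \<open>1 / 2\<close>.\<close>

section \<open>Maximum principle and Schwarz lemma\<close>

text \<open>The superlevel set \<open>{z \<in> S. Re (f z) \<ge> B + \<delta>}\<close> is compact, and the modulus of \<open>exp f\<close> is constant on
  its frontier.\<close>

lemma Re_le_if_limsup_le:
  assumes "open S" and holf: "f holomorphic_on S"
    and fr: "\<And>\<xi> \<delta>. \<xi> \<in> frontier S \<Longrightarrow> \<delta> > 0 \<Longrightarrow> eventually (\<lambda>z. Re (f z) \<le> B + \<delta>) (at \<xi> within S)"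
    and inf: "\<And>\<delta>. \<delta> > 0 \<Longrightarrow> \<exists>R. \<forall>z\<in>S. norm z \<ge> R \<longrightarrow> Re (f z) \<le> B + \<delta>"
    and "z \<in> S"
  shows "Re (f z) \<le> B"
proof (rule field_le_epsilon)
  fix \<delta> :: real assume "\<delta> > 0"
  have contf: "continuous_on S f"
    using holf by (rule holomorphic_on_imp_continuous_on)
  define K where "K = {z \<in> S. Re (f z) \<ge> B + \<delta>}"
  obtain R where R: "\<And>z. z \<in> S \<Longrightarrow> norm z \<ge> R \<Longrightarrow> Re (f z) \<le> B + \<delta>/2"
    using inf[of "\<delta>/2"] \<open>\<delta> > 0\<close> by auto
  have "bounded K"
    unfolding bounded_iff
  proof (intro exI ballI)
    fix z assume "z \<in> K"
    then show "norm z \<le> R"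
      using R[of z] \<open>\<delta> > 0\<close> unfolding K_def by force
  qed
  have clK: "\<xi> \<in> K" if "\<xi> \<in> closure K" for \<xi>
  proof -
    have ex: "\<exists>z\<in>K. z \<in> T" if "open T" "\<xi> \<in> T" for T
      using \<open>\<xi> \<in> closure K\<close> that by (meson IntI closure_iff_nhds_not_empty ex_in_conv subset_refl disjoint_iff)
    have "\<xi> \<in> S"
    proof (rule ccontr)
      assume "\<xi> \<notin> S"
      moreover have "\<xi> \<in> closure S"
        using that closure_mono[of K S] by (auto simp: K_def)
      ultimately have "\<xi> \<in> frontier S"
        using \<open>open S\<close> by (simp add: frontier_def interior_open)
      then obtain T where "open T" "\<xi> \<in> T" and T: "\<And>z. z \<in> T \<Longrightarrow> z \<noteq> \<xi> \<Longrightarrow> z \<in> S \<Longrightarrow> Re (f z) \<le> B + \<delta>/2"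
        using fr[of \<xi> "\<delta>/2"] \<open>\<delta> > 0\<close> unfolding eventually_at_topological by auto
      then obtain z where "z \<in> K" "z \<in> T"
        using ex by blast
      then show False
        using T[of z] \<open>\<xi> \<notin> S\<close> \<open>\<delta> > 0\<close> by (auto simp: K_def)
    qed
    moreover have "Re (f \<xi>) \<ge> B + \<delta>"
    proof (rule ccontr)
      assume "\<not> Re (f \<xi>) \<ge> B + \<delta>"
      then have "\<xi> \<in> S \<inter> (\<lambda>z. Re (f z)) -` {..<B + \<delta>}"
        using \<open>\<xi> \<in> S\<close> by auto
      moreover have "open (S \<inter> (\<lambda>z. Re (f z)) -` {..<B + \<delta>})"
        by (intro continuous_open_preimage continuous_intros contf \<open>open S\<close> open_lessThan)
      ultimately obtain z where "z \<in> K" "z \<in> S \<inter> (\<lambda>z. Re (f z)) -` {..<B + \<delta>}"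
        using ex by blast
      then show False
        by (auto simp: K_def)
    qed
    ultimately show ?thesis
      by (simp add: K_def)
  qed
  then have "closed K"
    using closure_subset_eq by blast
  then have KS: "closure K \<subseteq> S" "interior K \<subseteq> S"
    using interior_subset[of K] by (auto simp: K_def)
  show "Re (f z) \<le> B + \<delta>"
  proof (cases "z \<in> K")
    case True
    have "norm (exp (f z)) \<le> exp (B + \<delta>)"
    proof (rule maximum_modulus_frontier[of "\<lambda>z. exp (f z)" K])
      show "(\<lambda>z. exp (f z)) holomorphic_on interior K"
        using holomorphic_on_subset[OF holf KS(2)] by (intro holomorphic_intros)
      show "continuous_on (closure K) (\<lambda>z. exp (f z))"
        using continuous_on_subset[OF contf KS(1)] by (intro continuous_intros)
      show "norm (exp (f \<xi>)) \<le> exp (B + \<delta>)" if "\<xi> \<in> frontier K" for \<xi>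
      proof (rule ccontr)
        assume *: "\<not> norm (exp (f \<xi>)) \<le> exp (B + \<delta>)"
        have "\<xi> \<in> K"
          using that clK by (simp add: frontier_def)
        define T where "T = S \<inter> (\<lambda>z. Re (f z)) -` {B + \<delta><..}"
        have "open T"
          unfolding T_def
          by (intro continuous_open_preimage continuous_intros contf \<open>open S\<close> open_greaterThan)
        moreover have "\<xi> \<in> T"
          using * \<open>\<xi> \<in> K\<close> by (auto simp: T_def K_def)
        moreover have "T \<subseteq> K"
          by (auto simp: T_def K_def)
        ultimately have "\<xi> \<in> interior K"
          using interiorI by blast
        then show False
          using that by (simp add: frontier_def)
      qed
    qed (use True \<open>bounded K\<close> in auto)
    then show ?thesis
      by simp
  next
    case False
    then show ?thesis
      using \<open>z \<in> S\<close> by (auto simp: K_def)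
  qed
qed

text \<open>The point \<open>- cnj a\<close> is the mirror image of \<open>a\<close> in the
  imaginary axis, so \<open>b\<close> is nearer to \<open>a\<close> than to it. The quotient of the
  two norms is the pseudo-hyperbolic distance.\<close>

lemma right_half_plane_norm_less:
  assumes "Re a > 0" "Re b > 0"
  shows "norm (b - a) < norm (b + cnj a)"
proof -
  have "norm (b + cnj a) ^ 2 - norm (b - a) ^ 2 = 4 * Re a * Re b"
    unfolding cmod_power2 by (simp add: power2_eq_square algebra_simps)
  with assms have "norm (b - a) ^ 2 < norm (b + cnj a) ^ 2"
    by (smt (verit) mult_pos_pos)
  then show ?thesis
    by (rule power_less_imp_less_base) simp
qed

text \<open>The Cayley transform centred at \<open>g 0\<close> turns \<open>g\<close> into a
  self-map of the disc fixing \<open>0\<close>. The derivative of that transform at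
  \<open>g 0\<close> has modulus \<open>1 / (2 * Re (g 0))\<close>, whence the second claim.\<close>

lemma Schwarz_positive_real_part:
  assumes holg: "g holomorphic_on ball 0 1" and pos: "\<And>z. norm z < 1 \<Longrightarrow> Re (g z) > 0"
  shows "norm z < 1 \<Longrightarrow> norm (g z - g 0) \<le> norm z * norm (g z + cnj (g 0))"
    and "norm (deriv g 0) \<le> 2 * Re (g 0)"
proof -
  define f where "f z = (g z - g 0) / (g z + cnj (g 0))" for z
  have nz: "g z + cnj (g 0) \<noteq> 0" if "norm z < 1" for z
  proof -
    have "Re (g z + cnj (g 0)) > 0"
      using pos[OF that] pos[of 0] by simp
    then show ?thesis
      by (metis less_irrefl zero_complex.simps(1))
  qed
  have holf: "f holomorphic_on ball 0 1"
    unfolding f_def by (intro holomorphic_intros holg) (use nz in auto)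
  have f1: "norm (f z) < 1" if "norm z < 1" for z
    using right_half_plane_norm_less[of "g 0" "g z"] pos[OF that] pos[of 0] nz[OF that]
    by (simp add: f_def norm_divide)
  have f0: "f 0 = 0"
    by (simp add: f_def)
  show "norm (g z - g 0) \<le> norm z * norm (g z + cnj (g 0))" if "norm z < 1"
    using Schwarz_Lemma(1)[OF holf f0 f1 that] nz[OF that] by (simp add: f_def norm_divide field_simps)
  have dg: "(g has_field_derivative deriv g 0) (at 0)"
    using holg by (auto intro: holomorphic_derivI)
  have "((\<lambda>z. g z - g 0) has_field_derivative deriv g 0) (at 0)"
    "((\<lambda>z. g z + cnj (g 0)) has_field_derivative deriv g 0) (at 0)"
    by (auto intro!: derivative_eq_intros dg)
  then have "(f has_field_derivative deriv g 0 / (g 0 + cnj (g 0))) (at 0)"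
    unfolding f_def using nz[of 0] DERIV_divide[of "\<lambda>z. g z - g 0" _ 0 UNIV "\<lambda>z. g z + cnj (g 0)"] by fastforce
  then have "deriv f 0 = deriv g 0 / (g 0 + cnj (g 0))"
    by (rule DERIV_imp_deriv)
  moreover have "norm (deriv f 0) \<le> 1"
    by (rule Schwarz_Lemma(2)[OF holf f0 f1, of 0]) auto
  moreover have "norm (g 0 + cnj (g 0)) = 2 * Re (g 0)"
    using pos[of 0] by (simp add: complex_add_cnj)
  ultimately show "norm (deriv g 0) \<le> 2 * Re (g 0)"
    using pos[of 0] by (simp add: norm_divide field_simps)
qed

text \<open>An infinitesimal Harnack inequality, obtained by rescaling the disc. Since it bounds the
  full complex derivative by \<open>Re f\<close>, it will control \<open>Im F\<close> as
  well.\<close>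

lemma norm_deriv_le_Re:
  assumes "r > 0" "f holomorphic_on ball w r" and pos: "\<And>z. z \<in> ball w r \<Longrightarrow> Re (f z) > 0"
  shows "norm (deriv f w) \<le> 2 * Re (f w) / r"
proof -
  define g where "g z = f (w + r * z)" for z :: complex
  have in_ball: "w + r * z \<in> ball w r" if "norm z < 1" for z :: complex
    using that \<open>r > 0\<close> by (simp add: dist_norm norm_mult)
  have "g holomorphic_on ball 0 1"
    unfolding g_def using in_ball assms(2)
    by (intro holomorphic_on_compose_gen[of "\<lambda>z. w + r * z" _ f "ball w r", unfolded o_def])
       (auto intro!: holomorphic_intros)
  moreover have "Re (g z) > 0" if "norm z < 1" for z
    using pos in_ball[OF that] by (simp add: g_def)
  ultimately have "norm (deriv g 0) \<le> 2 * Re (g 0)"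
    by (rule Schwarz_positive_real_part(2)) auto
  moreover have "(g has_field_derivative deriv f w * r) (at 0)"
    unfolding g_def
    by (rule DERIV_chain2[where f = f and g = "\<lambda>z. w + r * z"])
       (use assms in \<open>auto intro!: derivative_eq_intros holomorphic_derivI[where S = "ball w r"]\<close>)
  then have "deriv g 0 = deriv f w * r"
    by (rule DERIV_imp_deriv)
  ultimately show ?thesis
    using \<open>r > 0\<close> by (simp add: g_def norm_mult field_simps)
qed

text \<open>The map \<open>z \<mapsto> (a + cnj a * z) / (1 - z)\<close> sends the disc onto the half-plane and \<open>0\<close> to \<open>a\<close>.\<close>

lemma right_half_plane_coordinate:
  assumes "Re a > 0" "Re b > 0"
  obtains z where "norm z < 1" "norm z = norm (b - a) / norm (b + cnj a)" "(a + cnj a * z) / (1 - z) = b"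
proof
  define z where "z = (b - a) / (b + cnj a)"
  have "norm (b - a) < norm (b + cnj a)"
    by (rule right_half_plane_norm_less[OF assms])
  then show "norm z < 1"
    by (simp add: z_def norm_divide divide_less_eq) 
  show "norm z = norm (b - a) / norm (b + cnj a)"
    by (simp add: z_def norm_divide)
  have ne: "b + cnj a \<noteq> 0" "a + cnj a \<noteq> 0"
    using assms by (auto simp: complex_eq_iff)
  have "1 - z = (a + cnj a) / (b + cnj a)"
    using ne by (simp add: z_def field_simps)
  moreover have "a + cnj a * z = b * (a + cnj a) / (b + cnj a)"
    using ne by (simp add: z_def field_simps)
  ultimately show "(a + cnj a * z) / (1 - z) = b"
    using ne by simp
qed

lemma right_half_plane_coordinate_Re:
  assumes "Re a > 0" "norm z < 1"
  shows "Re ((a + cnj a * z) / (1 - z)) > 0"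
proof -
  have "1 - z \<noteq> 0"
    using assms(2) by auto
  then have "norm (1 - z) > 0"
    by simp
  have "(a + cnj a * z) / (1 - z) = (a + cnj a * z) * cnj (1 - z) / of_real (norm (1 - z) ^ 2)"
    by (rule complex_div_cnj)
  moreover have "Re ((a + cnj a * z) * cnj (1 - z)) = Re a * (1 - norm z ^ 2)"
    unfolding cmod_power2 by (simp add: power2_eq_square algebra_simps)
  ultimately have "Re ((a + cnj a * z) / (1 - z)) = Re a * (1 - norm z ^ 2) / norm (1 - z) ^ 2"
    by (simp only: Re_divide_of_real)
  moreover have "norm z ^ 2 < 1"
    using assms(2) by (simp add: power_less_one_iff)
  ultimately show ?thesis
    using \<open>norm (1 - z) > 0\<close> assms(1) by simp
qed

lemma holomorphic_right_half_plane_coordinate: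
  assumes "Re a > 0" "f holomorphic_on {\<zeta>. Re \<zeta> > 0}"
  shows "(\<lambda>z. f ((a + cnj a * z) / (1 - z))) holomorphic_on ball 0 1"
proof (rule holomorphic_on_compose_gen[of "\<lambda>z. (a + cnj a * z) / (1 - z)" _ f "{\<zeta>. Re \<zeta> > 0}", unfolded o_def])
  show "(\<lambda>z. (a + cnj a * z) / (1 - z)) holomorphic_on ball 0 1"
    by (intro holomorphic_intros) auto
  show "(\<lambda>z. (a + cnj a * z) / (1 - z)) ` ball 0 1 \<subseteq> {\<zeta>. Re \<zeta> > 0}"
    using right_half_plane_coordinate_Re[OF assms(1)] by auto
qed fact

text \<open>Each side is \<open>2 * (cosh d - 1)\<close> for the hyperbolic distance
  \<open>d\<close> of the half-plane. This form contains no reflected point, so its behaviour when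
  one point tends to infinity can be read off.\<close>

lemma Schwarz_Pick_right_half_plane:
  assumes hol: "f holomorphic_on {\<zeta>. Re \<zeta> > 0}" and pos: "\<And>\<zeta>. Re \<zeta> > 0 \<Longrightarrow> Re (f \<zeta>) > 0"
    and "Re a > 0" "Re b > 0"
  shows "norm (f a - f b) ^ 2 / (Re (f a) * Re (f b)) \<le> norm (a - b) ^ 2 / (Re a * Re b)"
proof -
  obtain z where z: "norm z < 1" "norm z = norm (b - a) / norm (b + cnj a)" "(a + cnj a * z) / (1 - z) = b"
    using right_half_plane_coordinate assms by blast
  let ?g = "\<lambda>z. f ((a + cnj a * z) / (1 - z))"
  have hg: "?g holomorphic_on ball 0 1"
    by (rule holomorphic_right_half_plane_coordinate) fact+
  have "norm (?g z - ?g 0) \<le> norm z * norm (?g z + cnj (?g 0))"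
    by (rule Schwarz_positive_real_part(1)[OF hg _ z(1)])
       (use pos right_half_plane_coordinate_Re[OF \<open>Re a > 0\<close>] in auto)
  then have le: "norm (f b - f a) \<le> norm (b - a) / norm (b + cnj a) * norm (f b + cnj (f a))"
    using z by simp
  \<comment> \<open>This identity trades the reflected point for the product of the real parts;
    after squaring, the terms \<open>norm (f b - f a) ^ 2 * norm (b - a) ^ 2\<close> cancel.\<close>
  have id: "norm (y + cnj x) ^ 2 = norm (y - x) ^ 2 + 4 * (Re x * Re y)" for x y :: complex
    unfolding cmod_power2 by (simp add: power2_eq_square algebra_simps)
  have "Re (f a) > 0" "Re (f b) > 0"
    using pos assms by auto
  have "norm (b + cnj a) > 0"
    using right_half_plane_norm_less[OF assms(3,4)] by (smt (verit) norm_ge_zero)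
  with le have "norm (f b - f a) * norm (b + cnj a) \<le> norm (b - a) * norm (f b + cnj (f a))"
    by (simp add: field_simps)
  then have "(norm (f b - f a) * norm (b + cnj a))^2 \<le> (norm (b - a) * norm (f b + cnj (f a)))^2"
    by (intro power_mono) auto
  then have "norm (f b - f a)^2 * (Re a * Re b) \<le> norm (b - a)^2 * (Re (f a) * Re (f b))"
    unfolding power_mult_distrib id by (simp add: algebra_simps)
  then show ?thesis
    using assms \<open>Re (f a) > 0\<close> \<open>Re (f b) > 0\<close> by (simp add: field_simps norm_minus_commute)
qed

text \<open>The Schwarz bound in a disc coordinate \<open>z\<close> with \<open>0\<close> at the
  point \<open>1\<close> gives the factor \<open>(1 + norm z) / (1 - norm z)\<close>, and
  \<open>1 - norm z ^ 2 = 4 * Re \<zeta> / norm (\<zeta> + 1) ^ 2\<close> translates it back. On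
  vertical strips away from the imaginary axis this means polynomial growth.\<close>

lemma norm_positive_real_part_le:
  assumes hol: "f holomorphic_on {\<zeta>. Re \<zeta> > 0}" and pos: "\<And>\<zeta>. Re \<zeta> > 0 \<Longrightarrow> Re (f \<zeta>) > 0"
    and "Re \<zeta> > 0"
  shows "norm (f \<zeta>) \<le> norm (f 1) * (norm (\<zeta> + 1) ^ 2 / Re \<zeta>)"
proof -
  obtain z where z: "norm z < 1" "norm z = norm (\<zeta> - 1) / norm (\<zeta> + cnj 1)" "(1 + cnj 1 * z) / (1 - z) = \<zeta>"
    using right_half_plane_coordinate[of 1 \<zeta>] assms by auto
  let ?g = "\<lambda>z. f ((1 + cnj 1 * z) / (1 - z))"
  have hg: "?g holomorphic_on ball 0 1"
    by (rule holomorphic_right_half_plane_coordinate) (use assms in auto)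
  have "norm (?g z - ?g 0) \<le> norm z * norm (?g z + cnj (?g 0))"
    by (rule Schwarz_positive_real_part(1)[OF hg _ z(1)])
       (use pos right_half_plane_coordinate_Re[of 1] in auto)
  then have "norm (f \<zeta> - f 1) \<le> norm z * norm (f \<zeta> + cnj (f 1))"
    using z by simp
  also have "\<dots> \<le> norm z * (norm (f \<zeta>) + norm (f 1))"
    by (intro mult_left_mono order_trans[OF norm_triangle_ineq]) auto
  finally have *: "norm (f \<zeta>) * (1 - norm z) \<le> norm (f 1) * (1 + norm z)"
    using norm_triangle_sub[of "f \<zeta>" "f 1"] by (simp add: algebra_simps)
  have "norm (\<zeta> + 1) > 0"
    using assms(3) by (metis add_pos_pos complex_Re_le_cmod dual_order.strict_trans1 one_complex.simps(1) plus_complex.simps(1) zero_less_one)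
  have "(1 - norm z) * (1 + norm z) = 1 - norm z ^ 2"
    by (simp add: power2_eq_square algebra_simps)
  also have "\<dots> = 4 * Re \<zeta> / norm (\<zeta> + 1) ^ 2"
  proof -
    have "norm (\<zeta> + 1) ^ 2 - norm (\<zeta> - 1) ^ 2 = 4 * Re \<zeta>"
      unfolding cmod_power2 by (simp add: power2_eq_square algebra_simps)
    then show ?thesis
      using \<open>norm (\<zeta> + 1) > 0\<close> unfolding z(2) by (simp add: power_divide diff_divide_eq_iff)
  qed
  finally have e: "(1 - norm z) * (1 + norm z) = 4 * Re \<zeta> / norm (\<zeta> + 1) ^ 2" .
  have "norm (f \<zeta>) * (4 * Re \<zeta> / norm (\<zeta> + 1) ^ 2) = norm (f \<zeta>) * (1 - norm z) * (1 + norm z)"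
    unfolding e[symmetric] by (simp only: mult.assoc)
  also have "\<dots> \<le> norm (f 1) * (1 + norm z) * (1 + norm z)"
    by (intro mult_right_mono *) auto
  also have "\<dots> \<le> norm (f 1) * 2 * 2"
    using z(1) by (intro mult_mono) auto
  finally show ?thesis
    using \<open>norm (\<zeta> + 1) > 0\<close> assms(3) by (simp add: field_simps)
qed

section \<open>Conformal models over the right half-plane\<close>

text \<open>Once \<open>\<bar>g s\<bar>\<close> stays above \<open>1\<close>, connectedness prevents
  a change of sign.\<close>

lemma filterlim_abs_at_top_cases:
  fixes g :: "real \<Rightarrow> real"
  assumes "continuous_on {0..} g" "filterlim (\<lambda>s. \<bar>g s\<bar>) at_top at_top"
  shows "filterlim g at_top at_top \<or> filterlim g at_bot at_top"
proof -
  obtain s0 where s0: "\<And>s. s \<ge> s0 \<Longrightarrow> \<bar>g s\<bar> \<ge> 1"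
    using assms(2) by (auto simp: filterlim_at_top eventually_at_top_linorder)
  define s1 where "s1 = max s0 0"
  have conn: "connected (g ` {s1..})"
    by (intro connected_continuous_image continuous_on_subset[OF assms(1)]) (auto simp: s1_def)
  have "0 \<notin> g ` {s1..}"
    using s0 by (force simp: s1_def)
  then have no: "\<not> (g s \<le> 0 \<and> 0 \<le> g s')" if "s \<ge> s1" "s' \<ge> s1" for s s'
    using connectedD_interval[OF conn, of "g s" "g s'" 0] that by blast
  have "(\<forall>s\<ge>s1. g s > 0) \<or> (\<forall>s\<ge>s1. g s < 0)"
  proof (cases "g s1 > 0")
    case True
    have "g s > 0" if "s \<ge> s1" for s
      using no[of s s1] that True by linarith
    then show ?thesis
      by blast
  next
    case False
    have "g s < 0" if "s \<ge> s1" for s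
      using no[of s1 s] that False by linarith
    then show ?thesis
      by blast
  qed
  then show ?thesis
  proof
    assume "\<forall>s\<ge>s1. g s > 0"
    then have "\<forall>\<^sub>F s in at_top. \<bar>g s\<bar> = g s"
      by (auto simp: eventually_at_top_linorder intro!: exI[of _ s1])
    then show ?thesis
      using assms(2) by (simp cong: filterlim_cong)
  next
    assume "\<forall>s\<ge>s1. g s < 0"
    then have "\<forall>\<^sub>F s in at_top. \<bar>g s\<bar> = - g s"
      by (auto simp: eventually_at_top_linorder intro!: exI[of _ s1])
    then have "filterlim (\<lambda>s. - g s) at_top at_top"
      using assms(2) by (simp cong: filterlim_cong)
    then show ?thesis
      by (simp add: filterlim_uminus_at_top)
  qed
qed

lemma DERIV_nonneg_if_mono_right:
  fixes g :: "real \<Rightarrow> real"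
  assumes "(g has_field_derivative D) (at x)" "\<forall>\<^sub>F y in at_right x. g x \<le> g y"
  shows "D \<ge> 0"
proof -
  have "((\<lambda>y. (g y - g x) / (y - x)) \<longlongrightarrow> D) (at_right x)"
    using assms(1) has_field_derivative_at_within[of g D x "{x<..}"]
    by (simp add: has_field_derivative_iff)
  moreover have "\<forall>\<^sub>F y in at_right x. (g y - g x) / (y - x) \<ge> 0"
    using assms(2) eventually_at_right_less[of x] by eventually_elim simp
  ultimately show ?thesis
    by (rule tendsto_lowerbound) simp
qed

abbreviation vert :: "complex \<Rightarrow> real \<Rightarrow> complex" where
  "vert z s \<equiv> z + \<i> * of_real s"

text \<open>\<open>F\<close> maps the Koenigs domain \<open>\<Omega>\<close> conformally onto the right half-plane, with inverse \<open>k\<close>, in such a way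
  that the Denjoy-Wolff point corresponds to \<open>\<infinity>\<close>. That \<open>Re F\<close> increases along the orbits is Julia's lemma.\<close>

locale half_plane_model =
  fixes \<Omega> :: "complex set" and F k :: "complex \<Rightarrow> complex"
  assumes open_domain: "open \<Omega>"
    and holF: "F holomorphic_on \<Omega>"
    and holk: "k holomorphic_on {\<zeta>. Re \<zeta> > 0}"
    and F_pos: "z \<in> \<Omega> \<Longrightarrow> Re (F z) > 0"
    and k_in: "Re \<zeta> > 0 \<Longrightarrow> k \<zeta> \<in> \<Omega>"
    and kF [simp]: "z \<in> \<Omega> \<Longrightarrow> k (F z) = z"
    and Fk [simp]: "Re \<zeta> > 0 \<Longrightarrow> F (k \<zeta>) = \<zeta>"
    and up: "z \<in> \<Omega> \<Longrightarrow> s \<ge> 0 \<Longrightarrow> z + \<i> * of_real s \<in> \<Omega>"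
    and Re_F_up: "z \<in> \<Omega> \<Longrightarrow> s \<ge> 0 \<Longrightarrow> Re (F z) \<le> Re (F (vert z s))"
    and F_at_infinity: "z \<in> \<Omega> \<Longrightarrow> filterlim (\<lambda>s. F (vert z s)) at_infinity at_top"
begin

text \<open>The reflection swaps left and right and keeps the upward direction. On the half-plane it
  becomes conjugation, which keeps \<open>Re F\<close>, hence its monotonicity, and changes the sign
  of \<open>Im F\<close>. An upper bound for the slope thus yields a lower bound with the two
  distances exchanged.\<close>

lemma half_plane_model_mirror:
  "half_plane_model ((\<lambda>z. - cnj z) ` \<Omega>) (\<lambda>z. cnj (F (- cnj z))) (\<lambda>\<zeta>. - cnj (k (cnj \<zeta>)))"
proof -
  have im: "(\<lambda>z. - cnj z) ` \<Omega> = {z. - cnj z \<in> \<Omega>}"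
    by (force simp: image_iff intro: exI[of _ "- cnj _"])
  have "open ((\<lambda>z. - cnj z) -` \<Omega>)"
    by (intro open_vimage open_domain continuous_intros)
  then have op: "open {z. - cnj z \<in> \<Omega>}"
    by (simp add: vimage_def)
  have op': "open {\<zeta>. Re \<zeta> > 0}"
    by (simp add: open_halfspace_Re_gt)
  show ?thesis
    unfolding im
  proof
    have "(\<lambda>z. F (- z)) holomorphic_on cnj ` {z. - cnj z \<in> \<Omega>}"
      by (rule holomorphic_on_compose_gen[of "\<lambda>z. - z" _ F \<Omega>, unfolded o_def])
         (auto intro!: holomorphic_intros holF)
    then have "(cnj \<circ> (\<lambda>z. F (- z)) \<circ> cnj) holomorphic_on {z. - cnj z \<in> \<Omega>}"
      by (rule holomorphic_on_compose_cnj_cnj) fact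
    then show "(\<lambda>z. cnj (F (- cnj z))) holomorphic_on {z. - cnj z \<in> \<Omega>}"
      by (simp add: o_def)
    have "cnj ` {\<zeta>. Re \<zeta> > 0} = {\<zeta>. Re \<zeta> > 0}"
      by (force simp: image_iff intro: exI[of _ "cnj _"])
    then have "k holomorphic_on cnj ` {\<zeta>. Re \<zeta> > 0}"
      using holk by simp
    then have "(cnj \<circ> k \<circ> cnj) holomorphic_on {\<zeta>. Re \<zeta> > 0}"
      by (rule holomorphic_on_compose_cnj_cnj) fact
    then show "(\<lambda>\<zeta>. - cnj (k (cnj \<zeta>))) holomorphic_on {\<zeta>. Re \<zeta> > 0}"
      by (auto simp: o_def intro!: holomorphic_intros)
    fix z :: complex assume z: "z \<in> {z. - cnj z \<in> \<Omega>}"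
    have eq: "- cnj (vert z s) = - cnj z + \<i> * of_real s" for s
      by simp
    fix s :: real assume s: "s \<ge> 0"
    show "vert z s \<in> {z. - cnj z \<in> \<Omega>}"
      using up[of "- cnj z" s] z s by (simp add: eq del: complex_cnj_add)
    show "Re (cnj (F (- cnj z))) \<le> Re (cnj (F (- cnj (vert z s))))"
      using Re_F_up[of "- cnj z" s] z s unfolding eq by simp
  next
    fix z :: complex assume z: "z \<in> {z. - cnj z \<in> \<Omega>}"
    have eq: "- cnj (vert z s) = - cnj z + \<i> * of_real s" for s
      by simp
    show "filterlim (\<lambda>s. cnj (F (- cnj (vert z s)))) at_infinity at_top"
      using F_at_infinity[of "- cnj z"] z
      unfolding eq filterlim_at_infinity_conv_norm_at_top by simp
  qed (use op F_pos k_in in auto)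
qed

lemma deriv_F: "z \<in> \<Omega> \<Longrightarrow> (F has_field_derivative deriv F z) (at z)"
  by (rule holomorphic_derivI[OF holF open_domain])

lemma deriv_k: "Re \<zeta> > 0 \<Longrightarrow> (k has_field_derivative deriv k \<zeta>) (at \<zeta>)"
  using holomorphic_derivI[OF holk] by (simp add: open_halfspace_Re_gt)

lemma continuous_on_F: "continuous_on \<Omega> F"
  by (rule holomorphic_on_imp_continuous_on[OF holF])

lemma isCont_F: "z \<in> \<Omega> \<Longrightarrow> isCont F z"
  using deriv_F DERIV_isCont by blast

lemma isCont_k: "Re \<zeta> > 0 \<Longrightarrow> isCont k \<zeta>"
  using deriv_k DERIV_isCont by blast

lemma has_derivative_F_line:
  assumes "z + c * of_real s \<in> \<Omega>"
  shows "((\<lambda>s. F (z + c * of_real s)) has_vector_derivative c * deriv F (z + c * of_real s)) (at s)"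
proof -
  have "((\<lambda>s. z + c * of_real s) has_vector_derivative c) (at s)"
    by (auto intro!: derivative_eq_intros)
  from field_vector_diff_chain_at[OF this deriv_F[OF assms]] show ?thesis
    by (simp add: o_def)
qed

lemma DERIV_Re_F_line:
  assumes "z + c * of_real s \<in> \<Omega>"
  shows "((\<lambda>s. Re (F (z + c * of_real s))) has_field_derivative Re (c * deriv F (z + c * of_real s))) (at s)"
  using bounded_linear.has_vector_derivative[OF bounded_linear_Re has_derivative_F_line[OF assms]]
  by (simp add: has_real_derivative_iff_has_vector_derivative)

lemma DERIV_Im_F_line:
  assumes "z + c * of_real s \<in> \<Omega>"
  shows "((\<lambda>s. Im (F (z + c * of_real s))) has_field_derivative Im (c * deriv F (z + c * of_real s))) (at s)"
  using bounded_linear.has_vector_derivative[OF bounded_linear_Im has_derivative_F_line[OF assms]]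
  by (simp add: has_real_derivative_iff_has_vector_derivative)

lemma Im_deriv_F_nonpos:
  assumes "z \<in> \<Omega>"
  shows "Im (deriv F z) \<le> 0"
proof -
  have "((\<lambda>s. Re (F (vert z s))) has_field_derivative Re (\<i> * deriv F z)) (at 0)"
    using DERIV_Re_F_line[of z \<i> 0] assms by simp
  moreover have "\<forall>\<^sub>F s in at_right 0. Re (F (z + \<i> * of_real 0)) \<le> Re (F (vert z s))"
    using eventually_at_right_less[of "0::real"]
    by eventually_elim (use Re_F_up[OF assms] in simp)
  ultimately have "Re (\<i> * deriv F z) \<ge> 0"
    by (rule DERIV_nonneg_if_mono_right)
  then show ?thesis
    by simp
qed

lemma deriv_F_times_deriv_k:
  assumes "Re \<zeta> > 0"
  shows "deriv F (k \<zeta>) * deriv k \<zeta> = 1"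
proof -
  have "((\<lambda>\<zeta>. F (k \<zeta>)) has_field_derivative deriv F (k \<zeta>) * deriv k \<zeta>) (at \<zeta>)"
    by (rule DERIV_chain2) (use deriv_F k_in assms deriv_k in auto)
  moreover have "((\<lambda>\<zeta>. F (k \<zeta>)) has_field_derivative 1) (at \<zeta>)"
  proof (rule DERIV_cong_ev[THEN iffD2, OF refl _ refl])
    have "open {\<zeta>. Re \<zeta> > 0}"
      by (simp add: open_halfspace_Re_gt)
    then show "\<forall>\<^sub>F x in nhds \<zeta>. F (k x) = x"
      using eventually_nhds_in_open[of "{\<zeta>. Re \<zeta> > 0}" \<zeta>] assms by (auto elim!: eventually_mono)
  qed auto
  ultimately show ?thesis
    using DERIV_unique by blast
qed

lemma Im_deriv_k_nonneg:
  assumes "Re \<zeta> > 0"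
  shows "Im (deriv k \<zeta>) \<ge> 0"
proof -
  have e: "deriv F (k \<zeta>) * deriv k \<zeta> = 1"
    by (rule deriv_F_times_deriv_k[OF assms])
  then have "deriv k \<zeta> = 1 / deriv F (k \<zeta>)"
    by (metis eq_divide_imp mult.commute mult_zero_right zero_neq_one)
  then show ?thesis
    using Im_deriv_F_nonpos[OF k_in[OF assms]] by (simp add: Im_divide divide_le_0_iff)
qed

text \<open>The vertical derivative of \<open>Re k\<close> is \<open>- Im (deriv k)\<close>.
  Consequently, on a vertical line of the half-plane, the points that \<open>k\<close> sends to the
  right of a given abscissa form a lower part of the line: this is the separation principle behind
  every use of a base point.\<close>

lemma Re_k_antimono:
  assumes "Re \<zeta> > 0" "Re \<zeta> = Re \<zeta>'" "Im \<zeta> \<le> Im \<zeta>'"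
  shows "Re (k \<zeta>') \<le> Re (k \<zeta>)"
proof -
  define g where "g V = Re (k (of_real (Re \<zeta>) + \<i> * of_real V))" for V
  have "(g has_field_derivative - Im (deriv k (of_real (Re \<zeta>) + \<i> * of_real V))) (at V)" for V
  proof -
    let ?w = "of_real (Re \<zeta>) + \<i> * of_real V"
    have "((\<lambda>V. of_real (Re \<zeta>) + \<i> * of_real V) has_vector_derivative \<i>) (at V)"
      by (auto intro!: derivative_eq_intros)
    from field_vector_diff_chain_at[OF this deriv_k]
    have "((\<lambda>V. k (of_real (Re \<zeta>) + \<i> * of_real V)) has_vector_derivative \<i> * deriv k ?w) (at V)"
      using assms(1) by (simp add: o_def)
    from bounded_linear.has_vector_derivative[OF bounded_linear_Re this] show ?thesis
      by (simp add: g_def[abs_def] has_real_derivative_iff_has_vector_derivative)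
  qed
  moreover have "- Im (deriv k (of_real (Re \<zeta>) + \<i> * of_real V)) \<le> 0" for V
    using Im_deriv_k_nonneg[of "of_real (Re \<zeta>) + \<i> * of_real V"] assms(1) by simp
  ultimately have "g (Im \<zeta>') \<le> g (Im \<zeta>)"
    by (intro DERIV_nonpos_imp_nonincreasing[OF assms(3)] exI conjI)
  moreover have "of_real (Re \<zeta>) + \<i> * of_real (Im \<zeta>) = \<zeta>" "of_real (Re \<zeta>) + \<i> * of_real (Im \<zeta>') = \<zeta>'"
    using assms(2) by (simp_all add: complex_eq_iff)
  ultimately show ?thesis
    by (simp add: g_def)
qed

section \<open>Harnack inequalities along segments and comparison of orbits\<close>

lemma norm_deriv_F_le:
  assumes "r > 0" "ball w r \<subseteq> \<Omega>"
  shows "norm (deriv F w) \<le> 2 * Re (F w) / r"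
  by (rule norm_deriv_le_Re[OF assms(1) holomorphic_on_subset[OF holF assms(2)]]) (use F_pos assms(2) in auto)

text \<open>The logarithm of \<open>Re F\<close> changes by at most \<open>2 / r\<close> per unit of
  length, hence by \<open>2 * L\<close> along the segment. Inserting the resulting bound into the
  derivative estimate controls the increment of \<open>F\<close>, including its imaginary
  part.\<close>

lemma Harnack_segment:
  assumes r: "r > 0" and seg: "\<And>x. x \<in> closed_segment a b \<Longrightarrow> ball x r \<subseteq> \<Omega>" and L: "dist a b \<le> L * r"
  shows "\<bar>ln (Re (F b)) - ln (Re (F a))\<bar> \<le> 2 * L"
    and "Re (F b) \<le> exp (2 * L) * Re (F a)" and "Re (F a) \<le> exp (2 * L) * Re (F b)"
    and "norm (F b - F a) \<le> 2 * L * exp (2 * L) * Re (F a)"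
proof -
  have mem: "x \<in> \<Omega>" if "x \<in> closed_segment a b" for x
    using seg[OF that] r by (auto simp: subset_iff)
  have L0: "L \<ge> 0"
    using L r by (smt (verit) mult_neg_pos zero_le_dist)
  \<comment> \<open>All intermediate points are treated, since the last claim needs the bound for
    \<open>Re F\<close> on the whole segment.\<close>
  have ln_bound: "\<bar>ln (Re (F c)) - ln (Re (F a))\<bar> \<le> 2 * L" if c: "c \<in> closed_segment a b" for c
  proof -
    define g where "g s = ln (Re (F (a + (c - a) * of_real s)))" for s
    have sub: "closed_segment a c \<subseteq> closed_segment a b"
      using c by (simp add: subset_closed_segment)
    have in_seg: "a + (c - a) * of_real s \<in> closed_segment a b" if "0 \<le> s" "s \<le> 1" for s
    proof -
      have "a + (c - a) * of_real s = (1 - s) *\<^sub>R a + s *\<^sub>R c"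
        by (simp add: scaleR_conv_of_real algebra_simps)
      then have "a + (c - a) * of_real s \<in> closed_segment a c"
        using that unfolding closed_segment_def by blast
      then show ?thesis
        using sub by blast
    qed
    define D where "D s = Re ((c - a) * deriv F (a + (c - a) * of_real s)) / Re (F (a + (c - a) * of_real s))" for s
    have "(g has_field_derivative D s) (at s)" if "0 \<le> s" "s \<le> 1" for s
      unfolding g_def D_def
      by (rule DERIV_chain2[where f = ln, THEN DERIV_cong, OF DERIV_ln DERIV_Re_F_line])
         (use mem[OF in_seg[OF that]] F_pos in \<open>auto simp: divide_inverse\<close>)
    then obtain s where s: "0 < s" "s < 1" "g 1 - g 0 = (1 - 0) * D s"
      using MVT2[of 0 1 g D] by auto
    let ?x = "a + (c - a) * of_real s"
    have x: "?x \<in> closed_segment a b" "Re (F ?x) > 0"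
      using in_seg[of s] s F_pos mem by auto
    have "dist a c \<le> dist a b"
      using c by (metis dist_commute dist_in_closed_segment)
    have "\<bar>D s\<bar> = \<bar>Re ((c - a) * deriv F ?x)\<bar> / Re (F ?x)"
      using x by (simp add: D_def)
    also have "\<dots> \<le> norm ((c - a) * deriv F ?x) / Re (F ?x)"
      using x abs_Re_le_cmod[of "(c - a) * deriv F ?x"] by (intro divide_right_mono) auto
    also have "\<dots> = dist a c * norm (deriv F ?x) / Re (F ?x)"
      by (simp add: norm_mult dist_norm norm_minus_commute)
    also have "\<dots> \<le> (L * r) * (2 * Re (F ?x) / r) / Re (F ?x)"
      using x norm_deriv_F_le[OF r seg[OF x(1)]] \<open>dist a c \<le> dist a b\<close> L L0 r
      by (intro divide_right_mono mult_mono) auto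
    also have "\<dots> = 2 * L"
      using x r by simp
    finally show ?thesis
      using s(3) by (simp add: g_def)
  qed
  have U_bound: "Re (F c) \<le> exp (2 * L) * Re (F a)" "Re (F a) \<le> exp (2 * L) * Re (F c)"
    if c: "c \<in> closed_segment a b" for c
  proof -
    have pos: "Re (F c) > 0" "Re (F a) > 0"
      using mem c F_pos by auto
    have "exp (ln (Re (F c))) \<le> exp (2 * L + ln (Re (F a)))" "exp (ln (Re (F a))) \<le> exp (2 * L + ln (Re (F c)))"
      using ln_bound[OF c] unfolding exp_le_cancel_iff by linarith+
    then show "Re (F c) \<le> exp (2 * L) * Re (F a)" "Re (F a) \<le> exp (2 * L) * Re (F c)"
      using pos by (simp_all add: exp_add)
  qed
  show "\<bar>ln (Re (F b)) - ln (Re (F a))\<bar> \<le> 2 * L"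
    and "Re (F b) \<le> exp (2 * L) * Re (F a)" and "Re (F a) \<le> exp (2 * L) * Re (F b)"
    using ln_bound[of b] U_bound[of b] by auto
  have "norm (F b - F a) \<le> (2 * (exp (2 * L) * Re (F a)) / r) * norm (b - a)"
  proof (rule field_differentiable_bound)
    show "convex (closed_segment a b)"
      by simp
    fix x assume x: "x \<in> closed_segment a b"
    show "(F has_field_derivative deriv F x) (at x within closed_segment a b)"
      using deriv_F[OF mem[OF x]] by (rule has_field_derivative_at_within)
    have "norm (deriv F x) \<le> 2 * Re (F x) / r"
      by (rule norm_deriv_F_le[OF r seg[OF x]])
    also have "\<dots> \<le> 2 * (exp (2 * L) * Re (F a)) / r"
      using U_bound(1)[OF x] r by (simp add: divide_right_mono)
    finally show "norm (deriv F x) \<le> 2 * (exp (2 * L) * Re (F a)) / r" .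
  qed auto
  also have "\<dots> \<le> (2 * (exp (2 * L) * Re (F a)) / r) * (L * r)"
    using L r F_pos[OF mem[of a]] by (intro mult_left_mono) (auto simp: dist_norm norm_minus_commute)
  also have "\<dots> = 2 * L * exp (2 * L) * Re (F a)"
    using r by simp
  finally show "norm (F b - F a) \<le> 2 * L * exp (2 * L) * Re (F a)" .
qed

text \<open>Through \<open>F\<close>, translation by \<open>\<i> * s\<close> becomes a holomorphic
  self-map of the half-plane, so Schwarz-Pick bounds the separation of the orbits at time
  \<open>s\<close> by the initial one. The constant depends only on the two starting points.\<close>

lemma orbits_comparable:
  assumes "z \<in> \<Omega>" "z' \<in> \<Omega>"
  obtains K where "K > 0" "\<And>s. s \<ge> 0 \<Longrightarrow> Re (F (vert z' s)) \<le> K * Re (F (vert z s))"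
    "\<And>s. s \<ge> 0 \<Longrightarrow> norm (F (vert z' s) - F (vert z s)) \<le> K * Re (F (vert z s))"
proof
  define \<kappa> where "\<kappa> = norm (F z - F z') ^ 2 / (Re (F z) * Re (F z'))"
  have \<kappa>0: "\<kappa> \<ge> 0"
    unfolding \<kappa>_def using F_pos[OF assms(1)] F_pos[OF assms(2)] by simp
  then show "\<kappa> + 2 > 0"
    by simp
  fix s :: real assume s: "s \<ge> 0"
  define a b where "a = F (vert z s)" and "b = F (vert z' s)"
  have pos: "Re a > 0" "Re b > 0"
    using F_pos up assms s by (auto simp: a_def b_def)
  define \<Phi> where "\<Phi> \<zeta> = F (k \<zeta> + \<i> * of_real s)" for \<zeta>
  have "\<Phi> holomorphic_on {\<zeta>. Re \<zeta> > 0}"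
    unfolding \<Phi>_def
    by (rule holomorphic_on_compose_gen[of "\<lambda>\<zeta>. k \<zeta> + \<i> * of_real s" _ F \<Omega>, unfolded o_def])
       (use up k_in s in \<open>auto intro!: holomorphic_intros holk holF\<close>)
  moreover have "Re (\<Phi> \<zeta>) > 0" if "Re \<zeta> > 0" for \<zeta>
    using F_pos up k_in that s by (simp add: \<Phi>_def)
  ultimately have "norm (\<Phi> (F z) - \<Phi> (F z')) ^ 2 / (Re (\<Phi> (F z)) * Re (\<Phi> (F z'))) \<le> \<kappa>"
    unfolding \<kappa>_def by (rule Schwarz_Pick_right_half_plane) (use F_pos assms in auto)
  then have "norm (a - b) ^ 2 / (Re a * Re b) \<le> \<kappa>"
    using assms by (simp add: \<Phi>_def a_def b_def)
  then have le: "norm (a - b) ^ 2 \<le> \<kappa> * (Re a * Re b)"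
    using pos by (simp add: divide_le_eq)
  have "(Re a - Re b) ^ 2 \<le> norm (a - b) ^ 2"
    using abs_Re_le_cmod[of "a - b"] by (metis abs_ge_zero minus_complex.simps(1) power2_abs power_mono)
  \<comment> \<open>Expanding \<open>(Re a - Re b) ^ 2\<close> contributes
    \<open>2 * Re a * Re b\<close>, which replaces \<kappa> by \<open>\<kappa> + 2\<close>.\<close>
  with le have "Re b * Re b \<le> (\<kappa> + 2) * Re a * Re b - Re a * Re a"
    by (simp add: power2_eq_square algebra_simps)
  then have "Re b * Re b \<le> ((\<kappa> + 2) * Re a) * Re b"
    by (smt (verit) zero_le_square)
  then have b_le: "Re b \<le> (\<kappa> + 2) * Re a"
    using pos by (simp add: mult_le_cancel_right)
  then show "Re (F (vert z' s)) \<le> (\<kappa> + 2) * Re (F (vert z s))"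
    by (simp add: a_def b_def)
  have "norm (a - b) ^ 2 \<le> \<kappa> * (Re a * ((\<kappa> + 2) * Re a))"
    using le b_le pos \<kappa>0 by (smt (verit) mult_left_mono)
  also have "\<dots> \<le> (\<kappa> + 2) * (Re a * ((\<kappa> + 2) * Re a))"
    using pos \<kappa>0 by (intro mult_right_mono) auto
  also have "\<dots> = ((\<kappa> + 2) * Re a) ^ 2"
    by (simp add: power2_eq_square)
  finally have "norm (a - b) \<le> (\<kappa> + 2) * Re a"
    by (rule power2_le_imp_le) (use pos \<kappa>0 in simp)
  then show "norm (F (vert z' s) - F (vert z s)) \<le> (\<kappa> + 2) * Re (F (vert z s))"
    by (simp add: a_def b_def norm_minus_commute)
qed

lemma Re_F_orbit_mono:
  assumes "z \<in> \<Omega>" "0 \<le> s" "s \<le> s'"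
  shows "Re (F (vert z s)) \<le> Re (F (vert z s'))"
  using Re_F_up[of "vert z s" "s' - s"] up[of z s] assms by (simp add: algebra_simps)

end

section \<open>Base points\<close>

context half_plane_model
begin

text \<open>As \<open>Im (deriv k)\<close> is nonnegative, \<open>- \<i> * deriv k\<close> has
  nonnegative real part and so grows at most polynomially on the strip; integrating from
  \<open>u\<^sub>1\<close> gives the same for \<open>k\<close>. This is the growth condition for the
  Phragmen-Lindelof argument.\<close>

lemma norm_k_strip_le:
  assumes "0 < u\<^sub>1" "u\<^sub>1 \<le> u\<^sub>2"
  obtains A where "A \<ge> 0" "\<And>\<zeta>. u\<^sub>1 \<le> Re \<zeta> \<Longrightarrow> Re \<zeta> \<le> u\<^sub>2 \<Longrightarrow> norm (k \<zeta>) \<le> A + (1 + A * (u\<^sub>2 + 1 + \<bar>Im \<zeta>\<bar>) ^ 2) * (u\<^sub>2 + \<bar>Im \<zeta>\<bar>)"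
proof
  \<comment> \<open>The summand \<open>1\<close> makes the real part strictly positive, as the
    growth lemma requires.\<close>
  define q where "q \<zeta> = 1 - \<i> * deriv k \<zeta>" for \<zeta>
  have "q holomorphic_on {\<zeta>. Re \<zeta> > 0}"
    unfolding q_def by (intro holomorphic_intros holomorphic_deriv holk open_halfspace_Re_gt)
  moreover have "Re (q \<zeta>) > 0" if "Re \<zeta> > 0" for \<zeta>
    using Im_deriv_k_nonneg[OF that] by (simp add: q_def)
  ultimately have q_le: "norm (q \<zeta>) \<le> norm (q 1) * (norm (\<zeta> + 1) ^ 2 / Re \<zeta>)" if "Re \<zeta> > 0" for \<zeta>
    using norm_positive_real_part_le that by blast
  define A where "A = norm (k (of_real u\<^sub>1)) + norm (q 1) / u\<^sub>1"
  have A: "A \<ge> norm (k (of_real u\<^sub>1))" "A \<ge> norm (q 1) / u\<^sub>1"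
    using assms by (auto simp: A_def)
  then show "A \<ge> 0"
    using norm_ge_zero order_trans by blast
  fix \<zeta> assume \<zeta>: "u\<^sub>1 \<le> Re \<zeta>" "Re \<zeta> \<le> u\<^sub>2"
  define M where "M = 1 + A * (u\<^sub>2 + 1 + \<bar>Im \<zeta>\<bar>) ^ 2"
  have "M \<ge> 0"
    using \<open>A \<ge> 0\<close> by (simp add: M_def)
  have "norm (k \<zeta> - k (of_real u\<^sub>1)) \<le> M * norm (\<zeta> - of_real u\<^sub>1)"
  proof (rule field_differentiable_bound)
    show "convex (closed_segment (of_real u\<^sub>1) \<zeta>)"
      by simp
    fix x assume x: "x \<in> closed_segment (of_real u\<^sub>1) \<zeta>"
    then obtain s where s: "0 \<le> s" "s \<le> 1" "x = (1 - s) *\<^sub>R of_real u\<^sub>1 + s *\<^sub>R \<zeta>"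
      by (auto simp: closed_segment_def)
    have Re_x: "Re x = (1 - s) * u\<^sub>1 + s * Re \<zeta>"
      by (simp add: s)
    have "\<bar>Im x\<bar> \<le> \<bar>Im \<zeta>\<bar>"
      using s by (simp add: abs_mult mult_left_le_one_le)
    have "Re x \<ge> u\<^sub>1"
      unfolding Re_x using s \<zeta> convex_bound_le[of "-u\<^sub>1" "-u\<^sub>1" "-Re \<zeta>" "1-s" s] by simp
    have "Re x \<le> u\<^sub>2"
      unfolding Re_x using s \<zeta> convex_bound_le[of "u\<^sub>1" "u\<^sub>2" "Re \<zeta>" "1-s" s] assms by simp
    have "Re x > 0"
      using \<open>Re x \<ge> u\<^sub>1\<close> assms by simp
    show "(k has_field_derivative deriv k x) (at x within closed_segment (of_real u\<^sub>1) \<zeta>)"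
      using deriv_k[OF \<open>Re x > 0\<close>] by (rule has_field_derivative_at_within)
    have "norm (x + 1) \<le> u\<^sub>2 + 1 + \<bar>Im \<zeta>\<bar>"
      using cmod_le[of "x + 1"] \<open>Re x > 0\<close> \<open>Re x \<le> u\<^sub>2\<close> \<open>\<bar>Im x\<bar> \<le> \<bar>Im \<zeta>\<bar>\<close> by simp
    then have "norm (x + 1) ^ 2 \<le> (u\<^sub>2 + 1 + \<bar>Im \<zeta>\<bar>) ^ 2"
      by (intro power_mono) auto
    have "norm (deriv k x) = norm (1 - q x)"
      by (simp add: q_def norm_mult)
    also have "\<dots> \<le> 1 + norm (q x)"
      by (metis norm_one norm_triangle_ineq4)
    also have "norm (q x) \<le> norm (q 1) * (norm (x + 1) ^ 2 / Re x)"
      using q_le \<open>Re x > 0\<close> .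
    also have "\<dots> \<le> norm (q 1) * ((u\<^sub>2 + 1 + \<bar>Im \<zeta>\<bar>) ^ 2 / u\<^sub>1)"
      using \<open>norm (x + 1) ^ 2 \<le> _\<close> \<open>Re x \<ge> u\<^sub>1\<close> assms by (intro mult_left_mono frac_le) auto
    also have "\<dots> = norm (q 1) / u\<^sub>1 * (u\<^sub>2 + 1 + \<bar>Im \<zeta>\<bar>) ^ 2"
      by simp
    also have "\<dots> \<le> A * (u\<^sub>2 + 1 + \<bar>Im \<zeta>\<bar>) ^ 2"
      using A by (intro mult_right_mono) auto
    finally show "norm (deriv k x) \<le> M"
      by (simp add: M_def)
  qed auto
  also have "\<dots> \<le> M * (u\<^sub>2 + \<bar>Im \<zeta>\<bar>)"
    using \<open>M \<ge> 0\<close> cmod_le[of "\<zeta> - of_real u\<^sub>1"] \<zeta> assms by (intro mult_left_mono) auto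
  finally show "norm (k \<zeta>) \<le> A + (1 + A * (u\<^sub>2 + 1 + \<bar>Im \<zeta>\<bar>) ^ 2) * (u\<^sub>2 + \<bar>Im \<zeta>\<bar>)"
    using A(1) norm_triangle_ineq2[of "k \<zeta>" "k (of_real u\<^sub>1)"] unfolding M_def by linarith
qed

text \<open>Phragmen-Lindelof in a vertical strip: \<open>k\<close> has polynomial growth there, so the barrier
  \<open>cos (c * (\<zeta> - m))\<close>, whose real part grows exponentially, dominates.\<close>

lemma Re_k_ge_strip:
  assumes "0 < u\<^sub>1" "u\<^sub>1 < u\<^sub>2"
    and left: "\<And>V. x \<le> Re (k (Complex u\<^sub>1 V))" and right: "\<And>V. x \<le> Re (k (Complex u\<^sub>2 V))"
    and \<zeta>: "u\<^sub>1 < Re \<zeta>" "Re \<zeta> < u\<^sub>2"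
  shows "x \<le> Re (k \<zeta>)"
proof -
  define S where "S = {\<zeta>. u\<^sub>1 < Re \<zeta> \<and> Re \<zeta> < u\<^sub>2}"
  define c where "c = pi / (2 * (u\<^sub>2 - u\<^sub>1))"
  define m where "m = (u\<^sub>1 + u\<^sub>2) / 2"
  define C where "C \<zeta> = Re (cos (of_real c * (\<zeta> - of_real m)))" for \<zeta> :: complex
  have "c > 0"
    using assms by (simp add: c_def)
  have C_ge: "C \<zeta> \<ge> exp (c * \<bar>Im \<zeta>\<bar>) / 4" if "u\<^sub>1 \<le> Re \<zeta>" "Re \<zeta> \<le> u\<^sub>2" for \<zeta>
  proof -
    \<comment> \<open>The choice of \<open>c\<close> keeps the angle within \<open>pi / 4\<close>.
      It is relaxed to \<open>pi / 3\<close>, where the cosine has the rational value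
      \<open>1 / 2\<close>.\<close>
    have "\<bar>c * (Re \<zeta> - m)\<bar> \<le> pi / 3"
    proof -
      have scale: "pi / (2 * d) * (d / 2) = pi / 4" if "d \<noteq> 0" for d
        using that by simp
      have "\<bar>Re \<zeta> - m\<bar> \<le> (u\<^sub>2 - u\<^sub>1) / 2"
        unfolding m_def abs_le_iff using that by (simp add: field_simps)
      then have "\<bar>c * (Re \<zeta> - m)\<bar> \<le> c * ((u\<^sub>2 - u\<^sub>1) / 2)"
        using \<open>c > 0\<close> unfolding abs_mult by (intro mult_mono) auto
      also have "\<dots> = pi / 4"
        using scale[of "u\<^sub>2 - u\<^sub>1"] \<open>u\<^sub>1 < u\<^sub>2\<close> by (simp add: c_def del: times_divide_eq_left times_divide_eq_right)
      also have "\<dots> \<le> pi / 3"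
        using pi_gt_zero by linarith
      finally show ?thesis .
    qed
    then have "cos (pi / 3) \<le> cos \<bar>c * (Re \<zeta> - m)\<bar>"
      by (intro cos_monotone_0_pi_le) (use pi_gt_zero in linarith)+
    then have half: "1 / 2 \<le> cos (c * (Re \<zeta> - m))"
      by (simp add: cos_60 cos_abs_real)
    have "exp (c * \<bar>Im \<zeta>\<bar>) / 2 \<le> (exp (c * Im \<zeta>) + exp (- (c * Im \<zeta>))) / 2"
      by (cases "Im \<zeta> \<ge> 0") auto
    then have "1 / 2 * (exp (c * \<bar>Im \<zeta>\<bar>) / 2) \<le> cos (c * (Re \<zeta> - m)) * ((exp (c * Im \<zeta>) + exp (- (c * Im \<zeta>))) / 2)"
      using half by (intro mult_mono) auto
    then show ?thesis
      by (simp add: C_def Re_cos)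
  qed
  obtain A where A: "A \<ge> 0" "\<And>\<zeta>. u\<^sub>1 \<le> Re \<zeta> \<Longrightarrow> Re \<zeta> \<le> u\<^sub>2 \<Longrightarrow> norm (k \<zeta>) \<le> A + (1 + A * (u\<^sub>2 + 1 + \<bar>Im \<zeta>\<bar>) ^ 2) * (u\<^sub>2 + \<bar>Im \<zeta>\<bar>)"
    using norm_k_strip_le[of u\<^sub>1 u\<^sub>2] assms by auto
  have le: "x - Re (k \<zeta>) \<le> \<epsilon> * C \<zeta>" if "\<epsilon> > 0" for \<epsilon>
  proof -
    define f where "f \<zeta> = of_real x - k \<zeta> - of_real \<epsilon> * cos (of_real c * (\<zeta> - of_real m))" for \<zeta>
    have Re_f: "Re (f \<zeta>) = x - Re (k \<zeta>) - \<epsilon> * C \<zeta>" for \<zeta>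
      by (simp add: f_def C_def)
    have S_eq: "S = {\<zeta>. u\<^sub>1 < Re \<zeta>} \<inter> {\<zeta>. Re \<zeta> < u\<^sub>2}"
      by (auto simp: S_def)
    have "open S"
      unfolding S_eq by (intro open_Int open_halfspace_Re_gt open_halfspace_Re_lt)
    have clS: "closure S \<subseteq> {\<zeta>. u\<^sub>1 \<le> Re \<zeta>} \<inter> {\<zeta>. Re \<zeta> \<le> u\<^sub>2}"
      by (intro closure_minimal closed_Int closed_halfspace_Re_ge closed_halfspace_Re_le) (auto simp: S_def)
    have "Re (f \<zeta>) \<le> 0"
    proof (rule Re_le_if_limsup_le[of S f])
      show "f holomorphic_on S"
        unfolding f_def
        by (intro holomorphic_intros holomorphic_on_subset[OF holk]) (use assms in \<open>auto simp: S_def\<close>)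
      show "\<zeta> \<in> S"
        using \<zeta> by (simp add: S_def)
    next
      fix \<xi> \<delta> assume "\<xi> \<in> frontier S" "(\<delta>::real) > 0"
      then have \<xi>: "\<xi> \<in> closure S" "\<xi> \<notin> S"
        using \<open>open S\<close> by (auto simp: frontier_def interior_open)
      then have "Re \<xi> = u\<^sub>1 \<or> Re \<xi> = u\<^sub>2" and ge: "u\<^sub>1 \<le> Re \<xi>" "Re \<xi> \<le> u\<^sub>2"
        using clS by (force simp: S_def)+
      then have "x \<le> Re (k \<xi>)"
        using left[of "Im \<xi>"] right[of "Im \<xi>"] by (metis complex.collapse)
      moreover have "C \<xi> \<ge> 0"
        using C_ge[OF ge] by (smt (verit) divide_nonneg_nonneg exp_ge_zero)
      ultimately have "Re (f \<xi>) \<le> 0"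
        using \<open>\<epsilon> > 0\<close> by (simp add: Re_f) (smt (verit) mult_nonneg_nonneg)
      have "isCont k \<xi>"
        using ge assms by (intro isCont_k) simp
      then have "(k \<longlongrightarrow> k \<xi>) (at \<xi> within S)"
        by (simp add: continuous_at_imp_continuous_at_within continuous_within[symmetric])
      then have "((\<lambda>z. Re (f z)) \<longlongrightarrow> Re (f \<xi>)) (at \<xi> within S)"
        unfolding f_def by (intro tendsto_intros)
      moreover have "Re (f \<xi>) < 0 + \<delta>"
        using \<open>Re (f \<xi>) \<le> 0\<close> \<open>\<delta> > 0\<close> by simp
      ultimately have "\<forall>\<^sub>F z in at \<xi> within S. Re (f z) < 0 + \<delta>"
        by (rule order_tendstoD)
      then show "\<forall>\<^sub>F z in at \<xi> within S. Re (f z) \<le> 0 + \<delta>"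
        by (auto elim: eventually_mono)
    next
      fix \<delta> :: real assume "\<delta> > 0"
      \<comment> \<open>For each fixed \<epsilon> the polynomial bound for \<open>k\<close> loses
        against the exponential barrier, so \<open>Re f\<close> is nonpositive far out.\<close>
      have "\<forall>\<^sub>F V in at_top. \<bar>x\<bar> + (A + (1 + A * (u\<^sub>2 + 1 + V) ^ 2) * (u\<^sub>2 + V)) \<le> \<epsilon> * (exp (c * V) / 4)"
        using \<open>c > 0\<close> \<open>\<epsilon> > 0\<close> by real_asymp
      then obtain V\<^sub>0 where V0: "\<And>V. V \<ge> V\<^sub>0 \<Longrightarrow> \<bar>x\<bar> + (A + (1 + A * (u\<^sub>2 + 1 + V) ^ 2) * (u\<^sub>2 + V)) \<le> \<epsilon> * (exp (c * V) / 4)"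
        by (auto simp: eventually_at_top_linorder)
      show "\<exists>R. \<forall>z\<in>S. norm z \<ge> R \<longrightarrow> Re (f z) \<le> 0 + \<delta>"
      proof (intro exI[of _ "u\<^sub>2 + V\<^sub>0"] ballI impI)
        fix z assume z: "z \<in> S" "norm z \<ge> u\<^sub>2 + V\<^sub>0"
        then have Re_z: "u\<^sub>1 \<le> Re z" "Re z \<le> u\<^sub>2"
          by (auto simp: S_def)
        have "\<bar>Im z\<bar> \<ge> V\<^sub>0"
          using cmod_le[of z] z Re_z assms by simp
        have "x - Re (k z) \<le> \<bar>x\<bar> + norm (k z)"
          using abs_Re_le_cmod[of "k z"] by linarith
        also have "\<dots> \<le> \<epsilon> * (exp (c * \<bar>Im z\<bar>) / 4)"
          using V0[OF \<open>\<bar>Im z\<bar> \<ge> V\<^sub>0\<close>] A(2)[OF Re_z] by linarith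
        also have "\<dots> \<le> \<epsilon> * C z"
          using C_ge[OF Re_z] \<open>\<epsilon> > 0\<close> by (intro mult_left_mono) auto
        finally show "Re (f z) \<le> 0 + \<delta>"
          using \<open>\<delta> > 0\<close> by (simp add: Re_f)
      qed
    qed fact
    then show ?thesis
      by (simp add: Re_f)
  qed
  have "((\<lambda>\<epsilon>. \<epsilon> * C \<zeta>) \<longlongrightarrow> 0 * C \<zeta>) (at_right 0)"
    by (intro tendsto_intros)
  moreover have "\<forall>\<^sub>F \<epsilon> in at_right 0. x - Re (k \<zeta>) \<le> \<epsilon> * C \<zeta>"
    using eventually_at_right_less[of "0::real"] by eventually_elim (use le in auto)
  ultimately have "x - Re (k \<zeta>) \<le> 0 * C \<zeta>"
    by (rule tendsto_lowerbound) simp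
  then show ?thesis
    by simp
qed

text \<open>If the orbit of \<open>p\<close> stays in the strip and moves up to \<open>+\<infinity>\<close>, then the region to its left would be mapped
  outside the strip, so that \<open>Re F\<close> decreases in the horizontal direction along the orbit. By the
  Cauchy-Riemann equations \<open>Im F\<close> would then decrease along the orbit.\<close>

lemma Re_k_le_somewhere_if_orbit_upwards:
  assumes p: "p \<in> \<Omega>" and bdd: "\<And>s. s \<ge> 0 \<Longrightarrow> Re (F (vert p s)) \<le> B"
    and lim: "filterlim (\<lambda>s. Im (F (vert p s))) at_top at_top"
    and u1: "0 < u\<^sub>1" "u\<^sub>1 < Re (F p)"
  obtains V where "Re (k (Complex u\<^sub>1 V)) \<le> Re p"
proof (rule ccontr)
  assume "\<not> thesis"
  with that have left: "Re (k (Complex u\<^sub>1 V)) > Re p" for V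
    by (meson not_less)
  define U where "U s = Re (F (vert p s))" for s
  have U_mono: "U s \<le> U s'" if "0 \<le> s" "s \<le> s'" for s s'
    using Re_F_orbit_mono[OF p that] by (simp add: U_def)
  have bddU: "bdd_above (U ` {0..})"
    using bdd by (auto simp: U_def intro!: bdd_aboveI[of _ B])
  define u\<^sub>2 where "u\<^sub>2 = Sup (U ` {0..})"
  have U_le: "U s \<le> u\<^sub>2" if "s \<ge> 0" for s
    unfolding u\<^sub>2_def using that bddU by (intro cSup_upper) auto
  have "U 0 = Re (F p)"
    by (simp add: U_def)
  then have "u\<^sub>1 < u\<^sub>2"
    using U_le[of 0] u1 by simp
  have U_lim: "(U \<longlongrightarrow> u\<^sub>2) at_top"
  proof (rule increasing_tendsto)
    show "\<forall>\<^sub>F n in at_top. U n \<le> u\<^sub>2"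
      using eventually_ge_at_top[of 0] by eventually_elim (rule U_le)
    fix x assume "x < u\<^sub>2"
    then obtain s where s: "s \<ge> 0" "x < U s"
      unfolding u\<^sub>2_def using less_cSup_iff[OF _ bddU] by auto
    show "\<forall>\<^sub>F n in at_top. x < U n"
      using eventually_ge_at_top[of s] by eventually_elim (use U_mono s in \<open>force intro: less_le_trans\<close>)
  qed
  \<comment> \<open>The line at level \<open>u\<^sub>2\<close> is the limit of the vertical lines
    through orbit points. Since \<open>Im F\<close> tends to infinity, a point at the fixed height
    \<open>V\<close> eventually lies below the orbit point on its line, and
    \<open>Re_k_antimono\<close> bounds the abscissa of its image by \<open>Re p\<close>.\<close>
  have right: "Re p \<le> Re (k (Complex u\<^sub>2 V))" for V
  proof -
    have "((\<lambda>s. Complex (U s) V) \<longlongrightarrow> Complex u\<^sub>2 V) at_top"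
      by (intro tendsto_Complex U_lim tendsto_const)
    then have "((\<lambda>s. Re (k (Complex (U s) V))) \<longlongrightarrow> Re (k (Complex u\<^sub>2 V))) at_top"
      using u1 \<open>u\<^sub>1 < u\<^sub>2\<close> by (intro tendsto_Re isCont_tendsto_compose[of _ k] isCont_k) auto
    moreover have "\<forall>\<^sub>F s in at_top. Im (F (vert p s)) \<ge> V"
      using lim by (simp add: filterlim_at_top)
    then have "\<forall>\<^sub>F s in at_top. Re p \<le> Re (k (Complex (U s) V))"
      using eventually_ge_at_top[of 0]
    proof eventually_elim
      case (elim s)
      have ps: "vert p s \<in> \<Omega>"
        using up p elim by simp
      have "Re (k (F (vert p s))) \<le> Re (k (Complex (U s) V))"
        by (rule Re_k_antimono) (use F_pos[OF ps] elim in \<open>auto simp: U_def\<close>)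
      then show ?case
        using ps by simp
    qed
    ultimately show ?thesis
      by (rule tendsto_lowerbound) simp
  qed
  have strip: "Re p \<le> Re z" if "z \<in> \<Omega>" "u\<^sub>1 < Re (F z)" "Re (F z) < u\<^sub>2" for z
    using Re_k_ge_strip[of u\<^sub>1 u\<^sub>2 "Re p" "F z"] left right u1 \<open>u\<^sub>1 < u\<^sub>2\<close> that by (simp add: less_imp_le)
  have nonpos: "Re (deriv F (vert p s)) \<le> 0" if s: "s \<ge> 0" for s
  proof -
    define z where "z = vert p s"
    have z: "z \<in> \<Omega>"
      using up p s by (simp add: z_def)
    have Uz: "Re (F z) = U s"
      by (simp add: z_def U_def)
    have "((\<lambda>\<eta>. Re (F (z + (-1) * of_real \<eta>))) has_field_derivative Re ((-1) * deriv F z)) (at 0)"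
      using DERIV_Re_F_line[of z "-1" 0] z by simp
    \<comment> \<open>A point slightly to the left of the orbit cannot have a level strictly between
      \<open>u\<^sub>1\<close> and \<open>u\<^sub>2\<close>, because \<open>strip\<close> would put
      it on the right. By continuity its level exceeds \<open>u\<^sub>1\<close>, so it is at least
      \<open>u\<^sub>2\<close>, the supremum along the orbit.\<close>
    moreover have "\<forall>\<^sub>F \<eta> in at_right 0. Re (F (z + (-1) * of_real 0)) \<le> Re (F (z + (-1) * of_real \<eta>))"
    proof -
      have lim: "((\<lambda>\<eta>. z - of_real \<eta>) \<longlongrightarrow> z) (at_right 0)"
        by (auto intro!: tendsto_eq_intros)
      then have "((\<lambda>\<eta>. Re (F (z - of_real \<eta>))) \<longlongrightarrow> Re (F z)) (at_right 0)"
        by (intro tendsto_Re isCont_tendsto_compose[OF isCont_F[OF z]])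
      moreover have "u\<^sub>1 < Re (F z)"
        using u1 U_mono[of 0 s] s \<open>U 0 = Re (F p)\<close> by (simp add: Uz)
      ultimately have "\<forall>\<^sub>F \<eta> in at_right 0. u\<^sub>1 < Re (F (z - of_real \<eta>))"
        by (rule order_tendstoD)
      moreover have "\<forall>\<^sub>F \<eta> in at_right 0. z - of_real \<eta> \<in> \<Omega>"
        using lim open_domain z by (rule topological_tendstoD)
      ultimately show ?thesis
        using eventually_at_right_less[of "0::real"]
      proof eventually_elim
        case (elim \<eta>)
        have "\<not> Re (F (z - of_real \<eta>)) < u\<^sub>2"
          using strip[of "z - of_real \<eta>"] elim by (auto simp: z_def)
        then show ?case
          using U_le[OF s] by (simp add: Uz)
      qed
    qed
    ultimately have "Re ((-1) * deriv F z) \<ge> 0"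
      by (rule DERIV_nonneg_if_mono_right)
    then show ?thesis
      by (simp add: z_def)
  qed
  have "Im (F (vert p s)) \<le> Im (F (p + \<i> * of_real 0))" if "s \<ge> 0" for s
  proof (rule DERIV_nonpos_imp_nonincreasing[OF that])
    fix s' assume s': "0 \<le> s'" "s' \<le> s"
    have "((\<lambda>s. Im (F (vert p s))) has_field_derivative Im (\<i> * deriv F (vert p s'))) (at s')"
      by (rule DERIV_Im_F_line) (use up p s' in simp)
    moreover have "Im (\<i> * deriv F (vert p s')) \<le> 0"
      using nonpos[OF s'(1)] by simp
    ultimately show "\<exists>y. ((\<lambda>s. Im (F (vert p s))) has_field_derivative y) (at s') \<and> y \<le> 0"
      by blast
  qed
  moreover have "\<forall>\<^sub>F s in at_top. Im (F (vert p s)) \<ge> Im (F p) + 1"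
    using lim by (simp add: filterlim_at_top)
  then obtain s\<^sub>0 where "\<And>s. s \<ge> s\<^sub>0 \<Longrightarrow> Im (F (vert p s)) \<ge> Im (F p) + 1"
    by (auto simp: eventually_at_top_linorder)
  ultimately show False
    by (smt (verit) max.cobounded1 max.cobounded2 mult_zero_right of_real_0 add.right_neutral)
qed

text \<open>\<open>F\<close> tends to infinity along the orbit while its real part stays bounded, so
  the imaginary part carries the divergence and continuity fixes its sign.\<close>

lemma Im_F_orbit_cases:
  assumes p: "p \<in> \<Omega>" and bdd: "\<And>s. s \<ge> 0 \<Longrightarrow> Re (F (vert p s)) \<le> B"
  shows "filterlim (\<lambda>s. Im (F (vert p s))) at_top at_top \<or>
         filterlim (\<lambda>s. Im (F (vert p s))) at_bot at_top"
proof (rule filterlim_abs_at_top_cases)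
  show "continuous_on {0..} (\<lambda>s. Im (F (vert p s)))"
    by (intro continuous_on_Im continuous_on_compose2[OF continuous_on_F] continuous_intros) (use up p in auto)
  have "filterlim (\<lambda>s. norm (F (vert p s))) at_top at_top"
    using F_at_infinity[OF p] by (simp add: filterlim_at_infinity_conv_norm_at_top)
  then have "filterlim (\<lambda>s. - B + norm (F (vert p s))) at_top at_top"
    by (intro filterlim_tendsto_add_at_top[OF tendsto_const])
  then show "filterlim (\<lambda>s. \<bar>Im (F (vert p s))\<bar>) at_top at_top"
  proof (rule filterlim_at_top_mono)
    show "\<forall>\<^sub>F s in at_top. - B + norm (F (vert p s)) \<le> \<bar>Im (F (vert p s))\<bar>"
      using eventually_ge_at_top[of 0]
    proof eventually_elim
      case (elim s)
      have "Re (F (vert p s)) > 0"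
        using F_pos up p elim by simp
      then show ?case
        using cmod_le[of "F (vert p s)"] bdd[OF elim] by simp
    qed
  qed
qed

text \<open>The second alternative supplies base points for upper bounds of the slope, at levels
  that the orbit of \<open>p\<close> exceeds by any prescribed factor. In the first alternative the
  slope is eventually negative, so the upper bound is immediate. The point \<open>p\<^sub>1\<close>
  is kept apart from \<open>p\<close> because in one application the abscissa is dictated by a
  boundary point.\<close>

lemma right_base_point:
  assumes p: "p \<in> \<Omega>" and p1: "p\<^sub>1 \<in> \<Omega>"
  shows "(\<exists>B. \<forall>s\<ge>0. Re (F (vert p s)) \<le> B) \<and> filterlim (\<lambda>s. Im (F (vert p s))) at_bot at_top \<or>
    (\<forall>C. \<exists>\<omega>. Re \<omega> > 0 \<and> Re (k \<omega>) \<le> Re p\<^sub>1 \<and> (\<forall>\<^sub>F s in at_top. C * Re \<omega> < Re (F (vert p s))))"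
proof (cases "\<exists>B. \<forall>s\<ge>0. Re (F (vert p s)) \<le> B")
  case False
  have "\<forall>\<^sub>F s in at_top. C * Re (F p\<^sub>1) < Re (F (vert p s))" for C
  proof -
    obtain s\<^sub>0 where "s\<^sub>0 \<ge> 0" "Re (F (vert p s\<^sub>0)) > C * Re (F p\<^sub>1)"
      using False by (meson not_le)
    show ?thesis
      using eventually_ge_at_top[of s\<^sub>0]
      by eventually_elim (use Re_F_orbit_mono[OF p \<open>s\<^sub>0 \<ge> 0\<close>] \<open>Re (F (vert p s\<^sub>0)) > _\<close> in \<open>force intro: less_le_trans\<close>)
  qed
  then show ?thesis
    using F_pos[OF p1] p1 by (intro disjI2 allI exI[of _ "F p\<^sub>1"]) auto
next
  case True
  then obtain B where B: "\<And>s. s \<ge> 0 \<Longrightarrow> Re (F (vert p s)) \<le> B"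
    by blast
  obtain K where K: "K > 0" "\<And>s. s \<ge> 0 \<Longrightarrow> Re (F (vert p\<^sub>1 s)) \<le> K * Re (F (vert p s))"
    "\<And>s. s \<ge> 0 \<Longrightarrow> norm (F (vert p\<^sub>1 s) - F (vert p s)) \<le> K * Re (F (vert p s))"
    using orbits_comparable[OF p p1] by blast
  have KB: "K * Re (F (vert p s)) \<le> K * B" if "s \<ge> 0" for s
    using B[OF that] K(1) by simp
  have B1: "Re (F (vert p\<^sub>1 s)) \<le> K * B" if "s \<ge> 0" for s
    using K(2)[OF that] KB[OF that] by linarith
  show ?thesis
    using Im_F_orbit_cases[OF p1 B1]
  proof
    assume lim: "filterlim (\<lambda>s. Im (F (vert p\<^sub>1 s))) at_top at_top"
    have "\<exists>\<omega>. Re \<omega> > 0 \<and> Re (k \<omega>) \<le> Re p\<^sub>1 \<and> (\<forall>\<^sub>F s in at_top. C * Re \<omega> < Re (F (vert p s)))" for C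
    proof -
      \<comment> \<open>A level below \<open>e\<close> makes \<open>C * u\<^sub>1\<close> smaller
        than the initial level \<open>Re (F p)\<close>, which the orbit never undercuts;
        \<open>\<bar>C\<bar> + 1\<close> serves \<open>C\<close> of either sign.\<close>
      define e where "e = Re (F p) / (\<bar>C\<bar> + 1)"
      define u\<^sub>1 where "u\<^sub>1 = min (Re (F p\<^sub>1) / 2) (e / 2)"
      have pos: "Re (F p\<^sub>1) > 0" "Re (F p) > 0"
        using F_pos p p1 by auto
      then have "e > 0"
        by (simp add: e_def add_nonneg_pos)
      then have u1: "0 < u\<^sub>1" "u\<^sub>1 < Re (F p\<^sub>1)" "u\<^sub>1 < e"
        using pos by (auto simp: u\<^sub>1_def)
      obtain V where V: "Re (k (Complex u\<^sub>1 V)) \<le> Re p\<^sub>1"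
        using Re_k_le_somewhere_if_orbit_upwards[OF p1 B1 lim u1(1,2)] by blast
      have "C * u\<^sub>1 \<le> (\<bar>C\<bar> + 1) * u\<^sub>1"
        using u1(1) by (intro mult_right_mono) auto
      also have "\<dots> < Re (F p)"
        using u1(3) by (simp add: e_def less_divide_eq add_nonneg_pos mult.commute)
      finally have "C * u\<^sub>1 < Re (F p)" .
      have "\<forall>\<^sub>F s in at_top. C * u\<^sub>1 < Re (F (vert p s))"
        using eventually_ge_at_top[of "0::real"]
        by eventually_elim (rule less_le_trans[OF \<open>C * u\<^sub>1 < Re (F p)\<close> Re_F_up[OF p]])
      then show ?thesis
        using V u1 by (intro exI[of _ "Complex u\<^sub>1 V"]) simp
    qed
    then show ?thesis
      by blast
  next
    assume lim: "filterlim (\<lambda>s. Im (F (vert p\<^sub>1 s))) at_bot at_top"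
    \<comment> \<open>The values of \<open>F\<close> along the two orbits differ by at most
      \<open>K * B\<close>, so the divergence passes from \<open>p\<^sub>1\<close> back to
      \<open>p\<close>.\<close>
    have "filterlim (\<lambda>s. Im (F (vert p s))) at_bot at_top"
      unfolding filterlim_at_bot
    proof
      fix Z
      have "\<forall>\<^sub>F s in at_top. Im (F (vert p\<^sub>1 s)) \<le> Z - K * B"
        using lim by (simp add: filterlim_at_bot)
      then show "\<forall>\<^sub>F s in at_top. Im (F (vert p s)) \<le> Z"
        using eventually_ge_at_top[of 0]
      proof eventually_elim
        case (elim s)
        then show ?case
          using abs_Im_le_cmod[of "F (vert p\<^sub>1 s) - F (vert p s)"] K(3) KB[of s] by fastforce
      qed
    qed
    then show ?thesis
      using True by blast
  qed
qed

end

section \<open>Comparison with explicit harmonic functions\<close>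

lemma tendsto_le_at_within:
  assumes "isCont f \<xi>" "f \<xi> \<le> (0::real)" "\<delta> > 0"
  shows "eventually (\<lambda>z. f z \<le> \<delta>) (at \<xi> within S)"
proof -
  have "(f \<longlongrightarrow> f \<xi>) (at \<xi> within S)"
    using assms(1) by (simp add: continuous_at_imp_continuous_at_within continuous_within[symmetric])
  moreover have "f \<xi> < \<delta>"
    using assms by simp
  ultimately have "eventually (\<lambda>z. f z < \<delta>) (at \<xi> within S)"
    by (rule order_tendstoD)
  then show ?thesis
    by (auto elim: eventually_mono)
qed

text \<open>Infinity is a negligible boundary point: subtract \<open>\<epsilon> * Ln\<close>.\<close>

lemma Re_nonpos_if_limsup_half_plane:
  assumes "open S" and S: "\<And>\<zeta>. \<zeta> \<in> S \<Longrightarrow> Re \<zeta> > u" and holf: "f holomorphic_on S"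
    and bound: "\<And>\<zeta>. \<zeta> \<in> S \<Longrightarrow> Re (f \<zeta>) \<le> M"
    and fr: "\<And>\<xi> \<delta>. \<xi> \<in> frontier S \<Longrightarrow> \<delta> > 0 \<Longrightarrow> eventually (\<lambda>z. Re (f z) \<le> \<delta>) (at \<xi> within S)"
    and "\<zeta> \<in> S"
  shows "Re (f \<zeta>) \<le> 0"
proof -
  \<comment> \<open>The shift moves \<open>S\<close> into the region where the real part exceeds
    \<open>1\<close>. There the subtracted logarithm has nonnegative real part, so the frontier
    estimates survive.\<close>
  have ln_nonneg: "Re (Ln (z - of_real u + 1)) \<ge> 0" and ln_eq: "Re (Ln (z - of_real u + 1)) = ln (norm (z - of_real u + 1))"
    and Re_pos: "Re (z - of_real u + 1) > 0" if "z \<in> S" for z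
  proof -
    have "Re (z - of_real u + 1) \<ge> 1"
      using S[OF that] by simp
    then show "Re (z - of_real u + 1) > 0"
      by simp
    then have "z - of_real u + 1 \<noteq> 0"
      by (metis less_irrefl zero_complex.simps(1))
    then show *: "Re (Ln (z - of_real u + 1)) = ln (norm (z - of_real u + 1))"
      by simp
    have "norm (z - of_real u + 1) \<ge> 1"
      using \<open>Re (z - of_real u + 1) \<ge> 1\<close> complex_Re_le_cmod order_trans by blast
    then show "Re (Ln (z - of_real u + 1)) \<ge> 0"
      unfolding * by simp
  qed
  have le: "Re (f \<zeta>) \<le> \<epsilon> * Re (Ln (\<zeta> - of_real u + 1))" if "\<epsilon> > 0" for \<epsilon>
  proof -
    define g where "g z = f z - of_real \<epsilon> * Ln (z - of_real u + 1)" for z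
    have Re_g: "Re (g z) = Re (f z) - \<epsilon> * Re (Ln (z - of_real u + 1))" for z
      by (simp add: g_def)
    have "Re (g \<zeta>) \<le> 0"
    proof (rule Re_le_if_limsup_le[OF \<open>open S\<close> _ _ _ \<open>\<zeta> \<in> S\<close>])
      show "g holomorphic_on S"
        unfolding g_def
        by (intro holomorphic_intros holf) (use Re_pos complex_nonpos_Reals_iff in force)
    next
      fix \<xi> \<delta> assume "\<xi> \<in> frontier S" "(\<delta>::real) > 0"
      then have "eventually (\<lambda>z. Re (f z) \<le> \<delta>) (at \<xi> within S)"
        by (rule fr)
      moreover have "eventually (\<lambda>z. z \<in> S) (at \<xi> within S)"
        by (simp add: eventually_at_filter)
      ultimately show "eventually (\<lambda>z. Re (g z) \<le> 0 + \<delta>) (at \<xi> within S)"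
      proof eventually_elim
        case (elim z)
        have "\<epsilon> * Re (Ln (z - of_real u + 1)) \<ge> 0"
          using ln_nonneg[OF elim(2)] \<open>\<epsilon> > 0\<close> by (intro mult_nonneg_nonneg) auto
        then show ?case
          using elim(1) unfolding Re_g by linarith
      qed
    next
      fix \<delta> :: real assume "\<delta> > 0"
      show "\<exists>R. \<forall>z\<in>S. norm z \<ge> R \<longrightarrow> Re (g z) \<le> 0 + \<delta>"
      \<comment> \<open>Beyond this radius \<epsilon> times the logarithm outweighs the bound
        \<open>M\<close>; the summand \<open>\<bar>u\<bar> + 1\<close> pays for the shift.\<close>
      proof (intro exI[of _ "exp (\<bar>M\<bar> / \<epsilon>) + \<bar>u\<bar> + 1"] ballI impI)
        fix z assume z: "z \<in> S" "norm z \<ge> exp (\<bar>M\<bar> / \<epsilon>) + \<bar>u\<bar> + 1"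
        have "norm z \<le> norm (z - of_real u + 1) + norm (of_real u - 1 :: complex)"
          using norm_triangle_ineq[of "z - of_real u + 1" "of_real u - 1"] by simp
        moreover have "norm (of_real u - 1 :: complex) \<le> \<bar>u\<bar> + 1"
          using norm_triangle_ineq4[of "of_real u :: complex" 1] by simp
        ultimately have "exp (\<bar>M\<bar> / \<epsilon>) \<le> norm (z - of_real u + 1)"
          using z(2) by linarith
        then have "\<bar>M\<bar> / \<epsilon> \<le> ln (norm (z - of_real u + 1))"
          by (subst ln_ge_iff) (auto intro: less_le_trans[OF exp_gt_zero])
        then have "\<bar>M\<bar> \<le> \<epsilon> * Re (Ln (z - of_real u + 1))"
          using \<open>\<epsilon> > 0\<close> unfolding ln_eq[OF z(1)] by (simp add: divide_le_eq mult.commute)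
        then show "Re (g z) \<le> 0 + \<delta>"
          using bound[OF z(1)] \<open>\<delta> > 0\<close> unfolding Re_g by linarith
      qed
    qed
    then show ?thesis
      by (simp add: Re_g)
  qed
  have "((\<lambda>\<epsilon>. \<epsilon> * Re (Ln (\<zeta> - of_real u + 1))) \<longlongrightarrow> 0 * Re (Ln (\<zeta> - of_real u + 1))) (at_right 0)"
    by (intro tendsto_intros)
  moreover have "\<forall>\<^sub>F \<epsilon> in at_right 0. Re (f \<zeta>) \<le> \<epsilon> * Re (Ln (\<zeta> - of_real u + 1))"
    using eventually_at_right_less[of "0::real"] by eventually_elim (use le in auto)
  ultimately have "Re (f \<zeta>) \<le> 0 * Re (Ln (\<zeta> - of_real u + 1))"
    by (rule tendsto_lowerbound) simp
  then show ?thesis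
    by simp
qed

text \<open>\<open>2 / \<pi>\<close> times this function is the harmonic measure of the arc in the right half of the unit disc.\<close>

definition half_disc_angle :: "complex \<Rightarrow> real" where
  "half_disc_angle s = Im (Ln (1 + \<i> * s)) - Im (Ln (1 - \<i> * s))"

lemma Im_Ln_right_half_plane: "Re z > 0 \<Longrightarrow> Im (Ln z) = arctan (Im z / Re z)"
  using arg_conv_arctan[of z] Arg_eq_Im_Ln[of z] by fastforce

lemma half_disc_angle_arctan:
  assumes "\<bar>Im s\<bar> < 1"
  shows "half_disc_angle s = arctan (Re s / (1 - Im s)) + arctan (Re s / (1 + Im s))"
proof -
  have "Re (1 + \<i> * s) > 0" "Re (1 - \<i> * s) > 0"
    using assms by auto
  then show ?thesis
    by (simp add: half_disc_angle_def Im_Ln_right_half_plane arctan_minus)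
qed

lemma half_disc_angle_nonneg:
  assumes "\<bar>Im s\<bar> < 1" "Re s \<ge> 0"
  shows "half_disc_angle s \<ge> 0"
  using assms by (simp add: half_disc_angle_arctan)

text \<open>A point of the unit circle sees the diameter from \<open>- \<i>\<close> to
  \<open>\<i>\<close> under a right angle. In terms of \<open>half_disc_angle_arctan\<close>, the
  two arctangents have reciprocal arguments because
  \<open>Re s ^ 2 = (1 + Im s) * (1 - Im s)\<close>.\<close>

lemma half_disc_angle_arc:
  assumes "norm s = 1" "Re s > 0"
  shows "half_disc_angle s = pi / 2"
proof -
  have sq: "Re s ^ 2 + Im s ^ 2 = 1"
    using assms(1) cmod_power2[of s] by simp
  then have "Im s ^ 2 < 1"
    using assms(2) by (smt (verit) zero_less_power)
  then have im: "\<bar>Im s\<bar> < 1"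
    by (simp add: abs_square_less_1)
  have "Re s / (1 + Im s) = 1 / (Re s / (1 - Im s))"
  proof -
    have "Re s * Re s = (1 + Im s) * (1 - Im s)"
      using sq by (simp add: power2_eq_square algebra_simps)
    moreover have "1 + Im s \<noteq> 0"
      using im by auto
    ultimately show ?thesis
      using assms(2) by (simp add: field_simps)
  qed
  moreover have "Re s / (1 - Im s) > 0"
    using assms(2) im by simp
  ultimately show ?thesis
    using im arctan_inverse[of "Re s / (1 - Im s)"] by (simp add: half_disc_angle_arctan)
qed

lemma half_disc_angle_le:
  assumes "norm s < 1 / 2"
  shows "half_disc_angle s \<le> 4 * norm s"
proof -
  have "norm (Ln (1 + \<i> * s)) \<le> 2 * norm s" "norm (Ln (1 + - \<i> * s)) \<le> 2 * norm s"
    using norm_Ln_le[of "\<i> * s"] norm_Ln_le[of "- \<i> * s"] assms by (simp_all add: norm_mult)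
  then show ?thesis
    unfolding half_disc_angle_def
    using abs_Im_le_cmod[of "Ln (1 + \<i> * s)"] abs_Im_le_cmod[of "Ln (1 - \<i> * s)"] by simp
qed

lemma isCont_half_disc_angle:
  assumes "\<bar>Im s\<bar> < 1"
  shows "isCont half_disc_angle s"
proof -
  have "1 + \<i> * s \<notin> \<real>\<^sub>\<le>\<^sub>0" "1 - \<i> * s \<notin> \<real>\<^sub>\<le>\<^sub>0"
    using assms by (auto simp: complex_nonpos_Reals_iff)
  then show ?thesis
    unfolding half_disc_angle_def[abs_def] by (intro continuous_intros) auto
qed

context half_plane_model
begin

text \<open>The complement of \<Omega> contains the whole ray below each of its points, so branches
  of the logarithm and of the square root centred at \<open>q\<close> can be cut along that
  ray.\<close>

lemma not_below_domain:
  assumes "q \<notin> \<Omega>" "z \<in> \<Omega>" "Re z = Re q"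
  shows "Im q < Im z"
proof (rule ccontr)
  assume "\<not> Im q < Im z"
  then have "z + \<i> * of_real (Im q - Im z) \<in> \<Omega>"
    using up[of z "Im q - Im z"] assms \<open>\<not> Im q < Im z\<close> by (simp del: of_real_diff)
  moreover have "z + \<i> * of_real (Im q - Im z) = q"
    using assms(3) by (simp add: complex_eq_iff)
  ultimately show False
    using assms(1) by simp
qed

text \<open>On the region where \<open>Re \<zeta> > Re \<omega>\<close> and
  \<open>Re (k \<zeta>) > Re q\<close> both arguments lie in \<open>(-pi/2, pi/2)\<close>. On the
  part of the frontier over the vertical line through \<open>q\<close>, the point
  \<open>k \<zeta>\<close> is above \<open>q\<close> and the right side takes its top value
  \<open>pi / 2\<close>. On the rest, \<open>Re \<zeta> = Re \<omega>\<close> and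
  \<open>Re_k_antimono\<close> forces \<zeta> below \<omega>, so the left side takes its bottom
  value \<open>- pi / 2\<close>. The maximum principle fills in the interior.\<close>

lemma Arg_comparison:
  assumes \<zeta>1: "Re \<omega> > 0" and q: "q \<notin> \<Omega>" "Re (k \<omega>) \<le> Re q"
    and \<zeta>: "Re \<zeta> > Re \<omega>" "Re (k \<zeta>) > Re q"
  shows "Im (Ln (\<zeta> - \<omega>)) \<le> Im (Ln (k \<zeta> - q))"
proof -
  define S where "S = {\<zeta>. Re \<zeta> > Re \<omega> \<and> Re (k \<zeta>) > Re q}"
  define f where "f \<zeta> = - \<i> * (Ln (\<zeta> - \<omega>) - Ln (k \<zeta> - q))" for \<zeta>
  have Re_f: "Re (f \<zeta>) = Im (Ln (\<zeta> - \<omega>)) - Im (Ln (k \<zeta> - q))" for \<zeta>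
    by (simp add: f_def)
  have S_eq: "S = {\<zeta>. Re \<zeta> > Re \<omega>} \<inter> k -` {z. Re z > Re q}"
    by (auto simp: S_def)
  have "open S"
    unfolding S_eq
    by (intro continuous_open_preimage holomorphic_on_imp_continuous_on[OF holomorphic_on_subset[OF holk]] open_halfspace_Re_gt)
       (use \<zeta>1 in auto)
  have "Re (f \<zeta>) \<le> 0"
  proof (rule Re_nonpos_if_limsup_half_plane[of S "Re \<omega>" f "2 * pi" \<zeta>])
    show "f holomorphic_on S"
      unfolding f_def
      by (intro holomorphic_intros holomorphic_on_subset[OF holk])
         (use \<zeta>1 in \<open>auto simp: S_def complex_nonpos_Reals_iff\<close>)
    show "Re (f z) \<le> 2 * pi" if "z \<in> S" for z
    proof -
      have "Re (z - \<omega>) > 0" "Re (k z - q) > 0"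
        using that by (auto simp: S_def)
      from this[THEN Re_Ln_pos_lt_imp] show ?thesis
        unfolding Re_f by linarith
    qed
  next
    fix \<xi> \<delta> assume "\<xi> \<in> frontier S" and \<delta>: "(\<delta>::real) > 0"
    then have \<xi>: "\<xi> \<in> closure S" "\<xi> \<notin> S"
      using \<open>open S\<close> by (auto simp: frontier_def interior_open)
    have "closure S \<subseteq> {\<zeta>. Re \<zeta> \<ge> Re \<omega>}"
      by (intro closure_minimal closed_halfspace_Re_ge) (auto simp: S_def)
    then have ge: "Re \<xi> \<ge> Re \<omega>"
      using \<xi> by auto
    then have pos: "Re \<xi> > 0"
      using \<zeta>1 by simp
    have "Re (k \<xi>) \<ge> Re q"
    proof (rule ccontr)
      assume "\<not> Re (k \<xi>) \<ge> Re q"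
      moreover have "((\<lambda>z. Re (k z)) \<longlongrightarrow> Re (k \<xi>)) (at \<xi>)"
        using isCont_k[OF pos] by (intro tendsto_Re) (simp add: isCont_def)
      ultimately have "eventually (\<lambda>z. Re (k z) < Re q) (nhds \<xi>)"
        by (auto simp: tendsto_def eventually_at_filter not_le dest!: spec[of _ "{..<Re q}"] elim: eventually_mono)
      then obtain T where "open T" "\<xi> \<in> T" "\<And>z. z \<in> T \<Longrightarrow> Re (k z) < Re q"
        unfolding eventually_nhds by blast
      then have "T \<inter> S = {}"
        unfolding S_def by force
      then show False
        using \<xi>(1) \<open>open T\<close> \<open>\<xi> \<in> T\<close> open_Int_closure_eq_empty[of T S] by blast
    qed
    have in_S: "eventually (\<lambda>z. z \<in> S) (at \<xi> within S)"
      by (simp add: eventually_at_filter)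
    show "eventually (\<lambda>z. Re (f z) \<le> \<delta>) (at \<xi> within S)"
    proof (cases "Re (k \<xi>) = Re q")
      case True
      have gt: "Im (k \<xi>) > Im q"
        by (rule not_below_domain[OF q(1) k_in[OF pos] True])
      then have "k \<xi> - q \<noteq> 0" "k \<xi> - q \<notin> \<real>\<^sub>\<le>\<^sub>0"
        by (auto simp: complex_nonpos_Reals_iff)
      then have "isCont (\<lambda>z. pi / 2 - Im (Ln (k z - q))) \<xi>"
        using isCont_k[OF pos] by (intro continuous_intros) auto
      moreover have "Im (Ln (k \<xi> - q)) = pi / 2"
        using \<open>k \<xi> - q \<noteq> 0\<close> gt True by (subst Im_Ln_eq_pi_half) auto
      ultimately have "eventually (\<lambda>z. pi / 2 - Im (Ln (k z - q)) \<le> \<delta>) (at \<xi> within S)"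
        by (intro tendsto_le_at_within \<delta>) auto
      then show ?thesis
        using in_S
      proof eventually_elim
        case (elim z)
        then have "Re (z - \<omega>) > 0"
          by (simp add: S_def)
        from Re_Ln_pos_lt_imp[OF this] show ?case
          using elim unfolding Re_f by linarith
      qed
    next
      case False
      then have "Re (k \<xi>) > Re q"
        using \<open>Re (k \<xi>) \<ge> Re q\<close> by simp
      then have Re_eq: "Re \<xi> = Re \<omega>"
        using \<xi>(2) ge by (simp add: S_def)
      have "Im \<xi> < Im \<omega>"
      proof (rule ccontr)
        assume "\<not> Im \<xi> < Im \<omega>"
        then have "Re (k \<xi>) \<le> Re (k \<omega>)"
          by (intro Re_k_antimono) (use \<zeta>1 Re_eq in simp_all)
        then show False
          using \<open>Re (k \<xi>) > Re q\<close> q(2) by simp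
      qed
      then have "Im (\<xi> - \<omega>) \<noteq> 0"
        by simp
      then have "\<xi> - \<omega> \<noteq> 0" "\<xi> - \<omega> \<notin> \<real>\<^sub>\<le>\<^sub>0"
        unfolding complex_nonpos_Reals_iff by (metis zero_complex.simps(2), blast)
      then have "isCont (\<lambda>z. pi / 2 + Im (Ln (z - \<omega>))) \<xi>"
        by (intro continuous_intros) auto
      moreover have "Im (Ln (\<xi> - \<omega>)) = - pi / 2"
        using \<open>\<xi> - \<omega> \<noteq> 0\<close> \<open>Im \<xi> < Im \<omega>\<close> Re_eq by (subst Im_Ln_eq_pi_half) auto
      ultimately have "eventually (\<lambda>z. pi / 2 + Im (Ln (z - \<omega>)) \<le> \<delta>) (at \<xi> within S)"
        by (intro tendsto_le_at_within \<delta>) auto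
      then show ?thesis
        using in_S
      proof eventually_elim
        case (elim z)
        then have "Re (k z - q) > 0"
          by (simp add: S_def)
        from Re_Ln_pos_lt_imp[OF this] show ?case
          using elim unfolding Re_f by linarith
      qed
    qed
  qed (use \<open>open S\<close> \<zeta> in \<open>auto simp: S_def\<close>)
  then show ?thesis
    by (simp add: Re_f)
qed

text \<open>A Beurling type estimate: the ray below \<open>q\<close> lies outside \<open>\<Omega>\<close>, and the square root opens the slit disc
  up to a half-disc.\<close>

lemma slit_disc_comparison:
  assumes \<zeta>1: "Re \<omega> > 0" and q: "q \<notin> \<Omega>" and \<rho>: "\<rho> > 0"
    and sep: "\<And>\<zeta>. Re \<zeta> = Re \<omega> \<Longrightarrow> norm (k \<zeta> - q) \<le> \<rho> \<Longrightarrow> Im \<zeta> > Im \<omega>"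
    and \<zeta>: "Re \<zeta> > Re \<omega>" "norm (k \<zeta> - q) < \<rho>"
  shows "pi / 2 - Im (Ln (\<zeta> - \<omega>)) \<le> 2 * half_disc_angle (csqrt (- \<i> * (k \<zeta> - q) / of_real \<rho>))"
proof -
  define S where "S = {\<zeta>. Re \<zeta> > Re \<omega> \<and> norm (k \<zeta> - q) < \<rho>}"
  \<comment> \<open>The factor \<open>- \<i>\<close> turns the ray below \<open>q\<close> into the
    negative real axis, the cut of \<open>csqrt\<close>.\<close>
  define r where "r \<zeta> = - \<i> * (k \<zeta> - q) / of_real \<rho>" for \<zeta>
  define s where "s \<zeta> = csqrt (r \<zeta>)" for \<zeta>
  \<comment> \<open>The factor \<open>2\<close> is dictated by the arc: there
    \<open>half_disc_angle\<close> is \<open>pi / 2\<close>, whereas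
    \<open>pi / 2 - Im (Ln (\<zeta> - \<omega>))\<close> can be as large as
    \<open>pi\<close>.\<close>
  define f where "f \<zeta> = of_real (pi / 2) + \<i> * Ln (\<zeta> - \<omega>) + 2 * \<i> * (Ln (1 + \<i> * s \<zeta>) - Ln (1 - \<i> * s \<zeta>))" for \<zeta>
  have Re_f: "Re (f \<zeta>) = pi / 2 - Im (Ln (\<zeta> - \<omega>)) - 2 * half_disc_angle (s \<zeta>)" for \<zeta>
    by (simp add: f_def half_disc_angle_def)
  have r_notin: "r z \<notin> \<real>\<^sub>\<le>\<^sub>0" if "Re z > 0" for z
  proof
    assume "r z \<in> \<real>\<^sub>\<le>\<^sub>0"
    then have "Im (k z) - Im q \<le> 0" "Re (k z) = Re q"
      using \<rho> by (auto simp: complex_nonpos_Reals_iff r_def Re_divide_of_real Im_divide_of_real zero_le_divide_iff)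
    then show False
      using not_below_domain[OF q k_in[OF that]] by simp
  qed
  have Re_s: "Re (s z) > 0" if "Re z > 0" for z
  proof -
    have "r z \<noteq> 0"
      using r_notin[OF that] by auto
    \<comment> \<open>A root with vanishing real part would have a nonpositive real square, and
      \<open>r z\<close> avoids those values.\<close>
    then have "Re (s z) \<noteq> 0"
      using r_notin[OF that] unfolding s_def by (metis Re_csqrt csqrt_in_nonpos_Reals_iff complex_nonpos_Reals_iff power2_csqrt complex_eq_iff less_eq_real_def Re_power2 Im_power2 mult_zero_left mult_zero_right zero_power2 diff_0 neg_le_0_iff_le zero_le_power2)
    then show ?thesis
      using Re_csqrt[of "r z"] by (simp add: s_def less_le)
  qed
  have norm_s: "norm (s z) ^ 2 = norm (k z - q) / \<rho>" for z
    using \<rho> by (simp add: s_def r_def norm_power[symmetric] power2_csqrt norm_mult norm_divide)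
  have Im_s: "\<bar>Im (s z)\<bar> < 1" if "Re z > 0" "norm (k z - q) \<le> \<rho>" for z
  proof -
    have "Im (s z) ^ 2 < norm (s z) ^ 2"
      using Re_s[OF that(1)] by (simp add: cmod_power2)
    also have "\<dots> \<le> 1"
      unfolding norm_s using that(2) \<rho> by simp
    finally show ?thesis
      by (simp add: abs_square_less_1)
  qed
  have S_eq: "S = {\<zeta>. Re \<zeta> > Re \<omega>} \<inter> k -` ball q \<rho>"
    by (auto simp: S_def dist_norm norm_minus_commute)
  have "open S"
    unfolding S_eq
    by (intro continuous_open_preimage holomorphic_on_imp_continuous_on[OF holomorphic_on_subset[OF holk]] open_halfspace_Re_gt)
       (use \<zeta>1 in auto)
  have Spos: "Re z > 0" if "z \<in> S" for z
    using that \<zeta>1 by (simp add: S_def)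
  have "Re (f \<zeta>) \<le> 0"
  proof (rule Re_nonpos_if_limsup_half_plane[of S "Re \<omega>" f pi \<zeta>])
    have hols: "s holomorphic_on S"
      unfolding s_def r_def
      by (intro holomorphic_intros holomorphic_on_subset[OF holk]) (use Spos r_notin \<rho> in \<open>auto simp: r_def\<close>)
    have "1 + \<i> * s z \<notin> \<real>\<^sub>\<le>\<^sub>0" "1 - \<i> * s z \<notin> \<real>\<^sub>\<le>\<^sub>0" if "z \<in> S" for z
      using Im_s[of z] Spos[OF that] that by (auto simp: S_def complex_nonpos_Reals_iff)
    then show "f holomorphic_on S"
      unfolding f_def by (intro holomorphic_intros hols) (auto simp: S_def complex_nonpos_Reals_iff)
    show "Re (f z) \<le> pi" if "z \<in> S" for z
    proof -
      have "Re (z - \<omega>) > 0"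
        using that by (simp add: S_def)
      moreover have "half_disc_angle (s z) \<ge> 0"
        using Im_s[of z] Spos[OF that] that Re_s[of z] by (intro half_disc_angle_nonneg) (auto simp: S_def)
      ultimately show ?thesis
        using Re_Ln_pos_lt_imp[of "z - \<omega>"] unfolding Re_f by linarith
    qed
  next
    fix \<xi> \<delta> assume "\<xi> \<in> frontier S" and \<delta>: "(\<delta>::real) > 0"
    then have \<xi>: "\<xi> \<in> closure S" "\<xi> \<notin> S"
      using \<open>open S\<close> by (auto simp: frontier_def interior_open)
    have "closure S \<subseteq> {\<zeta>. Re \<zeta> \<ge> Re \<omega>}"
      by (intro closure_minimal closed_halfspace_Re_ge) (auto simp: S_def)
    then have ge: "Re \<xi> \<ge> Re \<omega>"
      using \<xi> by auto
    then have pos: "Re \<xi> > 0"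
      using \<zeta>1 by simp
    have le: "norm (k \<xi> - q) \<le> \<rho>"
    proof (rule ccontr)
      assume "\<not> norm (k \<xi> - q) \<le> \<rho>"
      moreover have "((\<lambda>z. norm (k z - q)) \<longlongrightarrow> norm (k \<xi> - q)) (at \<xi>)"
        using isCont_k[OF pos] by (intro tendsto_intros) (simp add: isCont_def)
      ultimately have "eventually (\<lambda>z. norm (k z - q) > \<rho>) (nhds \<xi>)"
        by (auto simp: tendsto_def eventually_at_filter not_le dest!: spec[of _ "{\<rho><..}"] elim: eventually_mono)
      then obtain T where "open T" "\<xi> \<in> T" "\<And>z. z \<in> T \<Longrightarrow> norm (k z - q) > \<rho>"
        unfolding eventually_nhds by blast
      then have "T \<inter> S = {}"
        unfolding S_def by force
      then show False
        using \<xi>(1) \<open>open T\<close> \<open>\<xi> \<in> T\<close> open_Int_closure_eq_empty[of T S] by blast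
    qed
    have "isCont r \<xi>"
      unfolding r_def[abs_def] by (intro continuous_intros isCont_k pos) (use \<rho> in auto)
    then have "isCont s \<xi>"
      unfolding s_def[abs_def]
      by (intro isCont_o2[of _ r csqrt] continuous_at_csqrt r_notin pos)
    then have cont: "isCont (\<lambda>z. half_disc_angle (s z)) \<xi>"
      by (rule isCont_o2) (rule isCont_half_disc_angle[OF Im_s[OF pos le]])
    \<comment> \<open>At \<omega> itself \<open>sep\<close> would give
      \<open>Im \<omega> > Im \<omega>\<close>; hence the singularity of the logarithm is not a
      frontier point of \<open>S\<close>.\<close>
    have ne: "\<xi> - \<omega> \<noteq> 0"
      using sep[of \<xi>] le by auto
    have nr: "\<xi> - \<omega> \<notin> \<real>\<^sub>\<le>\<^sub>0"
    proof
      assume "\<xi> - \<omega> \<in> \<real>\<^sub>\<le>\<^sub>0"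
      then have "Re \<xi> \<le> Re \<omega>" "Im \<xi> = Im \<omega>"
        by (auto simp: complex_nonpos_Reals_iff)
      with ge ne show False
        by (simp add: complex_eq_iff)
    qed
    have contf: "isCont (\<lambda>z. Re (f z)) \<xi>"
      unfolding Re_f by (intro continuous_intros cont) (use nr in auto)
    have "Re (f \<xi>) \<le> 0"
    proof (cases "Re \<xi> = Re \<omega>")
      case True
      then have "Im \<xi> > Im \<omega>"
        using sep le by simp
      then have "Im (Ln (\<xi> - \<omega>)) = pi / 2"
        using ne True by (subst Im_Ln_eq_pi_half) auto
      moreover have "half_disc_angle (s \<xi>) \<ge> 0"
        using Im_s[OF pos le] Re_s[OF pos] by (intro half_disc_angle_nonneg) auto
      ultimately show ?thesis
        unfolding Re_f by simp
    next
      case False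
      then have "norm (k \<xi> - q) = \<rho>"
        using \<xi>(2) ge le by (auto simp: S_def)
      then have "norm (s \<xi>) ^ 2 = 1"
        using norm_s[of \<xi>] \<rho> by simp
      then have "norm (s \<xi>) = 1"
        by (simp add: power2_eq_1_iff) (smt (verit) norm_ge_zero)
      then have "half_disc_angle (s \<xi>) = pi / 2"
        using Re_s[OF pos] by (rule half_disc_angle_arc)
      moreover have "Re (\<xi> - \<omega>) > 0"
        using False ge by simp
      ultimately show ?thesis
        using Re_Ln_pos_lt_imp[of "\<xi> - \<omega>"] unfolding Re_f by linarith
    qed
    then show "eventually (\<lambda>z. Re (f z) \<le> \<delta>) (at \<xi> within S)"
      by (rule tendsto_le_at_within[OF contf _ \<delta>])
  qed (use \<open>open S\<close> \<zeta> in \<open>auto simp: S_def\<close>)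
  then show ?thesis
    by (simp add: Re_f s_def r_def)
qed

text \<open>\<open>Re F\<close> is at least \<open>Re (F z)\<close> on the upper half of the diameter, whose harmonic measure near the centre is
  almost one half.\<close>

lemma Re_F_right_half_disc:
  assumes r: "r > 0" and half: "\<And>z. Re z \<ge> Re z\<^sub>0 \<Longrightarrow> dist z\<^sub>0 z \<le> r \<Longrightarrow> z \<in> \<Omega>"
    and x: "0 \<le> x" "x \<le> r / 16"
  shows "Re (F z\<^sub>0) / 4 \<le> Re (F (z\<^sub>0 + of_real x))"
proof (cases "x = 0")
  case True
  then show ?thesis
    using F_pos[of z\<^sub>0] half[of z\<^sub>0] r by simp
next
  case False
  then have "x > 0"
    using x by simp
  define m where "m = Re (F z\<^sub>0)"
  have "z\<^sub>0 \<in> \<Omega>"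
    using half[of z\<^sub>0] r by simp
  then have "m > 0"
    by (simp add: m_def F_pos)
  define S where "S = {z. Re z > Re z\<^sub>0} \<inter> ball z\<^sub>0 r"
  define s where "s z = (z - z\<^sub>0) / of_real r" for z
  \<comment> \<open>The real part of the bracket is \<open>1\<close> on the upper half of the
    diameter, \<open>0\<close> on the lower half and at most \<open>0\<close> on the arc, so
    \<open>m\<close> times it is a minorant of \<open>Re F\<close>.\<close>
  define f where "f z = of_real m * (1 / 2 - \<i> * Ln (s z) / of_real pi + 2 * \<i> / of_real pi * (Ln (1 + \<i> * s z) - Ln (1 - \<i> * s z))) - F z" for z
  have Re_f: "Re (f z) = m * (1 / 2 + Im (Ln (s z)) / pi - 2 / pi * half_disc_angle (s z)) - Re (F z)" for z
    by (simp add: f_def half_disc_angle_def Re_divide_of_real Im_divide_of_real diff_divide_distrib)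
  have Re_s: "Re (s z) = (Re z - Re z\<^sub>0) / r" for z
    by (simp add: s_def)
  have Im_s: "Im (s z) = (Im z - Im z\<^sub>0) / r" for z
    by (simp add: s_def)
  have norm_s: "norm (s z) = dist z\<^sub>0 z / r" for z
    using r by (simp add: s_def norm_divide dist_norm norm_minus_commute)
  have "open S"
    by (auto simp: S_def open_halfspace_Re_gt)
  have S_half: "Re (s z) > 0" "norm (s z) < 1" "\<bar>Im (s z)\<bar> < 1" "z \<in> \<Omega>" if "z \<in> S" for z
  proof -
    show "Re (s z) > 0" "norm (s z) < 1"
      using that r by (auto simp: S_def Re_s norm_s)
    then show "\<bar>Im (s z)\<bar> < 1"
      using abs_Im_le_cmod[of "s z"] by simp
    show "z \<in> \<Omega>"
      using that half[of z] by (auto simp: S_def)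
  qed
  have zS: "z\<^sub>0 + of_real x \<in> S"
    using x \<open>x > 0\<close> r by (auto simp: S_def dist_norm)
  have "Re (f (z\<^sub>0 + of_real x)) \<le> 0"
  proof (rule Re_le_if_limsup_le[OF \<open>open S\<close> _ _ _ zS])
    have hols: "s holomorphic_on S"
      unfolding s_def by (intro holomorphic_intros) (use r in auto)
    have "1 + \<i> * s z \<notin> \<real>\<^sub>\<le>\<^sub>0" "1 - \<i> * s z \<notin> \<real>\<^sub>\<le>\<^sub>0" "s z \<notin> \<real>\<^sub>\<le>\<^sub>0" if "z \<in> S" for z
      using S_half[OF that] by (auto simp: complex_nonpos_Reals_iff)
    then show "f holomorphic_on S"
      unfolding f_def
      by (intro holomorphic_intros hols holomorphic_on_subset[OF holF]) (use S_half in auto)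
  next
    fix \<xi> \<delta> assume "\<xi> \<in> frontier S" and \<delta>: "(\<delta>::real) > 0"
    then have \<xi>: "\<xi> \<in> closure S" "\<xi> \<notin> S"
      using \<open>open S\<close> by (auto simp: frontier_def interior_open)
    have "closure S \<subseteq> {z. Re z \<ge> Re z\<^sub>0} \<inter> cball z\<^sub>0 r"
      by (intro closure_minimal closed_Int closed_halfspace_Re_ge closed_cball) (auto simp: S_def)
    then have ge: "Re \<xi> \<ge> Re z\<^sub>0" "dist z\<^sub>0 \<xi> \<le> r"
      using \<xi> by auto
    have "\<xi> \<in> \<Omega>"
      using half ge by blast
    have in_S: "eventually (\<lambda>z. z \<in> S) (at \<xi> within S)"
      by (simp add: eventually_at_filter)
    have contF: "isCont (\<lambda>z. Re (F z)) \<xi>"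
      using isCont_F[OF \<open>\<xi> \<in> \<Omega>\<close>] by simp
    have conts: "isCont s \<xi>"
      unfolding s_def[abs_def] by (intro continuous_intros) (use r in auto)
    have angle: "half_disc_angle (s z) \<ge> 0" if "z \<in> S" for z
      using S_half[OF that] by (intro half_disc_angle_nonneg) auto
    have angle': "2 / pi * half_disc_angle (s z) \<ge> 0" if "z \<in> S" for z
      using angle[OF that] by simp
    show "eventually (\<lambda>z. Re (f z) \<le> 0 + \<delta>) (at \<xi> within S)"
    proof (cases "Re \<xi> = Re z\<^sub>0")
      case True
      show ?thesis
      proof (cases "Im \<xi> \<ge> Im z\<^sub>0")
        \<comment> \<open>The centre, where \<open>Ln (s z)\<close> is singular, falls under this
          case. The argument is therefore only estimated by \<open>pi / 2\<close>, and continuity is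
          used for \<open>F\<close> alone.\<close>
        case True
        have "\<xi> = z\<^sub>0 + \<i> * of_real (Im \<xi> - Im z\<^sub>0)"
          using \<open>Re \<xi> = Re z\<^sub>0\<close> by (simp add: complex_eq_iff)
        then have "m \<le> Re (F \<xi>)"
          using Re_F_up[OF \<open>z\<^sub>0 \<in> \<Omega>\<close>, of "Im \<xi> - Im z\<^sub>0"] True by (simp add: m_def)
        then have "eventually (\<lambda>z. m - Re (F z) \<le> \<delta>) (at \<xi> within S)"
          by (intro tendsto_le_at_within \<delta> continuous_intros contF) auto
        then show ?thesis
          using in_S
        proof eventually_elim
          case (elim z)
          have "Im (Ln (s z)) / pi \<le> 1 / 2"
            using Re_Ln_pos_lt_imp[OF S_half(1)[OF elim(2)]] by (simp add: divide_le_eq)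
          then have "1 / 2 + Im (Ln (s z)) / pi - 2 / pi * half_disc_angle (s z) \<le> 1"
            using angle'[OF elim(2)] by linarith
          then have "m * (1 / 2 + Im (Ln (s z)) / pi - 2 / pi * half_disc_angle (s z)) \<le> m * 1"
            using \<open>m > 0\<close> by (intro mult_left_mono) auto
          then show ?case
            using elim unfolding Re_f by linarith
        qed
      next
        case False
        have ne: "s \<xi> \<noteq> 0"
          using False r by (auto simp: s_def)
        have "s \<xi> \<notin> \<real>\<^sub>\<le>\<^sub>0"
          using False r by (auto simp: complex_nonpos_Reals_iff Im_s)
        then have "isCont (\<lambda>z. m * (1 / 2 + Im (Ln (s z)) / pi)) \<xi>"
          using conts by (intro continuous_intros) auto
        moreover have "Im (Ln (s \<xi>)) = - pi / 2"
          using ne False True r by (subst Im_Ln_eq_pi_half) (auto simp: Re_s Im_s divide_less_0_iff)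
        ultimately have "eventually (\<lambda>z. m * (1 / 2 + Im (Ln (s z)) / pi) \<le> \<delta>) (at \<xi> within S)"
          by (intro tendsto_le_at_within \<delta>) auto
        then show ?thesis
          using in_S
        proof eventually_elim
          case (elim z)
          have "m * (1 / 2 + Im (Ln (s z)) / pi - 2 / pi * half_disc_angle (s z)) \<le> m * (1 / 2 + Im (Ln (s z)) / pi)"
            using angle'[OF elim(2)] \<open>m > 0\<close> by (intro mult_left_mono) auto
          then show ?case
            using elim F_pos[OF S_half(4)[OF elim(2)]] unfolding Re_f by linarith
        qed
      qed
    next
      case False
      then have "Re \<xi> > Re z\<^sub>0"
        using ge by simp
      then have "dist z\<^sub>0 \<xi> = r"
        using \<xi>(2) ge by (auto simp: S_def)
      then have n1: "norm (s \<xi>) = 1" and Re_pos: "Re (s \<xi>) > 0"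
        using r \<open>Re \<xi> > Re z\<^sub>0\<close> by (auto simp: norm_s Re_s)
      have "Im (s \<xi>) ^ 2 < norm (s \<xi>) ^ 2"
        using Re_pos by (simp add: cmod_power2)
      then have im: "\<bar>Im (s \<xi>)\<bar> < 1"
        using n1 by (simp add: abs_square_less_1)
      have "isCont (\<lambda>z. half_disc_angle (s z)) \<xi>"
        by (rule isCont_o2[OF conts isCont_half_disc_angle[OF im]])
      moreover have "s \<xi> \<notin> \<real>\<^sub>\<le>\<^sub>0"
        using Re_pos by (auto simp: complex_nonpos_Reals_iff)
      ultimately have "isCont (\<lambda>z. Re (f z)) \<xi>"
        unfolding Re_f using conts by (intro continuous_intros contF) auto
      moreover have "Re (f \<xi>) \<le> 0"
      proof -
        have "Im (Ln (s \<xi>)) / pi \<le> 1 / 2"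
          using Re_Ln_pos_lt_imp[OF Re_pos] by (simp add: divide_le_eq)
        then have "m * (1 / 2 + Im (Ln (s \<xi>)) / pi - 1) \<le> 0"
          using \<open>m > 0\<close> by (simp add: mult_le_0_iff)
        moreover have angle_1: "2 / pi * half_disc_angle (s \<xi>) = 1"
          using half_disc_angle_arc[OF n1 Re_pos] by simp
        ultimately show ?thesis
          using F_pos[OF \<open>\<xi> \<in> \<Omega>\<close>] unfolding Re_f angle_1 by linarith
      qed
      ultimately show ?thesis
        using tendsto_le_at_within \<delta> by fastforce
    qed
  next
    fix \<delta> :: real assume "\<delta> > 0"
    show "\<exists>R. \<forall>z\<in>S. norm z \<ge> R \<longrightarrow> Re (f z) \<le> 0 + \<delta>"
    proof (intro exI[of _ "norm z\<^sub>0 + r"] ballI impI)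
      fix z assume "z \<in> S" "norm z \<ge> norm z\<^sub>0 + r"
      moreover from this have "norm (z - z\<^sub>0) < r"
        by (simp add: S_def dist_norm norm_minus_commute)
      ultimately show "Re (f z) \<le> 0 + \<delta>"
        using norm_triangle_ineq2[of z z\<^sub>0] by simp
    qed
  qed
  \<comment> \<open>On the horizontal radius the argument vanishes and the bracket is
    \<open>1 / 2\<close> minus the term of the arc. A distance of at most \<open>r / 16\<close>
    keeps \<open>half_disc_angle\<close> below \<open>1 / 4\<close>, and
    \<open>2 / pi \<le> 1\<close> leaves at least \<open>1 / 4\<close>.\<close>
  moreover have "1 / 4 \<le> 1 / 2 + Im (Ln (s (z\<^sub>0 + of_real x))) / pi - 2 / pi * half_disc_angle (s (z\<^sub>0 + of_real x))"
  proof -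
    define y where "y = x / r"
    have y: "0 < y" "y \<le> 1 / 16"
      using \<open>x > 0\<close> x r by (auto simp: y_def divide_le_eq)
    have s_eq: "s (z\<^sub>0 + of_real x) = of_real y"
      by (simp add: s_def y_def)
    have "half_disc_angle (of_real y) \<le> 4 * y"
      using half_disc_angle_le[of "of_real y"] y by simp
    then have "2 / pi * half_disc_angle (of_real y) \<le> 2 / pi * (1 / 4)"
      using y by (intro mult_left_mono) auto
    also have "\<dots> \<le> 1 / 4"
      using pi_ge_two by (simp add: divide_le_eq)
    finally show ?thesis
      using y unfolding s_eq by (simp add: Ln_of_real)
  qed
  then have "m * (1 / 4) \<le> m * (1 / 2 + Im (Ln (s (z\<^sub>0 + of_real x))) / pi - 2 / pi * half_disc_angle (s (z\<^sub>0 + of_real x)))"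
    using \<open>m > 0\<close> by (intro mult_left_mono) auto
  ultimately show ?thesis
    unfolding Re_f m_def by linarith
qed

end

section \<open>Boundary distances and the slope of an orbit\<close>

lemma half_disc_angle_csqrt_le:
  assumes "norm z < 1 / 4"
  shows "half_disc_angle (csqrt z) \<le> 4 * sqrt (norm z)"
proof -
  have "norm (csqrt z) ^ 2 = norm z"
    by (simp add: norm_power[symmetric] power2_csqrt)
  then have eq: "norm (csqrt z) = sqrt (norm z)"
    by (metis norm_ge_zero real_sqrt_unique)
  moreover have "sqrt (norm z) < 1 / 2"
    using real_sqrt_less_mono[OF assms] by (simp add: real_sqrt_divide)
  ultimately show ?thesis
    using half_disc_angle_le[of "csqrt z"] by simp
qed

context half_plane_model
begin

lemma left_base_point:
  assumes p: "p \<in> \<Omega>" and p1: "p\<^sub>1 \<in> \<Omega>"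
  shows "(\<exists>B. \<forall>s\<ge>0. Re (F (vert p s)) \<le> B) \<and> filterlim (\<lambda>s. Im (F (vert p s))) at_top at_top \<or>
    (\<forall>C. \<exists>\<omega>. Re \<omega> > 0 \<and> Re p\<^sub>1 \<le> Re (k \<omega>) \<and> (\<forall>\<^sub>F s in at_top. C * Re \<omega> < Re (F (vert p s))))"
proof -
  interpret M: half_plane_model "(\<lambda>z. - cnj z) ` \<Omega>" "\<lambda>z. cnj (F (- cnj z))" "\<lambda>\<zeta>. - cnj (k (cnj \<zeta>))"
    by (rule half_plane_model_mirror)
  have "- cnj p \<in> (\<lambda>z. - cnj z) ` \<Omega>" "- cnj p\<^sub>1 \<in> (\<lambda>z. - cnj z) ` \<Omega>"
    using p p1 by auto
  from M.right_base_point[OF this] show ?thesis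
  proof
    assume *: "\<forall>C. \<exists>\<omega>. 0 < Re \<omega> \<and> Re (- cnj (k (cnj \<omega>))) \<le> Re (- cnj p\<^sub>1) \<and>
      (\<forall>\<^sub>F s in at_top. C * Re \<omega> < Re (cnj (F (- cnj (- cnj p + \<i> * of_real s)))))"
    have "\<exists>\<omega>. Re \<omega> > 0 \<and> Re p\<^sub>1 \<le> Re (k \<omega>) \<and> (\<forall>\<^sub>F s in at_top. C * Re \<omega> < Re (F (vert p s)))" for C
    proof -
      obtain \<omega> where "0 < Re \<omega>" "Re (- cnj (k (cnj \<omega>))) \<le> Re (- cnj p\<^sub>1)"
        "\<forall>\<^sub>F s in at_top. C * Re \<omega> < Re (cnj (F (- cnj (- cnj p + \<i> * of_real s))))"
        using * by blast
      then show ?thesis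
        by (intro exI[of _ "cnj \<omega>"]) simp
    qed
    then show ?thesis
      by blast
  qed (simp add: filterlim_uminus_at_top)
qed

text \<open>The radius \<open>\<rho> / 4\<close> brings the square root below \<open>1 / 2\<close>,
  where \<open>half_disc_angle\<close> is at most four times the modulus; doubling gives
  \<open>8\<close>. The exponent \<open>1 / 2\<close> is the one of Beurling's projection
  theorem.\<close>

lemma slit_disc_bound:
  assumes "Re \<omega> > 0" "q \<notin> \<Omega>" "\<rho> > 0"
    and "\<And>\<zeta>. Re \<zeta> = Re \<omega> \<Longrightarrow> norm (k \<zeta> - q) \<le> \<rho> \<Longrightarrow> Im \<zeta> > Im \<omega>"
    and "Re \<zeta> > Re \<omega>" "norm (k \<zeta> - q) < \<rho> / 4"
  shows "pi / 2 - Im (Ln (\<zeta> - \<omega>)) \<le> 8 * sqrt (norm (k \<zeta> - q) / \<rho>)"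
proof -
  have n: "norm (- \<i> * (k \<zeta> - q) / of_real \<rho>) = norm (k \<zeta> - q) / \<rho>"
    using assms by (simp add: norm_divide norm_mult)
  have "half_disc_angle (csqrt (- \<i> * (k \<zeta> - q) / of_real \<rho>)) \<le> 4 * sqrt (norm (- \<i> * (k \<zeta> - q) / of_real \<rho>))"
    by (rule half_disc_angle_csqrt_le) (use assms in \<open>simp only: n, simp add: field_simps\<close>)
  then show ?thesis
    using slit_disc_comparison[of \<omega> q \<rho> \<zeta>] assms unfolding n by fastforce
qed

text \<open>Reflection reverses heights in the half-plane: the level line now enters the disc only
  below \<omega>, and the argument is pushed towards \<open>- pi / 2\<close>.\<close>

lemma slit_disc_bound_mirror:
  assumes "Re \<omega> > 0" "q \<notin> \<Omega>" "\<rho> > 0"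
    and sep: "\<And>\<zeta>. Re \<zeta> = Re \<omega> \<Longrightarrow> norm (k \<zeta> - q) \<le> \<rho> \<Longrightarrow> Im \<zeta> < Im \<omega>"
    and "Re \<zeta> > Re \<omega>" "norm (k \<zeta> - q) < \<rho> / 4"
  shows "pi / 2 + Im (Ln (\<zeta> - \<omega>)) \<le> 8 * sqrt (norm (k \<zeta> - q) / \<rho>)"
proof -
  interpret M: half_plane_model "(\<lambda>z. - cnj z) ` \<Omega>" "\<lambda>z. cnj (F (- cnj z))" "\<lambda>\<zeta>. - cnj (k (cnj \<zeta>))"
    by (rule half_plane_model_mirror)
  have n: "norm (- cnj z - - cnj q) = norm (z - q)" for z
    by (metis complex_cnj_diff complex_mod_cnj minus_diff_minus norm_minus_cancel)
  have "- cnj q \<notin> (\<lambda>z. - cnj z) ` \<Omega>"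
    using assms(2) by auto
  moreover have "Im (cnj \<omega>) < Im \<zeta>'" if "Re \<zeta>' = Re (cnj \<omega>)" "norm (- cnj (k (cnj \<zeta>')) - - cnj q) \<le> \<rho>" for \<zeta>'
    using sep[of "cnj \<zeta>'"] that unfolding n by simp
  ultimately have "pi / 2 - Im (Ln (cnj \<zeta> - cnj \<omega>)) \<le> 8 * sqrt (norm (- cnj (k (cnj (cnj \<zeta>))) - - cnj q) / \<rho>)"
    by (intro M.slit_disc_bound) (use assms n in auto)
  moreover have "Re (\<zeta> - \<omega>) > 0"
    using assms(5) by simp
  then have "\<zeta> - \<omega> \<notin> \<real>\<^sub>\<le>\<^sub>0"
    by (auto simp: complex_nonpos_Reals_iff)
  then have "Ln (cnj \<zeta> - cnj \<omega>) = cnj (Ln (\<zeta> - \<omega>))"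
    by (simp add: cnj_Ln)
  ultimately show ?thesis
    unfolding n by simp
qed

text \<open>A Liouville argument: on arbitrarily large discs the gradient estimate forces
  \<open>deriv F 0 = 0\<close>, against \<open>deriv_F_times_deriv_k\<close>.\<close>

lemma domain_not_UNIV: "\<Omega> \<noteq> UNIV"
proof
  assume "\<Omega> = UNIV"
  have le: "norm (deriv F 0) \<le> 2 * Re (F 0) / r" if "r > 0" for r
    using norm_deriv_F_le[OF that] \<open>\<Omega> = UNIV\<close> by simp
  have "((\<lambda>r. 2 * Re (F 0) / r) \<longlongrightarrow> 0) at_top"
    by (rule real_tendsto_divide_at_top[OF tendsto_const filterlim_ident])
  moreover have "\<forall>\<^sub>F r in at_top. norm (deriv F 0) \<le> 2 * Re (F 0) / r"
    using eventually_gt_at_top[of 0] by eventually_elim (rule le)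
  ultimately have "norm (deriv F 0) \<le> 0"
    by (rule tendsto_lowerbound) simp
  moreover have "deriv F (k (F 0)) * deriv k (F 0) = 1"
    by (rule deriv_F_times_deriv_k) (simp add: F_pos \<open>\<Omega> = UNIV\<close>)
  ultimately show False
    using \<open>\<Omega> = UNIV\<close> by simp
qed

text \<open>Near the boundary on the left: the slit below \<open>q\<close> has almost full harmonic measure, and by
  the half-disc lemma no point of the level line \<open>Re F = Re \<omega>\<close> below \<open>\<omega>\<close> comes close.\<close>

lemma Im_F_large_if_left_boundary_close:
  assumes p: "p \<in> \<Omega>"
  obtains \<epsilon> where "\<epsilon> > 0"
    "\<forall>\<^sub>F t in at_top. \<forall>R q. 0 < R \<longrightarrow> R \<le> t \<longrightarrow> (\<forall>z. Re p \<le> Re z \<longrightarrow> dist (vert p t) z < R \<longrightarrow> z \<in> \<Omega>) \<longrightarrow>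
       q \<notin> \<Omega> \<longrightarrow> dist (vert p t) q \<le> \<epsilon> * R \<longrightarrow>
       M * (Re (F (vert p t)) + 1 / 2) \<le> Im (F (vert p t))"
  using left_base_point[OF p p]
proof
  \<comment> \<open>Here the slope tends to infinity regardless of the boundary, so any \<epsilon>
    serves.\<close>
  assume *: "(\<exists>B. \<forall>s\<ge>0. Re (F (vert p s)) \<le> B) \<and> filterlim (\<lambda>s. Im (F (vert p s))) at_top at_top"
  then obtain B where B: "\<And>s. s \<ge> 0 \<Longrightarrow> Re (F (vert p s)) \<le> B"
    by blast
  have "\<forall>\<^sub>F t in at_top. \<bar>M\<bar> * (B + 1 / 2) \<le> Im (F (vert p t))"
    using * by (simp add: filterlim_at_top)
  then have "\<forall>\<^sub>F t in at_top. M * (Re (F (vert p t)) + 1 / 2) \<le> Im (F (vert p t))"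
    using eventually_ge_at_top[of 0]
  proof eventually_elim
    case (elim t)
    have "Re (F (vert p t)) > 0"
      using F_pos up p elim by simp
    then have "M * (Re (F (vert p t)) + 1 / 2) \<le> \<bar>M\<bar> * (B + 1 / 2)"
      using B[OF elim(2)] by (intro mult_mono) auto
    then show ?case
      using elim by simp
  qed
  then show thesis
    by (intro that[of 1]) (auto elim: eventually_mono)
next
  assume "\<forall>C. \<exists>\<omega>. Re \<omega> > 0 \<and> Re p \<le> Re (k \<omega>) \<and> (\<forall>\<^sub>F s in at_top. C * Re \<omega> < Re (F (vert p s)))"
  \<comment> \<open>The factor \<open>8\<close> beats the \<open>4 * Re \<omega>\<close> that the
    half-disc lemma would allow in the separation step, and it makes
    \<open>Re F - Re \<omega>\<close> at least \<open>Re F / 2\<close>.\<close>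
  then obtain \<omega> where \<zeta>1: "Re \<omega> > 0" "Re p \<le> Re (k \<omega>)"
    and "\<forall>\<^sub>F s in at_top. 8 * Re \<omega> < Re (F (vert p s))"
    by meson
  then obtain T where T: "\<And>s. s \<ge> T \<Longrightarrow> 8 * Re \<omega> < Re (F (vert p s))"
    by (auto simp: eventually_at_top_linorder)
  define u\<^sub>0 where "u\<^sub>0 = Re (F p)"
  have "u\<^sub>0 > 0"
    using F_pos p by (simp add: u\<^sub>0_def)
  \<comment> \<open>This is the slope to be reached as seen from \<omega>. The factor
    \<open>2\<close> compensates for \<open>Re F - Re \<omega> \<ge> Re F / 2\<close>, and the last
    term absorbs \<open>Im \<omega>\<close> and the \<open>1 / 2\<close> of the slope by means of
    \<open>Re F \<ge> u\<^sub>0\<close>.\<close>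
  define M' where "M' = 2 * \<bar>M\<bar> + 2 * (\<bar>M\<bar> / 2 + \<bar>Im \<omega>\<bar>) / u\<^sub>0"
  have "M' \<ge> 0"
    using \<open>u\<^sub>0 > 0\<close> by (simp add: M'_def)
  define \<eta> where "\<eta> = pi / 2 - arctan M'"
  have "\<eta> > 0"
    using arctan_ubound[of M'] by (simp add: \<eta>_def)
  \<comment> \<open>With \<open>\<rho> = R / 40\<close> below, the second entry makes
    \<open>8 * sqrt (norm (w - q) / \<rho>)\<close> at most \<eta>, and the first keeps
    \<open>w\<close> within \<open>\<rho> / 4\<close> of \<open>q\<close>.\<close>
  define \<epsilon> where "\<epsilon> = min (1 / 200) ((\<eta> / 8) ^ 2 / 40)"
  have "\<epsilon> > 0"
    using \<open>\<eta> > 0\<close> by (simp add: \<epsilon>_def)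
  show thesis
  proof (rule that[OF \<open>\<epsilon> > 0\<close>])
    show "\<forall>\<^sub>F t in at_top. \<forall>R q. 0 < R \<longrightarrow> R \<le> t \<longrightarrow> (\<forall>z. Re p \<le> Re z \<longrightarrow> dist (vert p t) z < R \<longrightarrow> z \<in> \<Omega>) \<longrightarrow>
       q \<notin> \<Omega> \<longrightarrow> dist (vert p t) q \<le> \<epsilon> * R \<longrightarrow>
       M * (Re (F (vert p t)) + 1 / 2) \<le> Im (F (vert p t))"
      \<comment> \<open>All heights within \<open>3 * R / 100\<close> of \<open>t\<close> are then
        still at least \<open>T\<close>, as \<open>R \<le> t\<close>.\<close>
      using eventually_ge_at_top[of "2 * \<bar>T\<bar>"]
    proof eventually_elim
      case (elim t)
      show ?case
      proof (intro allI impI)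
        fix R q
        assume R: "0 < R" "R \<le> t" and half: "\<forall>z. Re p \<le> Re z \<longrightarrow> dist (vert p t) z < R \<longrightarrow> z \<in> \<Omega>"
          and q: "q \<notin> \<Omega>" and near: "dist (vert p t) q \<le> \<epsilon> * R"
        define w where "w = vert p t"
        have w: "w \<in> \<Omega>"
          unfolding w_def using up p R by simp
        have "\<epsilon> * R \<le> R / 200"
          using R by (simp add: \<epsilon>_def min_def field_simps)
        then have near': "norm (w - q) \<le> R / 200"
          using near by (simp add: w_def dist_norm)
        \<comment> \<open>A point within \<rho> of \<open>q\<close> is within
          \<open>R / 40 + R / 200 = 3 * R / 100\<close> of \<open>w\<close>.\<close>
        define \<rho> where "\<rho> = R / 40"
        have "\<rho> > 0"
          using R by (simp add: \<rho>_def)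
        have Uw: "8 * Re \<omega> < Re (F w)"
          using T[of t] elim by (simp add: w_def)
        have sep: "Im \<zeta> > Im \<omega>" if \<zeta>: "Re \<zeta> = Re \<omega>" "norm (k \<zeta> - q) \<le> \<rho>" for \<zeta>
        proof (rule ccontr)
          assume "\<not> Im \<zeta> > Im \<omega>"
          then have "Re (k \<omega>) \<le> Re (k \<zeta>)"
            by (intro Re_k_antimono) (use \<zeta>1 \<zeta> in simp_all)
          define z where "z = k \<zeta>"
          define x where "x = Re z - Re p"
          define s where "s = Im z - Im p"
          define z\<^sub>0 where "z\<^sub>0 = vert p s"
          have z_eq: "z = z\<^sub>0 + of_real x"
            by (simp add: z\<^sub>0_def x_def s_def complex_eq_iff)
          have "x \<ge> 0"
            using \<open>Re (k \<omega>) \<le> Re (k \<zeta>)\<close> \<zeta>1 by (simp add: x_def z_def)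
          have dz: "norm (z - w) \<le> 3 * R / 100"
            using norm_triangle_ineq4[of "z - q" "w - q"] near' \<zeta>(2) R by (simp add: z_def \<rho>_def)
          have "x \<le> 3 * R / 100"
            using abs_Re_le_cmod[of "z - w"] dz by (simp add: x_def w_def)
          have "\<bar>s - t\<bar> \<le> 3 * R / 100"
          proof -
            have "s - t = Im (z - w)"
              by (simp add: s_def w_def)
            then show ?thesis
              using abs_Im_le_cmod[of "z - w"] dz by linarith
          qed
          have dz0: "dist w z\<^sub>0 \<le> 3 * R / 100"
          proof -
            have "w - z\<^sub>0 = \<i> * of_real (t - s)"
              by (simp add: w_def z\<^sub>0_def algebra_simps)
            then have "dist w z\<^sub>0 = \<bar>t - s\<bar>"
              by (simp only: dist_norm norm_mult norm_ii norm_of_real) simp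
            then show ?thesis
              using \<open>\<bar>s - t\<bar> \<le> _\<close> by linarith
          qed
          have "Re (F z\<^sub>0) / 4 \<le> Re (F (z\<^sub>0 + of_real x))"
          \<comment> \<open>The centre is the orbit point at the height of \<open>z\<close>. Radius
            \<open>9 * R / 10\<close> keeps the half-disc inside the one of radius \<open>R\<close>
            about \<open>w\<close>, and \<open>3 * R / 100\<close> is less than a sixteenth of
            it.\<close>
          proof (rule Re_F_right_half_disc[of "9 * R / 10"])
            fix y assume "Re y \<ge> Re z\<^sub>0" "dist z\<^sub>0 y \<le> 9 * R / 10"
            then show "y \<in> \<Omega>"
              using half dz0 R dist_triangle[of w y z\<^sub>0] unfolding w_def[symmetric] by (simp add: z\<^sub>0_def)
          qed (use R \<open>x \<ge> 0\<close> \<open>x \<le> _\<close> in auto)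
          also have "\<dots> = Re \<omega>"
            using \<zeta> \<zeta>1 by (simp add: z_eq[symmetric] z_def)
          finally have "Re (F z\<^sub>0) \<le> 4 * Re \<omega>"
            by simp
          moreover have "s \<ge> T"
            using \<open>\<bar>s - t\<bar> \<le> _\<close> R elim by linarith
          ultimately show False
            using T[of s] \<zeta>1 by (simp add: z\<^sub>0_def)
        qed
        have "pi / 2 - Im (Ln (F w - \<omega>)) \<le> 8 * sqrt (norm (k (F w) - q) / \<rho>)"
        proof (rule slit_disc_bound[OF \<zeta>1(1) q \<open>\<rho> > 0\<close> sep])
          show "Re (F w) > Re \<omega>"
            using Uw \<zeta>1(1) by linarith
          show "norm (k (F w) - q) < \<rho> / 4"
            using w near' R by (simp add: \<rho>_def)
        qed
        also have "\<dots> \<le> 8 * sqrt ((\<eta> / 8) ^ 2)"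
        proof -
          have "norm (w - q) \<le> ((\<eta> / 8) ^ 2 / 40) * R"
          proof -
            have "\<epsilon> * R \<le> ((\<eta> / 8) ^ 2 / 40) * R"
              using R by (intro mult_right_mono) (auto simp: \<epsilon>_def)
            then show ?thesis
              using near unfolding w_def dist_norm by linarith
          qed
          then have "norm (k (F w) - q) / \<rho> \<le> (\<eta> / 8) ^ 2"
            using w R by (simp add: \<rho>_def divide_le_eq)
          from real_sqrt_le_mono[OF this] show ?thesis
            by (rule mult_left_mono) simp
        qed
        also have "\<dots> = \<eta>"
          using \<open>\<eta> > 0\<close> by simp
        finally have "arctan M' \<le> Im (Ln (F w - \<omega>))"
          by (simp add: \<eta>_def)
        also have "\<dots> = arctan ((Im (F w) - Im \<omega>) / (Re (F w) - Re \<omega>))"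
          using Im_Ln_right_half_plane[of "F w - \<omega>"] Uw \<zeta>1 by simp
        finally have "M' \<le> (Im (F w) - Im \<omega>) / (Re (F w) - Re \<omega>)"
          by (simp add: arctan_le_iff)
        then have "M' * (Re (F w) - Re \<omega>) \<le> Im (F w) - Im \<omega>"
          using Uw \<zeta>1 by (simp add: le_divide_eq)
        moreover have "M' * (Re (F w) / 2) \<le> M' * (Re (F w) - Re \<omega>)"
          using Uw \<zeta>1 \<open>M' \<ge> 0\<close> by (intro mult_left_mono) auto
        moreover have "\<bar>M\<bar> * Re (F w) + (\<bar>M\<bar> / 2 + \<bar>Im \<omega>\<bar>) \<le> M' * (Re (F w) / 2)"
        proof -
          have "u\<^sub>0 \<le> Re (F w)"
            using Re_F_up[OF p, of t] R by (simp add: u\<^sub>0_def w_def)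
          then have "(\<bar>M\<bar> / 2 + \<bar>Im \<omega>\<bar>) * 1 \<le> (\<bar>M\<bar> / 2 + \<bar>Im \<omega>\<bar>) * (Re (F w) / u\<^sub>0)"
            using \<open>u\<^sub>0 > 0\<close> by (intro mult_left_mono) auto
          then show ?thesis
            by (simp add: M'_def algebra_simps add_divide_distrib)
        qed
        moreover have "M * (Re (F w) + 1 / 2) \<le> \<bar>M\<bar> * (Re (F w) + 1 / 2)"
          using F_pos[OF w] by (intro mult_right_mono) auto
        ultimately have "M * (Re (F w) + 1 / 2) \<le> Im (F w)"
          by (simp add: algebra_simps)
        then show "M * (Re (F (vert p t)) + 1 / 2) \<le> Im (F (vert p t))"
          by (simp add: w_def)
      qed
    qed
  qed
qed

lemma Im_F_le_if_Arg_le: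
  assumes "Re (F z) > Re \<omega>" "Im (Ln (F z - \<omega>)) \<le> arctan a" "a \<ge> 0" "Re \<omega> > 0"
  shows "Im (F z) \<le> \<bar>Im \<omega>\<bar> + a * Re (F z)"
proof -
  have "arctan ((Im (F z) - Im \<omega>) / (Re (F z) - Re \<omega>)) \<le> arctan a"
    using Im_Ln_right_half_plane[of "F z - \<omega>"] assms by simp
  then have "Im (F z) - Im \<omega> \<le> a * (Re (F z) - Re \<omega>)"
    using assms by (simp add: arctan_le_iff divide_le_eq)
  moreover have "a * (Re (F z) - Re \<omega>) \<le> a * Re (F z)"
    using assms by (intro mult_left_mono) auto
  ultimately show ?thesis
    by linarith
qed

text \<open>Moving from the orbit to the middle of the right half-disc costs a factor depending on
  \<open>C\<close> only: discs of radius \<open>R / (4 * C)\<close> about the segment stay in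
  \<Omega>, and its length \<open>R / 2\<close> is \<open>2 * C\<close> such radii.\<close>

lemma Harnack_half_disc_centre:
  assumes R: "R > 0" and C: "C \<ge> 1"
    and right: "\<And>z. Re w \<le> Re z \<Longrightarrow> dist w z < R \<Longrightarrow> z \<in> \<Omega>"
    and left: "\<And>z. Re z \<le> Re w \<Longrightarrow> dist w z < R / C \<Longrightarrow> z \<in> \<Omega>"
  shows "Re (F (w + of_real (R / 2))) \<le> exp (4 * C) * Re (F w)"
    and "Re (F w) \<le> exp (4 * C) * Re (F (w + of_real (R / 2)))"
    and "norm (F (w + of_real (R / 2)) - F w) \<le> 4 * C * exp (4 * C) * Re (F w)"
proof -
  have seg: "ball x (R / (4 * C)) \<subseteq> \<Omega>" if x: "x \<in> closed_segment w (w + of_real (R / 2))" for x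
  proof
    fix y assume y: "y \<in> ball x (R / (4 * C))"
    obtain s where s: "0 \<le> s" "s \<le> 1" "x = (1 - s) *\<^sub>R w + s *\<^sub>R (w + of_real (R / 2))"
      using x by (auto simp: closed_segment_def)
    then have x_eq: "x = w + of_real (s * R / 2)"
      by (simp add: scaleR_conv_of_real algebra_simps)
    have dwx: "dist w x = s * R / 2"
      using s(1,2) R by (simp add: x_eq dist_norm norm_mult)
    have Cle: "R / (4 * C) \<le> R / 4"
    proof -
      have "R * 1 \<le> R * C"
        using R C by (intro mult_left_mono) auto
      then show ?thesis
        using C by (simp add: field_simps)
    qed
    show "y \<in> \<Omega>"
    proof (cases "Re w \<le> Re y")
      case True
      have "s * R \<le> R"
        using s R by (simp add: mult_left_le_one_le)
      then have "dist w y < R"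
        using dist_triangle[of w y x] y[unfolded mem_ball] dwx Cle R by linarith
      then show ?thesis
        using right True by blast
    next
      case False
      \<comment> \<open>If \<open>y\<close> falls to the left of \<open>w\<close>, then
        \<open>x\<close> is within \<open>R / (4 * C)\<close> of \<open>w\<close>, and the smaller
        left half-disc contains \<open>y\<close>.\<close>
      have "Re x - Re y \<le> dist x y"
        using abs_Re_le_cmod[of "x - y"] by (simp add: dist_norm)
      then have "s * R / 2 < R / (4 * C)"
        using y False by (simp add: x_eq)
      then have "dist w y < R / (4 * C) + R / (4 * C)"
        using dist_triangle[of w y x] y dwx by simp
      also have "\<dots> \<le> R / C"
        using R C by (simp add: field_simps)
      finally show ?thesis
        using left False by simp
    qed
  qed
  have "dist w (w + of_real (R / 2)) \<le> 2 * C * (R / (4 * C))"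
    using R C by (simp add: dist_norm)
  note H = Harnack_segment[OF _ seg this]
  show "Re (F (w + of_real (R / 2))) \<le> exp (4 * C) * Re (F w)"
    "Re (F w) \<le> exp (4 * C) * Re (F (w + of_real (R / 2)))"
    "norm (F (w + of_real (R / 2)) - F w) \<le> 4 * C * exp (4 * C) * Re (F w)"
    using H(2-4) R C by simp_all
qed

text \<open>A homothety with centre \<open>q\<close> and ratio at least \<theta> shrinks the disc of
  radius \<open>R / 4\<close> about \<open>c\<close>; by convexity the image stays in the half-disc
  and contains a disc of radius \<open>\<theta> * R / 4\<close>. The segment has length at most
  \<open>3 / 2 * R\<close>, which is \<open>6 / \<theta>\<close> such radii.\<close>

lemma Harnack_half_disc_boundary:
  assumes R: "R > 0" and \<theta>: "0 < \<theta>" "\<theta> \<le> 1"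
    and right: "\<And>z. Re w \<le> Re z \<Longrightarrow> dist w z < R \<Longrightarrow> z \<in> \<Omega>"
    and q: "Re w \<le> Re q" "dist w q \<le> R"
  defines "c \<equiv> w + of_real (R / 2)"
  defines "z \<equiv> q + of_real \<theta> * (c - q)"
  shows "Re (F z) \<le> exp (12 / \<theta>) * Re (F c)" and "Re (F c) \<le> exp (12 / \<theta>) * Re (F z)"
    and "norm (F z - F c) \<le> 12 / \<theta> * exp (12 / \<theta>) * Re (F c)"
proof -
  have dcq: "dist c q \<le> 3 / 2 * R"
    using dist_triangle[of c q w] q R by (simp add: c_def dist_norm)
  have seg: "ball x (\<theta> * R / 4) \<subseteq> \<Omega>" if x: "x \<in> closed_segment c z" for x
  proof
    fix y assume y: "y \<in> ball x (\<theta> * R / 4)"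
    obtain s where s: "0 \<le> s" "s \<le> 1" "x = (1 - s) *\<^sub>R c + s *\<^sub>R z"
      using x by (auto simp: closed_segment_def)
    define \<mu> where "\<mu> = (1 - s) + s * \<theta>"
    have \<mu>: "\<mu> > 0" "\<mu> \<le> 1" "\<theta> \<le> \<mu>"
    proof -
      have "\<mu> - \<theta> = (1 - s) * (1 - \<theta>)"
        by (simp add: \<mu>_def algebra_simps)
      then show "\<theta> \<le> \<mu>"
        using s \<theta> by (smt (verit) mult_nonneg_nonneg)
      then show "\<mu> > 0"
        using \<theta> by simp
      show "\<mu> \<le> 1"
        using s \<theta> mult_left_le[of \<theta> s] by (simp add: \<mu>_def)
    qed
    have x_eq: "x = q + of_real \<mu> * (c - q)"
      by (simp add: s(3) z_def \<mu>_def scaleR_conv_of_real algebra_simps)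
    \<comment> \<open>The preimage of \<open>y\<close> under the homothety with centre
      \<open>q\<close> and ratio \<mu>.\<close>
    define c' where "c' = c + (y - x) / of_real \<mu>"
    have y_eq: "y = (1 - \<mu>) *\<^sub>R q + \<mu> *\<^sub>R c'"
      using \<mu>(1) by (simp add: c'_def x_eq scaleR_conv_of_real field_simps)
    have "dist c c' = dist x y / \<mu>"
      using \<mu>(1) by (simp add: c'_def dist_norm norm_divide norm_minus_commute)
    also have "\<dots> < R / 4"
    proof -
      have "\<theta> * R \<le> \<mu> * R"
        using \<mu>(3) R by (intro mult_right_mono) auto
      then show ?thesis
        using y \<mu>(1) by (simp add: divide_less_eq mult.commute)
    qed
    finally have dcc: "dist c c' < R / 4" .
    have "Re w \<le> Re c'"
      using abs_Re_le_cmod[of "c - c'"] dcc R by (simp add: dist_norm c_def)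
    have "dist w c' < R"
      using dist_triangle[of w c' c] dcc R by (simp add: c_def dist_norm)
    have "Re y = (1 - \<mu>) * Re q + \<mu> * Re c'"
      by (simp add: y_eq)
    moreover have "(1 - \<mu>) * Re w + \<mu> * Re w \<le> (1 - \<mu>) * Re q + \<mu> * Re c'"
      using \<mu> q \<open>Re w \<le> Re c'\<close> by (intro add_mono mult_left_mono) auto
    ultimately have "Re w \<le> Re y"
      by (simp add: algebra_simps)
    have "y - w = (1 - \<mu>) *\<^sub>R (q - w) + \<mu> *\<^sub>R (c' - w)"
      by (simp add: y_eq algebra_simps)
    then have "norm (y - w) \<le> (1 - \<mu>) * norm (q - w) + \<mu> * norm (c' - w)"
      using \<mu> norm_triangle_ineq[of "(1 - \<mu>) *\<^sub>R (q - w)" "\<mu> *\<^sub>R (c' - w)"] by simp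
    then have "dist w y \<le> (1 - \<mu>) * dist w q + \<mu> * dist w c'"
      by (simp add: dist_norm norm_minus_commute)
    also have "\<dots> < (1 - \<mu>) * R + \<mu> * R"
      using \<mu> q \<open>dist w c' < R\<close> by (intro add_le_less_mono mult_left_mono mult_strict_left_mono) auto
    finally have "dist w y < R"
      by (simp add: algebra_simps)
    then show "y \<in> \<Omega>"
      using right \<open>Re w \<le> Re y\<close> by blast
  qed
  have "dist c z = (1 - \<theta>) * dist c q"
  proof -
    have "c - z = of_real (1 - \<theta>) * (c - q)"
      by (simp add: z_def algebra_simps)
    then show ?thesis
      using \<theta> by (simp only: dist_norm norm_mult norm_of_real)
  qed
  also have "\<dots> \<le> 1 * (3 / 2 * R)"
    using dcq \<theta> by (intro mult_mono) auto
  also have "\<dots> = 6 / \<theta> * (\<theta> * R / 4)"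
    using \<theta> by simp
  finally have "dist c z \<le> 6 / \<theta> * (\<theta> * R / 4)" .
  note H = Harnack_segment[OF _ seg this]
  show "Re (F z) \<le> exp (12 / \<theta>) * Re (F c)" "Re (F c) \<le> exp (12 / \<theta>) * Re (F z)"
    "norm (F z - F c) \<le> 12 / \<theta> * exp (12 / \<theta>) * Re (F c)"
    using H(2-4) R \<theta> by (simp_all add: mult.assoc)
qed

text \<open>The disc about \<open>q\<close> whose radius is half the horizontal gap to
  \<open>w\<close> lies to the right of \<open>k \<omega>\<close>, so the level line of \<omega> can
  enter it only below \<omega>. From a point as close to \<open>q\<close> as \<open>z\<close> the
  slit below \<open>q\<close> dominates, which pushes the argument seen from \<omega> below
  \<open>0\<close>.\<close>

lemma Im_F_le_near_wall:
  assumes \<zeta>1: "Re \<omega> > 0" "Re (k \<omega>) \<le> Re w" and R: "R > 0"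
    and right: "\<And>z. Re w \<le> Re z \<Longrightarrow> dist w z < R \<Longrightarrow> z \<in> \<Omega>"
    and q: "q \<notin> \<Omega>" "dist w q = R" "Re q - Re w \<ge> R / 4"
  defines "z \<equiv> q + of_real (1 / 400) * (w + of_real (R / 2) - q)"
  assumes "Re (F z) > Re \<omega>" and zO: "z \<in> \<Omega>"
  shows "Im (F z) \<le> \<bar>Im \<omega>\<bar>"
proof -
  define \<rho> where "\<rho> = (Re q - Re w) / 2"
  have "\<rho> > 0"
    using q R by (simp add: \<rho>_def)
  have "dist (w + of_real (R / 2)) q \<le> 3 / 2 * R"
    using dist_triangle[of "w + of_real (R / 2)" q w] q R by (simp add: dist_norm)
  then have "norm (z - q) \<le> 1 / 400 * (3 / 2 * R)"
    by (simp add: z_def dist_norm norm_mult)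
  \<comment> \<open>The gap condition says \<open>R \<le> 8 * \<rho>\<close>.\<close>
  also have "\<dots> \<le> 3 / 100 * \<rho>"
    using q by (simp add: \<rho>_def)
  finally have zq: "norm (z - q) \<le> 3 / 100 * \<rho>" .
  have sep: "Im \<zeta> < Im \<omega>" if \<zeta>: "Re \<zeta> = Re \<omega>" "norm (k \<zeta> - q) \<le> \<rho>" for \<zeta>
  proof (rule ccontr)
    assume "\<not> Im \<zeta> < Im \<omega>"
    then have "Re (k \<zeta>) \<le> Re (k \<omega>)"
      by (intro Re_k_antimono) (use \<zeta>1 \<zeta> in simp_all)
    moreover have "Re q - Re (k \<zeta>) \<le> \<rho>"
      using abs_Re_le_cmod[of "k \<zeta> - q"] \<zeta>(2) by simp
    ultimately show False
      using \<zeta>1(2) \<open>\<rho> > 0\<close> by (simp add: \<rho>_def)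
  qed
  have "pi / 2 + Im (Ln (F z - \<omega>)) \<le> 8 * sqrt (norm (k (F z) - q) / \<rho>)"
    by (rule slit_disc_bound_mirror[OF \<zeta>1(1) q(1) \<open>\<rho> > 0\<close> sep]) (use assms zq \<open>\<rho> > 0\<close> in auto)
  \<comment> \<open>The square of \<open>3 / 16\<close> exceeds \<open>3 / 100\<close>, and
    \<open>8 * (3 / 16) = 3 / 2\<close> is below \<open>pi / 2\<close>.\<close>
  also have "\<dots> \<le> 8 * sqrt ((3 / 16) ^ 2)"
  proof -
    have "norm (z - q) / \<rho> \<le> 3 / 100"
      using zq \<open>\<rho> > 0\<close> by (simp add: divide_le_eq)
    then have "norm (k (F z) - q) / \<rho> \<le> (3 / 16) ^ 2"
      using zO by (simp add: power2_eq_square)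
    from real_sqrt_le_mono[OF this] show ?thesis
      by (rule mult_left_mono) simp
  qed
  also have "\<dots> = 3 / 2"
    by simp
  finally have "Im (Ln (F z - \<omega>)) \<le> arctan 0"
    using pi_gt3 by simp
  then show ?thesis
    using Im_F_le_if_Arg_le[of \<omega> z 0] assms by simp
qed

lemma Im_F_le_right_of_slit:
  assumes \<zeta>1: "Re \<omega> > 0" "Re (k \<omega>) \<le> Re q" and q: "q \<notin> \<Omega>" and z: "z \<in> \<Omega>" "Re (F z) > Re \<omega>"
    and le: "Re z > Re q" "Im z - Im q \<le> a * (Re z - Re q)" and a: "a \<ge> 0"
  shows "Im (F z) \<le> \<bar>Im \<omega>\<bar> + a * Re (F z)"
proof (rule Im_F_le_if_Arg_le[OF z(2) _ a \<zeta>1(1)])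
  have "Im (Ln (F z - \<omega>)) \<le> Im (Ln (z - q))"
    using Arg_comparison[OF \<zeta>1(1) q \<zeta>1(2), of "F z"] z le by simp
  also have "\<dots> = arctan ((Im z - Im q) / (Re z - Re q))"
    using Im_Ln_right_half_plane[of "z - q"] le by simp
  also have "\<dots> \<le> arctan a"
    using le by (simp add: arctan_le_iff divide_le_eq)
  finally show "Im (Ln (F z - \<omega>)) \<le> arctan a" .
qed

text \<open>Consider the vertical line through a point outside \<Omega>. Either it meets \<Omega>,
  or it lies entirely outside at a fixed distance from the orbit, and then half-discs growing
  linearly in \<open>t\<close> eventually contain one of its points.\<close>

lemma exists_boundary_below_domain_point:
  assumes "p \<in> \<Omega>" and C: "C \<ge> 1"
  shows "(\<exists>p\<^sub>0 q\<^sub>0. p\<^sub>0 \<in> \<Omega> \<and> q\<^sub>0 \<notin> \<Omega> \<and> Re p\<^sub>0 = Re q\<^sub>0) \<or>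
    (\<forall>\<^sub>F t in at_top. \<not> ((\<forall>z. Re p \<le> Re z \<longrightarrow> dist (vert p t) z < t \<longrightarrow> z \<in> \<Omega>) \<and>
       (\<forall>z. Re z \<le> Re p \<longrightarrow> dist (vert p t) z < t / C \<longrightarrow> z \<in> \<Omega>)))"
proof -
  obtain b where b: "b \<notin> \<Omega>"
    using domain_not_UNIV by auto
  define x where "x = Re b - Re p"
  show ?thesis
  proof (cases "\<exists>t. vert p t + of_real x \<in> \<Omega>")
    case True
    then obtain t where "vert p t + of_real x \<in> \<Omega>"
      by blast
    then show ?thesis
      using b by (intro disjI1 exI[of _ "vert p t + of_real x"] exI[of _ b]) (simp add: x_def)
  next
    case False
    have "\<forall>\<^sub>F t in at_top. \<not> ((\<forall>z. Re p \<le> Re z \<longrightarrow> dist (vert p t) z < t \<longrightarrow> z \<in> \<Omega>) \<and>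
       (\<forall>z. Re z \<le> Re p \<longrightarrow> dist (vert p t) z < t / C \<longrightarrow> z \<in> \<Omega>))"
      using eventually_gt_at_top[of "C * \<bar>x\<bar>"]
    proof eventually_elim
      case (elim t)
      have "\<bar>x\<bar> \<le> C * \<bar>x\<bar>"
        using C by (simp add: mult_le_cancel_right1)
      then have "\<bar>x\<bar> < t" "\<bar>x\<bar> < t / C"
        using elim C by (auto simp: less_divide_eq mult.commute)
      define z where "z = vert p t + of_real x"
      have "z \<notin> \<Omega>"
        using False by (simp add: z_def)
      moreover have "dist (vert p t) z = \<bar>x\<bar>"
        by (simp add: z_def dist_norm)
      moreover have "Re p \<le> Re z \<or> Re z \<le> Re p"
        by linarith
      ultimately show ?case
        using \<open>\<bar>x\<bar> < t\<close> \<open>\<bar>x\<bar> < t / C\<close> by metis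
    qed
    then show ?thesis
      by blast
  qed
qed

text \<open>The horizontal offset of \<open>q\<close> decides. If it is less than
  \<open>R / 4\<close>, the centre \<open>c\<close> of the Harnack chain lies to the right of
  \<open>q\<close> and \<open>Arg_comparison\<close> bounds the slope there. Otherwise the chain is
  prolonged to a point near \<open>q\<close>, where \<open>Im_F_le_near_wall\<close> applies.
  Harnack carries either bound back to the orbit.\<close>

lemma Im_F_bounded_above_if_right_boundary_close:
  assumes p: "p \<in> \<Omega>" and C: "C \<ge> 1"
  obtains K where
    "\<forall>\<^sub>F t in at_top. \<forall>R q. 0 < R \<longrightarrow> R \<le> t \<longrightarrow> (\<forall>z. Re p \<le> Re z \<longrightarrow> dist (vert p t) z < R \<longrightarrow> z \<in> \<Omega>) \<longrightarrow>
       (\<forall>z. Re z \<le> Re p \<longrightarrow> dist (vert p t) z < R / C \<longrightarrow> z \<in> \<Omega>) \<longrightarrow>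
       q \<notin> \<Omega> \<longrightarrow> Re p \<le> Re q \<longrightarrow> dist (vert p t) q = R \<longrightarrow>
       Im (F (vert p t)) \<le> K * (Re (F (vert p t)) + 1 / 2)"
  using right_base_point[OF p p]
proof
  assume "(\<exists>B. \<forall>s\<ge>0. Re (F (vert p s)) \<le> B) \<and> filterlim (\<lambda>s. Im (F (vert p s))) at_bot at_top"
  then have "\<forall>\<^sub>F t in at_top. Im (F (vert p t)) \<le> 0"
    by (simp add: filterlim_at_bot)
  then show thesis
    by (intro that[of 0]) (auto elim: eventually_mono)
next
  define E where "E = exp (4 * C)"
  define E' :: real where "E' = exp (12 / (1 / 400))"
  have E: "E > 0" "E' \<ge> 1"
    by (simp_all add: E_def E'_def)
  assume "\<forall>C. \<exists>\<omega>. Re \<omega> > 0 \<and> Re (k \<omega>) \<le> Re p \<and> (\<forall>\<^sub>F s in at_top. C * Re \<omega> < Re (F (vert p s)))"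
  \<comment> \<open>The two Harnack steps, from \<open>w\<close> to \<open>c\<close> and from
    \<open>c\<close> to \<open>z\<close>, may lower \<open>Re F\<close> by the factors
    \<open>E\<close> and \<open>E'\<close>; the level must still exceed \<open>Re \<omega>\<close>
    afterwards.\<close>
  then obtain \<omega> where \<zeta>1: "Re \<omega> > 0" "Re (k \<omega>) \<le> Re p"
    and ev: "\<forall>\<^sub>F s in at_top. (E * E') * Re \<omega> < Re (F (vert p s))"
    by meson
  define K\<^sub>1 where "K\<^sub>1 = 4 * E + 4 * C * E"
  define K\<^sub>2 where "K\<^sub>2 = 12 / (1 / 400) * E' * E + 4 * C * E"
  \<comment> \<open>\<open>K\<^sub>1\<close> and \<open>K\<^sub>2\<close> belong to the two
    positions of \<open>q\<close>; twice \<open>\<bar>Im \<omega>\<bar>\<close> is needed because it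
    is paid for by the summand \<open>1 / 2\<close>.\<close>
  define K where "K = 2 * \<bar>Im \<omega>\<bar> + K\<^sub>1 + K\<^sub>2"
  have K12: "K\<^sub>1 \<ge> 0" "K\<^sub>2 \<ge> 0"
    using E C by (auto simp: K\<^sub>1_def K\<^sub>2_def)
  show thesis
  proof (rule that[of K])
    show "\<forall>\<^sub>F t in at_top. \<forall>R q. 0 < R \<longrightarrow> R \<le> t \<longrightarrow> (\<forall>z. Re p \<le> Re z \<longrightarrow> dist (vert p t) z < R \<longrightarrow> z \<in> \<Omega>) \<longrightarrow>
       (\<forall>z. Re z \<le> Re p \<longrightarrow> dist (vert p t) z < R / C \<longrightarrow> z \<in> \<Omega>) \<longrightarrow>
       q \<notin> \<Omega> \<longrightarrow> Re p \<le> Re q \<longrightarrow> dist (vert p t) q = R \<longrightarrow>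
       Im (F (vert p t)) \<le> K * (Re (F (vert p t)) + 1 / 2)"
      using ev
    proof eventually_elim
      case (elim t)
      show ?case
      proof (intro allI impI)
        fix R q
        define w where "w = vert p t"
        assume R: "0 < R" "R \<le> t" and "\<forall>z. Re p \<le> Re z \<longrightarrow> dist (vert p t) z < R \<longrightarrow> z \<in> \<Omega>"
          "\<forall>z. Re z \<le> Re p \<longrightarrow> dist (vert p t) z < R / C \<longrightarrow> z \<in> \<Omega>"
          and q: "q \<notin> \<Omega>" "Re p \<le> Re q" "dist (vert p t) q = R"
        then have right: "\<And>z. Re w \<le> Re z \<Longrightarrow> dist w z < R \<Longrightarrow> z \<in> \<Omega>"
          and left: "\<And>z. Re z \<le> Re w \<Longrightarrow> dist w z < R / C \<Longrightarrow> z \<in> \<Omega>"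
          and q': "Re w \<le> Re q" "dist w q = R"
          by (auto simp: w_def)
        have wO: "w \<in> \<Omega>"
          using right[of w] R by simp
        then have Uw: "Re (F w) > 0"
          by (rule F_pos)
        define c where "c = w + of_real (R / 2)"
        have H: "Re (F c) \<le> E * Re (F w)" "Re (F w) \<le> E * Re (F c)" "norm (F c - F w) \<le> 4 * C * E * Re (F w)"
          using Harnack_half_disc_centre[OF R(1) C right left] by (simp_all add: c_def E_def)
        have cO: "c \<in> \<Omega>"
          using right[of c] R by (simp add: c_def dist_norm)
        have "E * E' * Re \<omega> < E * Re (F c)"
          using elim H(2) by (simp add: w_def)
        then have Uc: "E' * Re \<omega> < Re (F c)"
          using E by simp
        have "Im (F w) \<le> \<bar>Im \<omega>\<bar> + (K\<^sub>1 + K\<^sub>2) * Re (F w)"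
        proof (cases "Re q - Re w \<ge> R / 4")
          case False
          have "1 * Re \<omega> \<le> E' * Re \<omega>"
            using E \<zeta>1 by (intro mult_right_mono) auto
          then have "Re \<omega> < Re (F c)"
            using Uc by simp
          \<comment> \<open>The height difference is at most \<open>R\<close> and the horizontal one
            more than \<open>R / 2 - R / 4\<close>, which gives the slope \<open>4\<close>.\<close>
          moreover have "Im c - Im q \<le> 4 * (Re c - Re q)"
            using abs_Im_le_cmod[of "w - q"] q' False by (simp add: c_def dist_norm)
          ultimately have "Im (F c) \<le> \<bar>Im \<omega>\<bar> + 4 * Re (F c)"
            by (intro Im_F_le_right_of_slit[of _ q]) (use \<zeta>1 q cO False in \<open>auto simp: c_def w_def\<close>)
          moreover have "Im (F w) - Im (F c) \<le> norm (F c - F w)"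
            using abs_Im_le_cmod[of "F c - F w"] by simp
          moreover have "0 \<le> K\<^sub>2 * Re (F w)"
            using K12 Uw by simp
          ultimately show ?thesis
            using H by (simp add: K\<^sub>1_def algebra_simps)
        next
          case True
          define z where "z = q + of_real (1 / 400) * (c - q)"
          have H': "Re (F c) \<le> E' * Re (F z)" "norm (F z - F c) \<le> 12 / (1 / 400) * E' * Re (F c)"
            using Harnack_half_disc_boundary[OF R(1), of "1 / 400" w q] right q' by (simp_all add: c_def z_def E'_def)
          have "E' * Re \<omega> < E' * Re (F z)"
            using Uc H'(1) by simp
          then have Uz: "Re \<omega> < Re (F z)"
            using E by simp
          have zO: "z \<in> \<Omega>"
          proof (rule right)
            have "z - w = (1 - 1 / 400) *\<^sub>R (q - w) + (1 / 400) *\<^sub>R (c - w)"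
              by (simp add: z_def scaleR_conv_of_real field_simps)
            then have "norm (z - w) \<le> (1 - 1 / 400) * norm (q - w) + (1 / 400) * norm (c - w)"
              using norm_triangle_ineq[of "(1 - 1 / 400) *\<^sub>R (q - w)" "(1 / 400) *\<^sub>R (c - w)"] by simp
            moreover have "norm (q - w) = R" "norm (c - w) = R / 2"
              using q' R by (simp_all add: c_def dist_norm norm_minus_commute)
            ultimately show "dist w z < R"
              using R by (simp add: dist_norm norm_minus_commute)
            show "Re w \<le> Re z"
              using True R by (simp add: z_def c_def field_simps)
          qed
          have "Im (F z) \<le> \<bar>Im \<omega>\<bar>"
            unfolding z_def c_def
            by (rule Im_F_le_near_wall[OF \<zeta>1(1) _ R(1) right q(1) q'(2) True])
               (use \<zeta>1 Uz zO in \<open>auto simp: z_def c_def w_def\<close>)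
          moreover have "Im (F w) - Im (F c) \<le> norm (F c - F w)" "Im (F c) - Im (F z) \<le> norm (F z - F c)"
            using abs_Im_le_cmod[of "F c - F w"] abs_Im_le_cmod[of "F z - F c"] by simp_all
          moreover have "12 / (1 / 400) * E' * Re (F c) \<le> 12 / (1 / 400) * E' * (E * Re (F w))"
            using H(1) E by (intro mult_left_mono) auto
          moreover have "0 \<le> K\<^sub>1 * Re (F w)"
            using K12 Uw by simp
          ultimately show ?thesis
            using H(3) H'(2) by (simp add: K\<^sub>2_def algebra_simps)
        qed
        also have "\<dots> \<le> K * (Re (F w) + 1 / 2)"
        proof -
          have "0 \<le> \<bar>Im \<omega>\<bar> * Re (F w)"
            using Uw by simp
          then show ?thesis
            using K12 by (simp add: K_def algebra_simps)
        qed
        finally show "Im (F (vert p t)) \<le> K * (Re (F (vert p t)) + 1 / 2)"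
          by (simp add: w_def)
      qed
    qed
  qed
qed

text \<open>When there is no boundary at distance less than \<open>t\<close> on the right, a fixed boundary point takes over.\<close>

lemma Im_F_bounded_above_if_right_boundary_far:
  assumes p: "p \<in> \<Omega>" and C: "C \<ge> 1"
  obtains K where
    "\<forall>\<^sub>F t in at_top. (\<forall>z. Re p \<le> Re z \<longrightarrow> dist (vert p t) z < t \<longrightarrow> z \<in> \<Omega>) \<longrightarrow>
       (\<forall>z. Re z \<le> Re p \<longrightarrow> dist (vert p t) z < t / C \<longrightarrow> z \<in> \<Omega>) \<longrightarrow>
       Im (F (vert p t)) \<le> K * (Re (F (vert p t)) + 1 / 2)"
  using exists_boundary_below_domain_point[OF p C]
proof
  assume "\<forall>\<^sub>F t in at_top. \<not> ((\<forall>z. Re p \<le> Re z \<longrightarrow> dist (vert p t) z < t \<longrightarrow> z \<in> \<Omega>) \<and>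
       (\<forall>z. Re z \<le> Re p \<longrightarrow> dist (vert p t) z < t / C \<longrightarrow> z \<in> \<Omega>))"
  then show thesis
    by (intro that[of 0]) (auto elim: eventually_mono)
next
  assume "\<exists>p\<^sub>0 q\<^sub>0. p\<^sub>0 \<in> \<Omega> \<and> q\<^sub>0 \<notin> \<Omega> \<and> Re p\<^sub>0 = Re q\<^sub>0"
  then obtain p\<^sub>0 q where p0: "p\<^sub>0 \<in> \<Omega>" "q \<notin> \<Omega>" "Re p\<^sub>0 = Re q"
    by blast
  \<comment> \<open>Since \<open>p\<^sub>0\<close> and \<open>q\<close> share their abscissa, the
    base point obtained here lies weakly to the left of \<open>q\<close>.\<close>
  from right_base_point[OF p p0(1)] show thesis
  proof
    assume "(\<exists>B. \<forall>s\<ge>0. Re (F (vert p s)) \<le> B) \<and> filterlim (\<lambda>s. Im (F (vert p s))) at_bot at_top"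
    then have "\<forall>\<^sub>F t in at_top. Im (F (vert p t)) \<le> 0"
      by (simp add: filterlim_at_bot)
    then show thesis
      by (intro that[of 0]) (auto elim: eventually_mono)
  next
    define E where "E = exp (4 * C)"
    have E: "E > 0"
      by (simp add: E_def)
    assume "\<forall>C. \<exists>\<omega>. Re \<omega> > 0 \<and> Re (k \<omega>) \<le> Re p\<^sub>0 \<and> (\<forall>\<^sub>F s in at_top. C * Re \<omega> < Re (F (vert p s)))"
    then obtain \<omega> where \<zeta>1: "Re \<omega> > 0" "Re (k \<omega>) \<le> Re p\<^sub>0"
      and ev: "\<forall>\<^sub>F s in at_top. E * Re \<omega> < Re (F (vert p s))"
      by meson
    define K where "K = 2 * \<bar>Im \<omega>\<bar> + 8 * E + 4 * C * E"
    define a where "a = \<bar>Re p - Re q\<bar>"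
    define b where "b = \<bar>Im p - Im q\<bar>"
    have ab: "0 \<le> a" "0 \<le> b" "Re q - Re p \<le> a" "Im p - Im q \<le> b"
      by (auto simp: a_def b_def)
    show thesis
    proof (rule that[of K])
      show "\<forall>\<^sub>F t in at_top. (\<forall>z. Re p \<le> Re z \<longrightarrow> dist (vert p t) z < t \<longrightarrow> z \<in> \<Omega>) \<longrightarrow>
         (\<forall>z. Re z \<le> Re p \<longrightarrow> dist (vert p t) z < t / C \<longrightarrow> z \<in> \<Omega>) \<longrightarrow>
         Im (F (vert p t)) \<le> K * (Re (F (vert p t)) + 1 / 2)"
        \<comment> \<open>For such \<open>t\<close> the centre \<open>c\<close>, at horizontal
          distance \<open>t / 2\<close> from the orbit, is to the right of \<open>q\<close>, and the
          slope from \<open>q\<close> to \<open>c\<close> is at most \<open>8\<close>.\<close>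
        using ev eventually_gt_at_top[of "4 * a + b"]
      proof eventually_elim
        case (elim t)
        show ?case
        proof (intro impI)
          define w where "w = vert p t"
          assume "\<forall>z. Re p \<le> Re z \<longrightarrow> dist (vert p t) z < t \<longrightarrow> z \<in> \<Omega>"
            "\<forall>z. Re z \<le> Re p \<longrightarrow> dist (vert p t) z < t / C \<longrightarrow> z \<in> \<Omega>"
          then have right: "\<And>z. Re w \<le> Re z \<Longrightarrow> dist w z < t \<Longrightarrow> z \<in> \<Omega>"
            and left: "\<And>z. Re z \<le> Re w \<Longrightarrow> dist w z < t / C \<Longrightarrow> z \<in> \<Omega>"
            by (auto simp: w_def)
          have t: "t > 0"
            using elim(2) ab by linarith
          have "w \<in> \<Omega>"
            using right[of w] t by simp
          then have Uw: "Re (F w) > 0"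
            by (rule F_pos)
          define c where "c = w + of_real (t / 2)"
          have H: "Re (F c) \<le> E * Re (F w)" "Re (F w) \<le> E * Re (F c)" "norm (F c - F w) \<le> 4 * C * E * Re (F w)"
            using Harnack_half_disc_centre[OF t C right left] by (simp_all add: c_def E_def)
          have cO: "c \<in> \<Omega>"
            using right[of c] t by (simp add: c_def dist_norm)
          have "E * Re \<omega> < E * Re (F c)"
            using elim H(2) by (simp add: w_def)
          then have Uc: "Re \<omega> < Re (F c)"
            using E by simp
          have "Im c - Im q \<le> 8 * (Re c - Re q)" "Re c > Re q"
            using elim(2) ab t by (simp_all add: c_def w_def)
          then have "Im (F c) \<le> \<bar>Im \<omega>\<bar> + 8 * Re (F c)"
            by (intro Im_F_le_right_of_slit[of _ q]) (use \<zeta>1 p0 cO Uc in auto)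
          moreover have "Im (F w) - Im (F c) \<le> norm (F c - F w)"
            using abs_Im_le_cmod[of "F c - F w"] by simp
          moreover have "0 \<le> \<bar>Im \<omega>\<bar> * Re (F w)" "0 \<le> C * E"
            using Uw E C by simp_all
          ultimately have "Im (F w) \<le> K * (Re (F w) + 1 / 2)"
            using H E by (simp add: K_def algebra_simps)
          then show "Im (F (vert p t)) \<le> K * (Re (F (vert p t)) + 1 / 2)"
            by (simp add: w_def)
        qed
      qed
    qed
  qed
qed

end

section \<open>Geometric content of the truncated distances, and their reflection\<close>

lemma truncated_distance:
  fixes A :: "complex set" and w :: complex
  assumes "closed A" "t \<ge> 0"
  defines "\<delta> \<equiv> real_of_ereal (min (ereal t) (INF z\<in>A. ereal (cmod (z - w))))"
  shows "\<delta> \<le> t" and "\<And>z. z \<in> A \<Longrightarrow> \<delta> \<le> dist w z" and "\<delta> = t \<or> (\<exists>q\<in>A. dist w q = \<delta>)"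
proof -
  have "\<delta> \<le> t \<and> (\<forall>z\<in>A. \<delta> \<le> dist w z) \<and> (\<delta> = t \<or> (\<exists>q\<in>A. dist w q = \<delta>))"
  proof (cases "A = {}")
    case True
    then show ?thesis
      by (simp add: \<delta>_def top_ereal_def)
  next
    case False
    then obtain q where q: "q \<in> A" "\<And>z. z \<in> A \<Longrightarrow> dist w q \<le> dist w z"
      using distance_attains_inf[OF assms(1), of w] by blast
    have "(INF z\<in>A. ereal (cmod (z - w))) = ereal (dist w q)"
    proof (rule antisym)
      show "(INF z\<in>A. ereal (cmod (z - w))) \<le> ereal (dist w q)"
        using q(1) by (intro INF_lower2[of q]) (auto simp: dist_norm norm_minus_commute)
      show "ereal (dist w q) \<le> (INF z\<in>A. ereal (cmod (z - w)))"
        using q(2) by (intro INF_greatest) (auto simp: dist_norm norm_minus_commute)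
    qed
    then have "\<delta> = min t (dist w q)"
      by (simp add: \<delta>_def min_def)
    then show ?thesis
      using q by (auto simp: min_def intro: order_trans)
  qed
  then show "\<delta> \<le> t" "\<And>z. z \<in> A \<Longrightarrow> \<delta> \<le> dist w z" "\<delta> = t \<or> (\<exists>q\<in>A. dist w q = \<delta>)"
    by auto
qed

text \<open>A segment that leaves \<Omega> crosses the frontier; convexity keeps the crossing in
  \<open>H\<close>, no farther from \<open>w\<close> than \<open>z\<close> is.\<close>

lemma mem_if_no_frontier_near:
  fixes \<Omega> :: "'a::euclidean_space set"
  assumes "w \<in> \<Omega>" and H: "convex H" "w \<in> H"
    and far: "\<And>z. z \<in> frontier \<Omega> \<Longrightarrow> z \<in> H \<Longrightarrow> r \<le> dist w z"
    and z: "z \<in> H" "dist w z < r"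
  shows "z \<in> \<Omega>"
proof (rule ccontr)
  assume "z \<notin> \<Omega>"
  then have "closed_segment w z \<inter> \<Omega> \<noteq> {}" "closed_segment w z - \<Omega> \<noteq> {}"
    using \<open>w \<in> \<Omega>\<close> ends_in_segment[of w z] by blast+
  from connected_Int_frontier[OF connected_segment this]
  obtain y where y: "y \<in> closed_segment w z" "y \<in> frontier \<Omega>"
    by auto
  have "y \<in> H"
    using y(1) closed_segment_subset[OF H(2) z(1) H(1)] by blast
  moreover have "dist w y \<le> dist w z"
    using y(1) by (metis dist_commute dist_in_closed_segment)
  ultimately show False
    using far[OF y(2)] z(2) by simp
qed

lemma frontier_mirror: "frontier ((\<lambda>z. - cnj z) ` \<Omega>) = (\<lambda>z. - cnj z) ` frontier \<Omega>"
proof -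
  have lin: "linear (\<lambda>z. - cnj z)"
    by (intro linearI) (auto simp: scaleR_conv_of_real)
  have inj: "inj (\<lambda>z. - cnj z)"
    by (auto simp: inj_on_def)
  have "interior ((\<lambda>z. - cnj z) ` \<Omega>) = (\<lambda>z. - cnj z) ` interior \<Omega>"
    by (rule interior_injective_linear_image[OF lin inj])
  moreover have "closure ((\<lambda>z. - cnj z) ` \<Omega>) = (\<lambda>z. - cnj z) ` closure \<Omega>"
    using closure_injective_linear_image[OF lin inj] by simp
  ultimately show ?thesis
    using inj by (simp add: frontier_def image_set_diff)
qed

lemma delta_plus_mirror: "delta_plus ((\<lambda>z. - cnj z) ` \<Omega>) (- cnj p) t = delta_minus \<Omega> p t"
proof -
  have "{z \<in> (\<lambda>z. - cnj z) ` frontier \<Omega>. Re z \<ge> Re (- cnj p)} = (\<lambda>z. - cnj z) ` {z \<in> frontier \<Omega>. Re z \<le> Re p}"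
    by auto
  moreover have "cmod (- cnj z - (- cnj p + \<i> * of_real t)) = cmod (z - (vert p t))" for z
  proof -
    have "- cnj z - (- cnj p + \<i> * of_real t) = - cnj (z - (vert p t))"
      by simp
    then show ?thesis
      by (simp only: norm_minus_cancel complex_mod_cnj)
  qed
  ultimately show ?thesis
    by (simp add: delta_plus_def delta_minus_def frontier_mirror image_image)
qed

lemma delta_minus_mirror: "delta_minus ((\<lambda>z. - cnj z) ` \<Omega>) (- cnj p) t = delta_plus \<Omega> p t"
  using delta_plus_mirror[of "(\<lambda>z. - cnj z) ` \<Omega>" "- cnj p" t] by (simp add: image_image)

context half_plane_model
begin

lemma frontier_disjoint: "z \<in> frontier \<Omega> \<Longrightarrow> z \<notin> \<Omega>"
  using open_domain by (simp add: frontier_def interior_open)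

text \<open>This is the form in which the estimates of \<open>Im F\<close> use the distance: a
  half-disc free of the complement, with a point of the complement on its rim unless the truncation
  at \<open>t\<close> is active.\<close>

lemma delta_plus_props:
  assumes p: "p \<in> \<Omega>" and t: "t > 0"
  shows "delta_plus \<Omega> p t > 0" and "delta_plus \<Omega> p t \<le> t"
    and "\<And>z. Re p \<le> Re z \<Longrightarrow> dist (vert p t) z < delta_plus \<Omega> p t \<Longrightarrow> z \<in> \<Omega>"
    and "delta_plus \<Omega> p t = t \<or> (\<exists>q. q \<notin> \<Omega> \<and> Re p \<le> Re q \<and> dist (vert p t) q = delta_plus \<Omega> p t)"
proof -
  define w where "w = vert p t"
  define A where "A = {z \<in> frontier \<Omega>. Re z \<ge> Re p}"
  have w: "w \<in> \<Omega>"
    using up p t by (simp add: w_def)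
  have "A = frontier \<Omega> \<inter> {z. Re z \<ge> Re p}"
    by (auto simp: A_def)
  then have "closed A"
    by (simp add: closed_Int closed_halfspace_Re_ge)
  have d: "delta_plus \<Omega> p t = real_of_ereal (min (ereal t) (INF z\<in>A. ereal (cmod (z - w))))"
    by (simp add: delta_plus_def A_def w_def)
  note D = truncated_distance[OF \<open>closed A\<close> less_imp_le[OF t], where w = w, folded d]
  show "delta_plus \<Omega> p t \<le> t"
    by (rule D(1))
  show "delta_plus \<Omega> p t > 0"
    using D(3) t w frontier_disjoint by (auto simp: A_def) (metis zero_less_dist_iff)
  show "delta_plus \<Omega> p t = t \<or> (\<exists>q. q \<notin> \<Omega> \<and> Re p \<le> Re q \<and> dist (vert p t) q = delta_plus \<Omega> p t)"
    using D(3) frontier_disjoint unfolding w_def[symmetric] A_def by blast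
  fix z assume z: "Re p \<le> Re z" "dist (vert p t) z < delta_plus \<Omega> p t"
  show "z \<in> \<Omega>"
  proof (rule mem_if_no_frontier_near[OF w])
    show "convex {z. Re z \<ge> Re p}"
      by (rule convex_halfspace_Re_ge)
  qed (use z D(2) in \<open>auto simp: w_def A_def\<close>)
qed

lemma delta_minus_props:
  assumes p: "p \<in> \<Omega>" and t: "t > 0"
  shows "delta_minus \<Omega> p t > 0" and "delta_minus \<Omega> p t \<le> t"
    and "\<And>z. Re z \<le> Re p \<Longrightarrow> dist (vert p t) z < delta_minus \<Omega> p t \<Longrightarrow> z \<in> \<Omega>"
    and "delta_minus \<Omega> p t = t \<or> (\<exists>q. q \<notin> \<Omega> \<and> Re q \<le> Re p \<and> dist (vert p t) q = delta_minus \<Omega> p t)"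
proof -
  interpret M: half_plane_model "(\<lambda>z. - cnj z) ` \<Omega>" "\<lambda>z. cnj (F (- cnj z))" "\<lambda>\<zeta>. - cnj (k (cnj \<zeta>))"
    by (rule half_plane_model_mirror)
  have "- cnj p \<in> (\<lambda>z. - cnj z) ` \<Omega>"
    using p by blast
  note D = M.delta_plus_props[OF this t, unfolded delta_plus_mirror]
  have mem: "- cnj z \<in> (\<lambda>z. - cnj z) ` \<Omega> \<longleftrightarrow> z \<in> \<Omega>" for z
    by auto
  have dist: "dist (- cnj p + \<i> * of_real t) (- cnj z) = dist (vert p t) z" for z
  proof -
    have "- cnj p + \<i> * of_real t - - cnj z = - cnj (vert p t - z)"
      by simp
    then show ?thesis
      by (simp only: dist_norm norm_minus_cancel complex_mod_cnj)
  qed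
  show "delta_minus \<Omega> p t > 0" "delta_minus \<Omega> p t \<le> t"
    by (rule D(1), rule D(2))
  show "z \<in> \<Omega>" if "Re z \<le> Re p" "dist (vert p t) z < delta_minus \<Omega> p t" for z
    using D(3)[of "- cnj z"] that unfolding mem dist by simp
  show "delta_minus \<Omega> p t = t \<or> (\<exists>q. q \<notin> \<Omega> \<and> Re q \<le> Re p \<and> dist (vert p t) q = delta_minus \<Omega> p t)"
    using D(4)
  proof
    assume "\<exists>q. q \<notin> (\<lambda>z. - cnj z) ` \<Omega> \<and> Re (- cnj p) \<le> Re q \<and> dist (- cnj p + \<i> * of_real t) q = delta_minus \<Omega> p t"
    then obtain q where q: "q \<notin> (\<lambda>z. - cnj z) ` \<Omega>" "Re (- cnj p) \<le> Re q" "dist (- cnj p + \<i> * of_real t) q = delta_minus \<Omega> p t"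
      by blast
    then have "- cnj q \<notin> \<Omega>" "Re (- cnj q) \<le> Re p" "dist (vert p t) (- cnj q) = delta_minus \<Omega> p t"
      using mem[of "- cnj q"] dist[of "- cnj q"] by auto
    then show ?thesis
      by blast
  qed simp
qed

section \<open>The slope of an orbit in terms of the two distances\<close>

definition slope :: "complex \<Rightarrow> real \<Rightarrow> real" where
  "slope p t = Im (F (vert p t)) / (Re (F (vert p t)) + 1 / 2)"

lemma Re_F_half_pos:
  assumes "p \<in> \<Omega>" "t \<ge> 0"
  shows "Re (F (vert p t)) + 1 / 2 > 0"
  using F_pos[OF up[OF assms]] by simp

lemma le_slope_iff:
  assumes "p \<in> \<Omega>" "t \<ge> 0"
  shows "M \<le> slope p t \<longleftrightarrow> M * (Re (F (vert p t)) + 1 / 2) \<le> Im (F (vert p t))"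
  using Re_F_half_pos[OF assms] by (simp add: slope_def le_divide_eq)

lemma slope_le_iff:
  assumes "p \<in> \<Omega>" "t \<ge> 0"
  shows "slope p t \<le> M \<longleftrightarrow> Im (F (vert p t)) \<le> M * (Re (F (vert p t)) + 1 / 2)"
  using Re_F_half_pos[OF assms] by (simp add: slope_def divide_le_eq)

lemma slope_ge_if_delta_minus_small:
  assumes p: "p \<in> \<Omega>"
  obtains \<epsilon> where "\<epsilon> > 0" "\<forall>\<^sub>F t in at_top. delta_minus \<Omega> p t \<le> \<epsilon> * delta_plus \<Omega> p t \<longrightarrow> M \<le> slope p t"
proof -
  obtain \<epsilon> where \<epsilon>: "\<epsilon> > 0"
    and ev: "\<forall>\<^sub>F t in at_top. \<forall>R q. 0 < R \<longrightarrow> R \<le> t \<longrightarrow> (\<forall>z. Re p \<le> Re z \<longrightarrow> dist (vert p t) z < R \<longrightarrow> z \<in> \<Omega>) \<longrightarrow>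
       q \<notin> \<Omega> \<longrightarrow> dist (vert p t) q \<le> \<epsilon> * R \<longrightarrow>
       M * (Re (F (vert p t)) + 1 / 2) \<le> Im (F (vert p t))"
    using Im_F_large_if_left_boundary_close[OF p] by blast
  show thesis
  \<comment> \<open>The bound \<open>1 / 2\<close> keeps the left distance below \<open>t\<close>,
    so it is attained at a point outside \<Omega> and is not merely the truncation.\<close>
  proof (rule that[of "min \<epsilon> (1 / 2)"])
    show "\<forall>\<^sub>F t in at_top. delta_minus \<Omega> p t \<le> min \<epsilon> (1 / 2) * delta_plus \<Omega> p t \<longrightarrow> M \<le> slope p t"
      using ev eventually_gt_at_top[of 0]
    proof eventually_elim
      case (elim t)
      show ?case
      proof
        assume le: "delta_minus \<Omega> p t \<le> min \<epsilon> (1 / 2) * delta_plus \<Omega> p t"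
        note P = delta_plus_props[OF p elim(2)] and N = delta_minus_props[OF p elim(2)]
        have "min \<epsilon> (1 / 2) * delta_plus \<Omega> p t \<le> \<epsilon> * delta_plus \<Omega> p t"
          "min \<epsilon> (1 / 2) * delta_plus \<Omega> p t \<le> 1 / 2 * delta_plus \<Omega> p t"
          using P(1) by (intro mult_right_mono; simp)+
        then have le': "delta_minus \<Omega> p t \<le> \<epsilon> * delta_plus \<Omega> p t" "delta_minus \<Omega> p t < t"
          using le P(1,2) elim(2) by linarith+
        then obtain q where "q \<notin> \<Omega>" "dist (vert p t) q = delta_minus \<Omega> p t"
          using N(4) by auto
        then have "M * (Re (F (vert p t)) + 1 / 2) \<le> Im (F (vert p t))"
          using elim(1) P(1-3) le'(1) by metis
        then show "M \<le> slope p t"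
          using le_slope_iff[OF p] elim(2) by simp
      qed
    qed
  qed (use \<epsilon> in auto)
qed

lemma slope_bounded_above_if_delta_plus_le:
  assumes p: "p \<in> \<Omega>"
  obtains K where "\<forall>\<^sub>F t in at_top. delta_plus \<Omega> p t \<le> C * delta_minus \<Omega> p t \<longrightarrow> slope p t \<le> K"
proof -
  \<comment> \<open>With a constant of at least \<open>1\<close> the left half-disc of radius
    \<open>R / C'\<close> is no larger than the right one.\<close>
  define C' where "C' = max C 1"
  have C': "C' \<ge> 1"
    by (simp add: C'_def)
  obtain K\<^sub>1 where K1: "\<forall>\<^sub>F t in at_top. \<forall>R q. 0 < R \<longrightarrow> R \<le> t \<longrightarrow> (\<forall>z. Re p \<le> Re z \<longrightarrow> dist (vert p t) z < R \<longrightarrow> z \<in> \<Omega>) \<longrightarrow>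
       (\<forall>z. Re z \<le> Re p \<longrightarrow> dist (vert p t) z < R / C' \<longrightarrow> z \<in> \<Omega>) \<longrightarrow>
       q \<notin> \<Omega> \<longrightarrow> Re p \<le> Re q \<longrightarrow> dist (vert p t) q = R \<longrightarrow>
       Im (F (vert p t)) \<le> K\<^sub>1 * (Re (F (vert p t)) + 1 / 2)"
    using Im_F_bounded_above_if_right_boundary_close[OF p C'] by blast
  obtain K\<^sub>2 where K2: "\<forall>\<^sub>F t in at_top. (\<forall>z. Re p \<le> Re z \<longrightarrow> dist (vert p t) z < t \<longrightarrow> z \<in> \<Omega>) \<longrightarrow>
       (\<forall>z. Re z \<le> Re p \<longrightarrow> dist (vert p t) z < t / C' \<longrightarrow> z \<in> \<Omega>) \<longrightarrow>
       Im (F (vert p t)) \<le> K\<^sub>2 * (Re (F (vert p t)) + 1 / 2)"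
    using Im_F_bounded_above_if_right_boundary_far[OF p C'] by blast
  show thesis
  proof (rule that[of "max K\<^sub>1 K\<^sub>2"])
    show "\<forall>\<^sub>F t in at_top. delta_plus \<Omega> p t \<le> C * delta_minus \<Omega> p t \<longrightarrow> slope p t \<le> max K\<^sub>1 K\<^sub>2"
      using K1 K2 eventually_gt_at_top[of 0]
    proof eventually_elim
      case (elim t)
      show ?case
      proof
        assume le: "delta_plus \<Omega> p t \<le> C * delta_minus \<Omega> p t"
        note P = delta_plus_props[OF p elim(3)] and N = delta_minus_props[OF p elim(3)]
        have "C * delta_minus \<Omega> p t \<le> C' * delta_minus \<Omega> p t"
          using N(1) by (intro mult_right_mono) (auto simp: C'_def)
        then have "delta_plus \<Omega> p t / C' \<le> delta_minus \<Omega> p t"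
          using le C' by (simp add: divide_le_eq mult.commute)
        then have left: "\<forall>z. Re z \<le> Re p \<longrightarrow> dist (vert p t) z < delta_plus \<Omega> p t / C' \<longrightarrow> z \<in> \<Omega>"
          using N(3) by (meson less_le_trans)
        have right: "\<forall>z. Re p \<le> Re z \<longrightarrow> dist (vert p t) z < delta_plus \<Omega> p t \<longrightarrow> z \<in> \<Omega>"
          using P(3) by blast
        \<comment> \<open>An active truncation is the case of a far boundary; otherwise the distance
          is attained on the rim.\<close>
        from P(4) have "slope p t \<le> K\<^sub>1 \<or> slope p t \<le> K\<^sub>2"
        proof
          assume eq: "delta_plus \<Omega> p t = t"
          show ?thesis
            using elim(2) left right slope_le_iff[OF p less_imp_le[OF elim(3)]] unfolding eq by blast
        next
          assume "\<exists>q. q \<notin> \<Omega> \<and> Re p \<le> Re q \<and> dist (vert p t) q = delta_plus \<Omega> p t"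
          then show ?thesis
            using elim(1) left right P(1,2) slope_le_iff[OF p less_imp_le[OF elim(3)]] by blast
        qed
        then show "slope p t \<le> max K\<^sub>1 K\<^sub>2"
          by auto
      qed
    qed
  qed
qed

lemma slope_le_if_delta_plus_small:
  assumes p: "p \<in> \<Omega>"
  obtains \<epsilon> where "\<epsilon> > 0" "\<forall>\<^sub>F t in at_top. delta_plus \<Omega> p t \<le> \<epsilon> * delta_minus \<Omega> p t \<longrightarrow> slope p t \<le> M"
proof -
  interpret M: half_plane_model "(\<lambda>z. - cnj z) ` \<Omega>" "\<lambda>z. cnj (F (- cnj z))" "\<lambda>\<zeta>. - cnj (k (cnj \<zeta>))"
    by (rule half_plane_model_mirror)
  have "- cnj p \<in> (\<lambda>z. - cnj z) ` \<Omega>"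
    using p by blast
  from M.slope_ge_if_delta_minus_small[OF this, of "- M"] obtain \<epsilon> where "\<epsilon> > 0"
    "\<forall>\<^sub>F t in at_top. delta_plus \<Omega> p t \<le> \<epsilon> * delta_minus \<Omega> p t \<longrightarrow> - M \<le> M.slope (- cnj p) t"
    unfolding delta_plus_mirror delta_minus_mirror by blast
  moreover have "M.slope (- cnj p) t = - slope p t" for t
    by (simp add: M.slope_def slope_def)
  ultimately show thesis
    by (intro that[of \<epsilon>]) simp_all
qed

lemma slope_bounded_below_if_delta_minus_le:
  assumes p: "p \<in> \<Omega>"
  obtains K where "\<forall>\<^sub>F t in at_top. delta_minus \<Omega> p t \<le> C * delta_plus \<Omega> p t \<longrightarrow> K \<le> slope p t"
proof -
  interpret M: half_plane_model "(\<lambda>z. - cnj z) ` \<Omega>" "\<lambda>z. cnj (F (- cnj z))" "\<lambda>\<zeta>. - cnj (k (cnj \<zeta>))"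
    by (rule half_plane_model_mirror)
  have "- cnj p \<in> (\<lambda>z. - cnj z) ` \<Omega>"
    using p by blast
  from M.slope_bounded_above_if_delta_plus_le[OF this, of C] obtain K where
    "\<forall>\<^sub>F t in at_top. delta_minus \<Omega> p t \<le> C * delta_plus \<Omega> p t \<longrightarrow> M.slope (- cnj p) t \<le> K"
    unfolding delta_plus_mirror delta_minus_mirror by blast
  moreover have "M.slope (- cnj p) t = - slope p t" for t
    by (simp add: M.slope_def slope_def)
  ultimately have "\<forall>\<^sub>F t in at_top. delta_minus \<Omega> p t \<le> C * delta_plus \<Omega> p t \<longrightarrow> - slope p t \<le> K"
    by simp
  then have "\<forall>\<^sub>F t in at_top. delta_minus \<Omega> p t \<le> C * delta_plus \<Omega> p t \<longrightarrow> - K \<le> slope p t"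
    by eventually_elim auto
  then show thesis
    by (rule that)
qed

text \<open>Between the two orbits the denominators of the slope change by a factor of at most
  \<open>L\<close> and the numerators by at most \<open>K\<close> times the denominator. The
  one-sided bounds require \<open>slope p s\<close> beyond \<plusminus>\<open>K\<close>, since
  exchanging the denominators preserves an inequality only when the sign of the shifted slope is
  known.\<close>

lemma slope_comparable:
  assumes p: "p \<in> \<Omega>" and p': "p' \<in> \<Omega>"
  obtains K L where "K > 0" "L > 0"
    "\<And>s. s \<ge> 0 \<Longrightarrow> \<bar>slope p' s\<bar> \<le> L * (\<bar>slope p s\<bar> + K)"
    "\<And>s. s \<ge> 0 \<Longrightarrow> K \<le> slope p s \<Longrightarrow> (slope p s - K) / L \<le> slope p' s"
    "\<And>s. s \<ge> 0 \<Longrightarrow> slope p s \<le> - K \<Longrightarrow> slope p' s \<le> (slope p s + K) / L"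
proof -
  obtain K where K: "K > 0" "\<And>s. s \<ge> 0 \<Longrightarrow> Re (F (vert p' s)) \<le> K * Re (F (vert p s))"
    "\<And>s. s \<ge> 0 \<Longrightarrow> norm (F (vert p' s) - F (vert p s)) \<le> K * Re (F (vert p s))"
    using orbits_comparable[OF p p'] by blast
  obtain K' where K': "K' > 0" "\<And>s. s \<ge> 0 \<Longrightarrow> Re (F (vert p s)) \<le> K' * Re (F (vert p' s))"
    "\<And>s. s \<ge> 0 \<Longrightarrow> norm (F (vert p s) - F (vert p' s)) \<le> K' * Re (F (vert p' s))"
    using orbits_comparable[OF p' p] by blast
  \<comment> \<open>The entry \<open>1\<close> covers the summand \<open>1 / 2\<close> in the
    denominators.\<close>
  define L where "L = max 1 (max K K')"
  have L: "L \<ge> 1" "K \<le> L" "K' \<le> L"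
    by (auto simp: L_def)
  show thesis
  proof (rule that[of K L])
    show "K > 0" "L > 0"
      using K L by auto
    fix s :: real assume s: "s \<ge> 0"
    define u v u' v' where "u = Re (F (vert p s)) + 1 / 2" and "v = Im (F (vert p s))"
      and "u' = Re (F (vert p' s)) + 1 / 2" and "v' = Im (F (vert p' s))"
    have pos: "u > 1 / 2" "u' > 1 / 2"
      using F_pos[OF up[OF p s]] F_pos[OF up[OF p' s]] by (simp_all add: u_def u'_def)
    have sl: "slope p s = v / u" "slope p' s = v' / u'"
      by (simp_all add: slope_def u_def v_def u'_def v'_def)
    have "K * (u - 1 / 2) \<le> L * (u - 1 / 2)" "K' * (u' - 1 / 2) \<le> L * (u' - 1 / 2)"
      using pos L by (auto intro: mult_right_mono)
    then have u': "u' \<le> L * u" "u \<le> L * u'"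
      using K(2)[OF s] K'(2)[OF s] L(1) unfolding u_def u'_def by (simp_all add: algebra_simps)
    have "K * (u - 1 / 2) \<le> K * u"
      using K(1) by simp
    moreover have "\<bar>v' - v\<bar> \<le> K * (u - 1 / 2)"
      using K(3)[OF s] abs_Im_le_cmod[of "F (vert p' s) - F (vert p s)"]
      by (simp add: u_def v_def v'_def)
    ultimately have v': "\<bar>v' - v\<bar> \<le> K * u"
      by linarith
    have vu: "v = slope p s * u"
      using pos by (simp add: sl)
    show "\<bar>slope p' s\<bar> \<le> L * (\<bar>slope p s\<bar> + K)"
    proof -
      have "\<bar>v'\<bar> \<le> \<bar>slope p s\<bar> * u + K * u"
        using v' pos vu abs_mult[of "slope p s" u] by linarith
      also have "\<dots> = (\<bar>slope p s\<bar> + K) * u"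
        by (simp add: algebra_simps)
      also have "\<dots> \<le> (\<bar>slope p s\<bar> + K) * (L * u')"
        using K(1) u' by (intro mult_left_mono) auto
      finally show ?thesis
        using pos unfolding sl(2) by (simp add: divide_le_eq abs_divide mult_ac)
    qed
    show "(slope p s - K) / L \<le> slope p' s" if "K \<le> slope p s"
    proof -
      have "(slope p s - K) / L * u' \<le> (slope p s - K) / L * (L * u)"
        using that L u' by (intro mult_left_mono) auto
      also have "\<dots> = (slope p s - K) * u"
        using L by simp
      also have "\<dots> \<le> v'"
        using v' vu by (simp add: algebra_simps)
      finally show ?thesis
        using pos unfolding sl(2) by (simp add: le_divide_eq)
    qed
    show "slope p' s \<le> (slope p s + K) / L" if "slope p s \<le> - K"
    proof -
      have "v' \<le> (slope p s + K) * u"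
        using v' vu by (simp add: algebra_simps)
      also have "\<dots> = (slope p s + K) / L * (L * u)"
        using L by simp
      also have "\<dots> \<le> (slope p s + K) / L * u'"
        using that L u' by (intro mult_left_mono_neg) (auto simp: divide_le_0_iff)
      finally show ?thesis
        using pos unfolding sl(2) by (simp add: divide_le_eq)
    qed
  qed
qed

end

section \<open>Semigroups and their Koenigs functions\<close>

text \<open>Wolff's lemma: if \<open>Re (\<Phi> \<zeta>) < Re \<zeta>\<close>, then comparing the orbit \<open>b\<close> with \<open>\<zeta>\<close> through Schwarz-Pick would make
  \<open>norm (b n) ^ 2 / Re (b n)\<close> eventually decreasing, although this quantity dominates \<open>norm (b n)\<close>.\<close>

lemma Re_le_if_orbit_at_infinity:
  assumes hol: "\<Phi> holomorphic_on {\<zeta>. Re \<zeta> > 0}" and pos: "\<And>\<zeta>. Re \<zeta> > 0 \<Longrightarrow> Re (\<Phi> \<zeta>) > 0"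
    and b: "\<And>n::nat. Re (b n) > 0" "\<And>n. b (Suc n) = \<Phi> (b n)" "filterlim b at_infinity sequentially"
    and \<zeta>: "Re \<zeta> > 0"
  shows "Re \<zeta> \<le> Re (\<Phi> \<zeta>)"
proof (rule ccontr)
  assume "\<not> Re \<zeta> \<le> Re (\<Phi> \<zeta>)"
  define r where "r = Re (\<Phi> \<zeta>) / Re \<zeta>"
  have r: "0 < r" "r < 1"
    using \<open>\<not> _\<close> \<zeta> pos[OF \<zeta>] by (auto simp: r_def)
  have b0: "b n \<noteq> 0" for n
    using b(1)[of n] by auto
  \<comment> \<open>Up to the constant factor \<open>1 / Re \<zeta>\<close> this is the leading term
    of the Schwarz-Pick quantity between \<zeta> and \<open>b n\<close> when \<open>b n\<close> is
    near infinity; its sublevel sets are horocyclic.\<close>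
  define e where "e n = norm (b n) ^ 2 / Re (b n)" for n
  have e_ge: "norm (b n) \<le> e n" for n
  proof -
    have "norm (b n) * Re (b n) \<le> norm (b n) ^ 2"
      using complex_Re_le_cmod[of "b n"] by (simp add: power2_eq_square mult_left_mono)
    then show ?thesis
      using b(1)[of n] by (simp add: e_def le_divide_eq)
  qed
  have ratio: "(\<lambda>n. norm (a - c n) / norm (c n)) \<longlonglongrightarrow> 1"
    if "filterlim c at_infinity sequentially" "\<And>n. c n \<noteq> 0" for a :: complex and c
  proof -
    have "(\<lambda>n. norm (a / c n - 1)) \<longlonglongrightarrow> norm (0 - 1 :: complex)"
      by (intro tendsto_intros tendsto_divide_0[OF tendsto_const that(1)])
    moreover have "norm (a / c n - 1) = norm (a - c n) / norm (c n)" for n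
      using that(2)[of n] by (simp add: norm_divide[symmetric] diff_divide_distrib)
    ultimately show ?thesis
      by simp
  qed
  define x where "x n = norm (\<zeta> - b n) / norm (b n)" for n
  define y where "y n = norm (\<Phi> \<zeta> - b (Suc n)) / norm (b (Suc n))" for n
  have "x \<longlonglongrightarrow> 1"
    unfolding x_def[abs_def] by (rule ratio[OF b(3) b0])
  moreover have "filterlim (\<lambda>n. b (Suc n)) at_infinity sequentially"
    using b(3) filterlim_Suc filterlim_compose by blast
  then have "y \<longlonglongrightarrow> 1"
    unfolding y_def[abs_def] using b0 by (intro ratio[of "\<lambda>n. b (Suc n)"])
  \<comment> \<open>The limit \<open>r - 1\<close> is negative: the corrections \<open>x\<close> and
    \<open>y\<close> for replacing \<open>\<zeta> - b n\<close> by \<open>b n\<close>, and likewise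
    after \<Phi>, do not spoil the contraction by \<open>r\<close>.\<close>
  ultimately have "(\<lambda>n. r * x n ^ 2 - y n ^ 2) \<longlonglongrightarrow> r * 1 ^ 2 - 1 ^ 2"
    by (intro tendsto_intros)
  then have "\<forall>\<^sub>F n in sequentially. r * x n ^ 2 - y n ^ 2 < 0"
    using r by (intro order_tendstoD(2)[where a = 0]) auto
  moreover have "\<forall>\<^sub>F n in sequentially. y n > 0"
    using \<open>y \<longlonglongrightarrow> 1\<close> by (rule order_tendstoD) simp
  ultimately have "\<forall>\<^sub>F n in sequentially. e (Suc n) \<le> e n"
  proof eventually_elim
    case (elim n)
    have "norm (\<Phi> \<zeta> - \<Phi> (b n)) ^ 2 / (Re (\<Phi> \<zeta>) * Re (\<Phi> (b n))) \<le> norm (\<zeta> - b n) ^ 2 / (Re \<zeta> * Re (b n))"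
      by (rule Schwarz_Pick_right_half_plane[OF hol pos \<zeta> b(1)])
    then have "norm (\<Phi> \<zeta> - b (Suc n)) ^ 2 / (Re (\<Phi> \<zeta>) * Re (b (Suc n))) * Re (\<Phi> \<zeta>) \<le> norm (\<zeta> - b n) ^ 2 / (Re \<zeta> * Re (b n)) * Re (\<Phi> \<zeta>)"
      unfolding b(2)[symmetric] using pos[OF \<zeta>] by (intro mult_right_mono) auto
    then have "norm (\<Phi> \<zeta> - b (Suc n)) ^ 2 / Re (b (Suc n)) \<le> r * (norm (\<zeta> - b n) ^ 2 / Re (b n))"
      using pos[OF \<zeta>] by (simp add: r_def mult_ac)
    then have "y n ^ 2 * e (Suc n) \<le> r * (x n ^ 2 * e n)"
      using b0 by (simp add: y_def x_def e_def power_divide)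
    also have "\<dots> = (r * x n ^ 2) * e n"
      by simp
    also have "\<dots> \<le> y n ^ 2 * e n"
      using elim e_ge[of n] order_trans[OF norm_ge_zero e_ge[of n]] by (intro mult_right_mono) auto
    finally show ?case
      using elim by simp
  qed
  then obtain N where N: "\<And>n. n \<ge> N \<Longrightarrow> e (Suc n) \<le> e n"
    by (auto simp: eventually_sequentially)
  have e_le: "e n \<le> e N" if "n \<ge> N" for n
    using that by (induction n rule: dec_induct) (use N in \<open>auto intro: order_trans\<close>)
  have "\<forall>\<^sub>F n in sequentially. norm (b n) \<ge> e N + 1"
    using b(3) by (auto simp: filterlim_at_infinity_conv_norm_at_top filterlim_at_top)
  then obtain N' where "\<And>n. n \<ge> N' \<Longrightarrow> norm (b n) \<ge> e N + 1"
    by (auto simp: eventually_sequentially)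
  from this[of "max N N'"] e_le[of "max N N'"] e_ge[of "max N N'"] show False
    by fastforce
qed

section \<open>Arguments, cluster points and inequalities along a sequence\<close>

lemma Re_inverse_one_minus:
  assumes "norm (v :: complex) < 1"
  shows "Re (1 / (1 - v)) > 1 / 2"
proof -
  have "1 - v \<noteq> 0"
    using assms by auto
  then have n: "norm (1 - v) ^ 2 > 0"
    by simp
  have "norm (1 - v) ^ 2 = 1 - 2 * Re v + norm v ^ 2"
    by (simp only: cmod_power2) (simp add: power2_eq_square algebra_simps)
  moreover have "norm v ^ 2 < 1"
    using assms by (simp add: power_less_one_iff)
  ultimately have "norm (1 - v) ^ 2 < 2 * Re (1 - v)"
    by simp
  then have "1 / 2 < Re (1 - v) / norm (1 - v) ^ 2"
    using n by (simp add: less_divide_eq)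
  also have "\<dots> = Re (1 / (1 - v))"
    by (simp add: Re_divide cmod_power2)
  finally show ?thesis .
qed

lemma Arg_one_minus:
  assumes "norm (v :: complex) < 1"
  defines "y \<equiv> 1 / (1 - v)"
  shows "Arg (1 - v) = - arctan (Im y / Re y)"
proof -
  have "Re v < 1"
    using complex_Re_le_cmod[of v] assms by simp
  then have pos: "Re (1 - v) > 0"
    by simp
  have "1 - v \<noteq> 0"
    using assms by auto
  then have n: "norm (1 - v) ^ 2 > 0"
    by simp
  have "Re y = Re (1 - v) / norm (1 - v) ^ 2" "Im y = - Im (1 - v) / norm (1 - v) ^ 2"
    by (simp_all add: y_def Re_divide Im_divide cmod_power2)
  then have "Im y / Re y = - (Im (1 - v) / Re (1 - v))"
    using n pos by simp
  then show ?thesis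
    using arg_conv_arctan[OF pos] by (simp only: arctan_minus)
qed

lemma arctan_tendsto_pi_half_iff:
  "((\<lambda>n. arctan (x n)) \<longlongrightarrow> pi / 2) G \<longleftrightarrow> filterlim x at_top G"
proof
  assume lim: "((\<lambda>n. arctan (x n)) \<longlongrightarrow> pi / 2) G"
  show "filterlim x at_top G"
    unfolding filterlim_at_top
  proof
    fix Z
    have "arctan Z < pi / 2"
      by (rule arctan_ubound)
    with lim have "\<forall>\<^sub>F n in G. arctan Z < arctan (x n)"
      by (rule order_tendstoD)
    then show "\<forall>\<^sub>F n in G. Z \<le> x n"
      by eventually_elim (simp add: arctan_less_iff)
  qed
next
  assume "filterlim x at_top G"
  then show "((\<lambda>n. arctan (x n)) \<longlongrightarrow> pi / 2) G"
    using filterlim_compose[OF tendsto_arctan_at_top] by blast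
qed

lemma cluster_points_convergent:
  fixes x :: "nat \<Rightarrow> 'a::t2_space"
  assumes "x \<longlonglongrightarrow> l"
  shows "cluster_points x \<subseteq> {l}"
proof
  fix m assume m: "m \<in> cluster_points x"
  show "m \<in> {l}"
  proof (rule ccontr)
    assume "m \<notin> {l}"
    then obtain U V where UV: "open U" "open V" "m \<in> U" "l \<in> V" "U \<inter> V = {}"
      using hausdorff[of m l] by blast
    then have "\<forall>\<^sub>F n in sequentially. x n \<in> V"
      using assms by (auto dest: topological_tendstoD)
    moreover have "\<exists>\<^sub>F n in sequentially. x n \<in> U"
      using m UV by (auto simp: cluster_points_def)
    ultimately have "\<exists>\<^sub>F n in sequentially. x n \<in> U \<and> x n \<in> V"
      by (rule frequently_eventually_frequently[rotated])
    then show False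
      using UV(5) frequently_ex by blast
  qed
qed

text \<open>The values already lie in the open interval, so only its two endpoints must be excluded
  as cluster points. Avoiding a neighbourhood of both endpoints means staying bounded before the
  arctangent is taken.\<close>

lemma cluster_points_arctan_iff:
  fixes x :: "nat \<Rightarrow> real"
  shows "cluster_points (\<lambda>n. - arctan (x n)) \<subseteq> {-(pi/2)<..<pi/2} \<longleftrightarrow> (\<exists>K. \<forall>\<^sub>F n in sequentially. \<bar>x n\<bar> \<le> K)"
proof
  assume sub: "cluster_points (\<lambda>n. - arctan (x n)) \<subseteq> {-(pi/2)<..<pi/2}"
  then have "- (pi / 2) \<notin> cluster_points (\<lambda>n. - arctan (x n))" "pi / 2 \<notin> cluster_points (\<lambda>n. - arctan (x n))"
    by auto
  then obtain U V where U: "open U" "- (pi / 2) \<in> U" "\<forall>\<^sub>F n in sequentially. - arctan (x n) \<notin> U"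
    and V: "open V" "pi / 2 \<in> V" "\<forall>\<^sub>F n in sequentially. - arctan (x n) \<notin> V"
    unfolding cluster_points_def not_frequently[symmetric] by blast
  have "((\<lambda>y. - arctan y) \<longlongrightarrow> - (pi / 2)) at_top"
    by (intro tendsto_minus tendsto_arctan_at_top)
  then have "\<forall>\<^sub>F y in at_top. - arctan y \<in> U"
    using U by (auto dest: topological_tendstoD)
  then obtain K\<^sub>1 where K1: "\<And>y. y \<ge> K\<^sub>1 \<Longrightarrow> - arctan y \<in> U"
    by (auto simp: eventually_at_top_linorder)
  have "((\<lambda>y. - arctan y) \<longlongrightarrow> - (- (pi / 2))) at_bot"
    by (intro tendsto_minus tendsto_arctan_at_bot)
  then have "\<forall>\<^sub>F y in at_bot. - arctan y \<in> V"
    using V by (auto dest: topological_tendstoD)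
  then obtain K\<^sub>2 where K2: "\<And>y. y \<le> K\<^sub>2 \<Longrightarrow> - arctan y \<in> V"
    by (auto simp: eventually_at_bot_linorder)
  have "\<forall>\<^sub>F n in sequentially. \<bar>x n\<bar> \<le> max \<bar>K\<^sub>1\<bar> \<bar>K\<^sub>2\<bar>"
    using U(3) V(3)
  proof eventually_elim
    case (elim n)
    then have "x n < K\<^sub>1" "K\<^sub>2 < x n"
      using K1 K2 not_less by blast+
    then show ?case
      by linarith
  qed
  then show "\<exists>K. \<forall>\<^sub>F n in sequentially. \<bar>x n\<bar> \<le> K"
    by blast
next
  assume "\<exists>K. \<forall>\<^sub>F n in sequentially. \<bar>x n\<bar> \<le> K"
  then obtain K where K: "\<forall>\<^sub>F n in sequentially. \<bar>x n\<bar> \<le> K"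
    by blast
  have ev: "\<forall>\<^sub>F n in sequentially. - arctan (x n) \<in> {- arctan K..arctan K}"
    using K
  proof eventually_elim
    case (elim n)
    then have "- K \<le> x n" "x n \<le> K"
      by auto
    then have "arctan (- K) \<le> arctan (x n)" "arctan (x n) \<le> arctan K"
      by (simp_all add: arctan_le_iff del: arctan_minus)
    then show ?case
      by (simp add: arctan_minus)
  qed
  have "cluster_points (\<lambda>n. - arctan (x n)) \<subseteq> {- arctan K..arctan K}"
  proof (rule ccontr)
    assume "\<not> ?thesis"
    then obtain m where m: "m \<in> cluster_points (\<lambda>n. - arctan (x n))" "m \<in> - {- arctan K..arctan K}"
      by blast
    moreover have "open (- {- arctan K..arctan K})"
      by (simp add: open_Compl)
    ultimately have "\<exists>\<^sub>F n in sequentially. - arctan (x n) \<in> - {- arctan K..arctan K}"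
      unfolding cluster_points_def by blast
    then show False
      using ev by (simp add: frequently_def)
  qed
  also have "\<dots> \<subseteq> {-(pi/2)<..<pi/2}"
    using arctan_ubound[of K] by auto
  finally show "cluster_points (\<lambda>n. - arctan (x n)) \<subseteq> {-(pi/2)<..<pi/2}" .
qed

text \<open>The finitely many exceptional indices only lower the constant, provided that
  \<open>g n\<close> vanishes only together with \<open>f n\<close>; both distances vanish at time
  \<open>0\<close>.\<close>

lemma eventually_le_imp_all_le:
  fixes f g :: "nat \<Rightarrow> real"
  assumes pos: "\<And>n. f n > 0 \<and> g n > 0 \<or> f n = 0 \<and> g n = 0"
    and "c > 0" "\<forall>\<^sub>F n in sequentially. c * f n \<le> g n"
  obtains d where "d > 0" "\<And>n. d * f n \<le> g n"
proof -
  obtain N where N: "\<And>n. n \<ge> N \<Longrightarrow> c * f n \<le> g n"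
    using assms(3) by (auto simp: eventually_sequentially)
  \<comment> \<open>Where \<open>f n = 0\<close> any positive entry serves, and \<open>1\<close> is
    taken.\<close>
  define S where "S = insert c ((\<lambda>n. if f n = 0 then 1 else g n / f n) ` {..<N})"
  have "finite S" "S \<noteq> {}"
    by (auto simp: S_def)
  have "\<forall>x\<in>S. x > 0"
    using pos \<open>c > 0\<close> by (force simp: S_def)
  show thesis
  proof (rule that[of "Min S"])
    show "Min S > 0"
      using \<open>finite S\<close> \<open>S \<noteq> {}\<close> \<open>\<forall>x\<in>S. x > 0\<close> by (simp add: Min_gr_iff)
    fix n
    have f0: "f n \<ge> 0"
      using pos[of n] by auto
    show "Min S * f n \<le> g n"
    proof (cases "n \<ge> N")
      case True
      have "Min S \<le> c"
        using \<open>finite S\<close> by (auto simp: S_def)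
      then have "Min S * f n \<le> c * f n"
        using f0 by (rule mult_right_mono)
      then show ?thesis
        using N[OF True] by simp
    next
      case False
      show ?thesis
      proof (cases "f n = 0")
        case True
        then show ?thesis
          using pos[of n] by auto
      next
        case fn: False
        then have "g n / f n \<in> S"
          using False by (auto simp: S_def image_iff intro!: bexI[of _ n])
        then have "Min S * f n \<le> g n / f n * f n"
          using \<open>finite S\<close> f0 by (intro mult_right_mono Min_le)
        then show ?thesis
          using fn by simp
      qed
    qed
  qed
qed

lemma all_equivalent_transfer:
  assumes "D \<noteq> {}" and indep: "\<And>z z'. z \<in> D \<Longrightarrow> z' \<in> D \<Longrightarrow> P z \<Longrightarrow> P z'"
    and PQ: "\<And>z. z \<in> D \<Longrightarrow> P z \<longleftrightarrow> Q (h z)"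
  shows "all_equivalent [\<exists>z\<in>D. P z, \<forall>z\<in>D. P z, \<exists>p\<in>h ` D. Q p, \<forall>p\<in>h ` D. Q p]"
proof -
  obtain z\<^sub>0 where z0: "z\<^sub>0 \<in> D"
    using assms(1) by blast
  have P: "P z \<longleftrightarrow> P z\<^sub>0" if "z \<in> D" for z
    using indep z0 that by blast
  have Q: "Q (h z) \<longleftrightarrow> P z\<^sub>0" if "z \<in> D" for z
    using PQ P that by blast
  have "(\<exists>z\<in>D. P z) \<longleftrightarrow> P z\<^sub>0" "(\<forall>z\<in>D. P z) \<longleftrightarrow> P z\<^sub>0" "(\<exists>p\<in>h ` D. Q p) \<longleftrightarrow> P z\<^sub>0" "(\<forall>p\<in>h ` D. Q p) \<longleftrightarrow> P z\<^sub>0"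
    using P Q z0 by blast+
  then show ?thesis
    by (simp add: all_equivalent_def)
qed

section \<open>Limits of the slope and of the ratio of the distances along a sequence of
  times\<close>

context half_plane_model
begin

lemma slope_tendsto_at_top_transfer:
  assumes p: "p \<in> \<Omega>" and p': "p' \<in> \<Omega>" and t: "\<And>n. t n \<ge> (0::real)"
    and lim: "filterlim (\<lambda>n. slope p (t n)) at_top G"
  shows "filterlim (\<lambda>n. slope p' (t n)) at_top G"
proof -
  obtain K L where K: "K > 0" "L > 0" "\<And>s. s \<ge> 0 \<Longrightarrow> \<bar>slope p' s\<bar> \<le> L * (\<bar>slope p s\<bar> + K)"
    "\<And>s. s \<ge> 0 \<Longrightarrow> K \<le> slope p s \<Longrightarrow> (slope p s - K) / L \<le> slope p' s"
    "\<And>s. s \<ge> 0 \<Longrightarrow> slope p s \<le> - K \<Longrightarrow> slope p' s \<le> (slope p s + K) / L"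
    using slope_comparable[OF p p'] by blast
  show ?thesis
    unfolding filterlim_at_top
  proof
    fix Z
    have "\<forall>\<^sub>F n in G. L * \<bar>Z\<bar> + K \<le> slope p (t n)"
      using lim by (simp add: filterlim_at_top)
    then show "\<forall>\<^sub>F n in G. Z \<le> slope p' (t n)"
    proof eventually_elim
      case (elim n)
      have "0 \<le> L * \<bar>Z\<bar>"
        using K(2) by simp
      then have "(slope p (t n) - K) / L \<le> slope p' (t n)"
        using elim by (intro K(4) t) linarith
      moreover have "\<bar>Z\<bar> \<le> (slope p (t n) - K) / L"
        using elim K(2) by (simp add: le_divide_eq mult.commute)
      ultimately show ?case
        by linarith
    qed
  qed
qed

lemma slope_tendsto_at_bot_transfer:
  assumes p: "p \<in> \<Omega>" and p': "p' \<in> \<Omega>" and t: "\<And>n. t n \<ge> (0::real)"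
    and lim: "filterlim (\<lambda>n. slope p (t n)) at_bot G"
  shows "filterlim (\<lambda>n. slope p' (t n)) at_bot G"
proof -
  obtain K L where K: "K > 0" "L > 0" "\<And>s. s \<ge> 0 \<Longrightarrow> \<bar>slope p' s\<bar> \<le> L * (\<bar>slope p s\<bar> + K)"
    "\<And>s. s \<ge> 0 \<Longrightarrow> K \<le> slope p s \<Longrightarrow> (slope p s - K) / L \<le> slope p' s"
    "\<And>s. s \<ge> 0 \<Longrightarrow> slope p s \<le> - K \<Longrightarrow> slope p' s \<le> (slope p s + K) / L"
    using slope_comparable[OF p p'] by blast
  show ?thesis
    unfolding filterlim_at_bot
  proof
    fix Z
    have "\<forall>\<^sub>F n in G. slope p (t n) \<le> - (L * \<bar>Z\<bar> + K)"
      using lim by (simp add: filterlim_at_bot)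
    then show "\<forall>\<^sub>F n in G. slope p' (t n) \<le> Z"
    proof eventually_elim
      case (elim n)
      have "0 \<le> L * \<bar>Z\<bar>"
        using K(2) by simp
      then have "slope p' (t n) \<le> (slope p (t n) + K) / L"
        using elim by (intro K(5) t) linarith
      moreover have "slope p (t n) + K \<le> - \<bar>Z\<bar> * L"
        using elim by (simp add: algebra_simps)
      then have "(slope p (t n) + K) / L \<le> - \<bar>Z\<bar>"
        using K(2) by (simp add: divide_le_eq)
      ultimately show ?case
        by linarith
    qed
  qed
qed

lemma slope_bounded_transfer:
  assumes p: "p \<in> \<Omega>" and p': "p' \<in> \<Omega>" and t: "\<And>n. t n \<ge> (0::real)"
    and bdd: "\<exists>B. \<forall>\<^sub>F n in G. \<bar>slope p (t n)\<bar> \<le> B"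
  shows "\<exists>B. \<forall>\<^sub>F n in G. \<bar>slope p' (t n)\<bar> \<le> B"
proof -
  obtain K L where K: "K > 0" "L > 0" "\<And>s. s \<ge> 0 \<Longrightarrow> \<bar>slope p' s\<bar> \<le> L * (\<bar>slope p s\<bar> + K)"
    "\<And>s. s \<ge> 0 \<Longrightarrow> K \<le> slope p s \<Longrightarrow> (slope p s - K) / L \<le> slope p' s"
    "\<And>s. s \<ge> 0 \<Longrightarrow> slope p s \<le> - K \<Longrightarrow> slope p' s \<le> (slope p s + K) / L"
    using slope_comparable[OF p p'] by blast
  obtain B where "\<forall>\<^sub>F n in G. \<bar>slope p (t n)\<bar> \<le> B"
    using bdd by blast
  then have "\<forall>\<^sub>F n in G. \<bar>slope p' (t n)\<bar> \<le> L * (B + K)"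
  proof eventually_elim
    case (elim n)
    have "\<bar>slope p' (t n)\<bar> \<le> L * (\<bar>slope p (t n)\<bar> + K)"
      by (rule K(3)[OF t])
    also have "\<dots> \<le> L * (B + K)"
      using elim K(2) by (intro mult_left_mono) auto
    finally show ?case .
  qed
  then show ?thesis
    by blast
qed

text \<open>Forwards, a ratio of at most \<open>Z\<close> would keep the slope bounded, so a large
  slope excludes it. Backwards, a large ratio makes the left distance a small fraction of the right
  one, which forces a large slope.\<close>

lemma slope_at_top_iff:
  assumes p: "p \<in> \<Omega>" and lim: "filterlim t at_top G"
  shows "filterlim (\<lambda>n. slope p (t n)) at_top G \<longleftrightarrow>
    filterlim (\<lambda>n. delta_plus \<Omega> p (t n) / delta_minus \<Omega> p (t n)) at_top G"
proof
  note ev = eventually_compose_filterlim[OF _ lim]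
  assume slope: "filterlim (\<lambda>n. slope p (t n)) at_top G"
  show "filterlim (\<lambda>n. delta_plus \<Omega> p (t n) / delta_minus \<Omega> p (t n)) at_top G"
    unfolding filterlim_at_top
  proof
    fix Z
    obtain K where K: "\<forall>\<^sub>F t in at_top. delta_plus \<Omega> p t \<le> Z * delta_minus \<Omega> p t \<longrightarrow> slope p t \<le> K"
      using slope_bounded_above_if_delta_plus_le[OF p] by blast
    have "\<forall>\<^sub>F n in G. K + 1 \<le> slope p (t n)"
      using slope by (simp add: filterlim_at_top)
    then show "\<forall>\<^sub>F n in G. Z \<le> delta_plus \<Omega> p (t n) / delta_minus \<Omega> p (t n)"
      using ev[OF K] ev[OF eventually_gt_at_top[of 0]]
    proof eventually_elim
      case (elim n)
      then have "\<not> delta_plus \<Omega> p (t n) \<le> Z * delta_minus \<Omega> p (t n)"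
        by auto
      then show ?case
        using delta_minus_props(1)[OF p elim(3)] by (simp add: le_divide_eq)
    qed
  qed
next
  note ev = eventually_compose_filterlim[OF _ lim]
  assume ratio: "filterlim (\<lambda>n. delta_plus \<Omega> p (t n) / delta_minus \<Omega> p (t n)) at_top G"
  show "filterlim (\<lambda>n. slope p (t n)) at_top G"
    unfolding filterlim_at_top
  proof
    fix Z
    obtain \<epsilon> where \<epsilon>: "\<epsilon> > 0" "\<forall>\<^sub>F t in at_top. delta_minus \<Omega> p t \<le> \<epsilon> * delta_plus \<Omega> p t \<longrightarrow> Z \<le> slope p t"
      using slope_ge_if_delta_minus_small[OF p] by blast
    have "\<forall>\<^sub>F n in G. 1 / \<epsilon> \<le> delta_plus \<Omega> p (t n) / delta_minus \<Omega> p (t n)"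
      using ratio by (simp add: filterlim_at_top)
    then show "\<forall>\<^sub>F n in G. Z \<le> slope p (t n)"
      using ev[OF \<epsilon>(2)] ev[OF eventually_gt_at_top[of 0]]
    proof eventually_elim
      case (elim n)
      then have "delta_minus \<Omega> p (t n) \<le> \<epsilon> * delta_plus \<Omega> p (t n)"
        using delta_minus_props(1)[OF p elim(3)] \<epsilon>(1) by (simp add: field_simps)
      then show ?case
        using elim by blast
    qed
  qed
qed

lemma slope_at_bot_iff:
  assumes p: "p \<in> \<Omega>" and lim: "filterlim t at_top G"
  shows "filterlim (\<lambda>n. slope p (t n)) at_bot G \<longleftrightarrow>
    ((\<lambda>n. delta_plus \<Omega> p (t n) / delta_minus \<Omega> p (t n)) \<longlongrightarrow> 0) G"
proof
  note ev = eventually_compose_filterlim[OF _ lim]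
  assume slope: "filterlim (\<lambda>n. slope p (t n)) at_bot G"
  show "((\<lambda>n. delta_plus \<Omega> p (t n) / delta_minus \<Omega> p (t n)) \<longlongrightarrow> 0) G"
  proof (rule order_tendstoI)
    fix a :: real assume "a < 0"
    show "\<forall>\<^sub>F n in G. a < delta_plus \<Omega> p (t n) / delta_minus \<Omega> p (t n)"
      using ev[OF eventually_gt_at_top[of 0]]
    proof eventually_elim
      case (elim n)
      then have "0 < delta_plus \<Omega> p (t n) / delta_minus \<Omega> p (t n)"
        using delta_minus_props(1)[OF p elim] delta_plus_props(1)[OF p elim] by simp
      then show ?case
        using \<open>a < 0\<close> by linarith
    qed
  next
    fix a :: real assume a: "0 < a"
    obtain K where K: "\<forall>\<^sub>F t in at_top. delta_minus \<Omega> p t \<le> 1 / a * delta_plus \<Omega> p t \<longrightarrow> K \<le> slope p t"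
      using slope_bounded_below_if_delta_minus_le[OF p] by blast
    have "\<forall>\<^sub>F n in G. slope p (t n) \<le> K - 1"
      using slope by (simp add: filterlim_at_bot)
    then show "\<forall>\<^sub>F n in G. delta_plus \<Omega> p (t n) / delta_minus \<Omega> p (t n) < a"
      using ev[OF K] ev[OF eventually_gt_at_top[of 0]]
    proof eventually_elim
      case (elim n)
      then have "\<not> delta_minus \<Omega> p (t n) \<le> 1 / a * delta_plus \<Omega> p (t n)"
        by auto
      then show ?case
        using delta_minus_props(1)[OF p elim(3)] a by (simp add: field_simps)
    qed
  qed
next
  note ev = eventually_compose_filterlim[OF _ lim]
  assume ratio: "((\<lambda>n. delta_plus \<Omega> p (t n) / delta_minus \<Omega> p (t n)) \<longlongrightarrow> 0) G"
  show "filterlim (\<lambda>n. slope p (t n)) at_bot G"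
    unfolding filterlim_at_bot
  proof
    fix Z
    obtain \<epsilon> where \<epsilon>: "\<epsilon> > 0" "\<forall>\<^sub>F t in at_top. delta_plus \<Omega> p t \<le> \<epsilon> * delta_minus \<Omega> p t \<longrightarrow> slope p t \<le> Z"
      using slope_le_if_delta_plus_small[OF p] by blast
    have "\<forall>\<^sub>F n in G. delta_plus \<Omega> p (t n) / delta_minus \<Omega> p (t n) < \<epsilon>"
      using ratio \<epsilon>(1) by (rule order_tendstoD)
    then show "\<forall>\<^sub>F n in G. slope p (t n) \<le> Z"
      using ev[OF \<epsilon>(2)] ev[OF eventually_gt_at_top[of 0]]
    proof eventually_elim
      case (elim n)
      then have "delta_plus \<Omega> p (t n) \<le> \<epsilon> * delta_minus \<Omega> p (t n)"
        using delta_minus_props(1)[OF p elim(3)] by (simp add: divide_less_eq)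
      then show ?case
        using elim by blast
    qed
  qed
qed

text \<open>A bounded slope excludes both kinds of extreme ratio by the two estimates for small
  distances; conversely each of the two inequalities bounds the slope on one side.\<close>

lemma slope_bounded_iff:
  assumes p: "p \<in> \<Omega>" and lim: "filterlim t at_top G"
  shows "(\<exists>K. \<forall>\<^sub>F n in G. \<bar>slope p (t n)\<bar> \<le> K) \<longleftrightarrow>
    (\<exists>c>0. (\<forall>\<^sub>F n in G. c * delta_plus \<Omega> p (t n) \<le> delta_minus \<Omega> p (t n)) \<and>
            (\<forall>\<^sub>F n in G. c * delta_minus \<Omega> p (t n) \<le> delta_plus \<Omega> p (t n)))"
proof
  note ev = eventually_compose_filterlim[OF _ lim]
  assume "\<exists>K. \<forall>\<^sub>F n in G. \<bar>slope p (t n)\<bar> \<le> K"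
  then obtain K where K: "\<forall>\<^sub>F n in G. \<bar>slope p (t n)\<bar> \<le> K"
    by blast
  obtain \<epsilon> where \<epsilon>: "\<epsilon> > 0" "\<forall>\<^sub>F t in at_top. delta_minus \<Omega> p t \<le> \<epsilon> * delta_plus \<Omega> p t \<longrightarrow> K + 1 \<le> slope p t"
    using slope_ge_if_delta_minus_small[OF p] by blast
  obtain \<epsilon>' where \<epsilon>': "\<epsilon>' > 0" "\<forall>\<^sub>F t in at_top. delta_plus \<Omega> p t \<le> \<epsilon>' * delta_minus \<Omega> p t \<longrightarrow> slope p t \<le> - K - 1"
    using slope_le_if_delta_plus_small[OF p] by blast
  define c where "c = min \<epsilon> \<epsilon>'"
  have "c > 0"
    using \<epsilon> \<epsilon>' by (simp add: c_def)
  moreover have "\<forall>\<^sub>F n in G. c * delta_plus \<Omega> p (t n) \<le> delta_minus \<Omega> p (t n)"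
    using K ev[OF \<epsilon>(2)] ev[OF eventually_gt_at_top[of 0]]
  proof eventually_elim
    case (elim n)
    have "c * delta_plus \<Omega> p (t n) \<le> \<epsilon> * delta_plus \<Omega> p (t n)"
      using delta_plus_props(1)[OF p elim(3)] by (intro mult_right_mono) (auto simp: c_def)
    moreover have "\<not> delta_minus \<Omega> p (t n) \<le> \<epsilon> * delta_plus \<Omega> p (t n)"
      using elim by auto
    ultimately show ?case
      by linarith
  qed
  moreover have "\<forall>\<^sub>F n in G. c * delta_minus \<Omega> p (t n) \<le> delta_plus \<Omega> p (t n)"
    using K ev[OF \<epsilon>'(2)] ev[OF eventually_gt_at_top[of 0]]
  proof eventually_elim
    case (elim n)
    have "c * delta_minus \<Omega> p (t n) \<le> \<epsilon>' * delta_minus \<Omega> p (t n)"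
      using delta_minus_props(1)[OF p elim(3)] by (intro mult_right_mono) (auto simp: c_def)
    moreover have "\<not> delta_plus \<Omega> p (t n) \<le> \<epsilon>' * delta_minus \<Omega> p (t n)"
      using elim by auto
    ultimately show ?case
      by linarith
  qed
  ultimately show "\<exists>c>0. (\<forall>\<^sub>F n in G. c * delta_plus \<Omega> p (t n) \<le> delta_minus \<Omega> p (t n)) \<and>
            (\<forall>\<^sub>F n in G. c * delta_minus \<Omega> p (t n) \<le> delta_plus \<Omega> p (t n))"
    by blast
next
  note ev = eventually_compose_filterlim[OF _ lim]
  assume "\<exists>c>0. (\<forall>\<^sub>F n in G. c * delta_plus \<Omega> p (t n) \<le> delta_minus \<Omega> p (t n)) \<and>
            (\<forall>\<^sub>F n in G. c * delta_minus \<Omega> p (t n) \<le> delta_plus \<Omega> p (t n))"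
  then obtain c where c: "c > 0" "\<forall>\<^sub>F n in G. c * delta_plus \<Omega> p (t n) \<le> delta_minus \<Omega> p (t n)"
    "\<forall>\<^sub>F n in G. c * delta_minus \<Omega> p (t n) \<le> delta_plus \<Omega> p (t n)"
    by blast
  obtain K where K: "\<forall>\<^sub>F t in at_top. delta_minus \<Omega> p t \<le> 1 / c * delta_plus \<Omega> p t \<longrightarrow> K \<le> slope p t"
    using slope_bounded_below_if_delta_minus_le[OF p] by blast
  obtain K' where K': "\<forall>\<^sub>F t in at_top. delta_plus \<Omega> p t \<le> 1 / c * delta_minus \<Omega> p t \<longrightarrow> slope p t \<le> K'"
    using slope_bounded_above_if_delta_plus_le[OF p] by blast
  have "\<forall>\<^sub>F n in G. \<bar>slope p (t n)\<bar> \<le> \<bar>K\<bar> + \<bar>K'\<bar>"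
    using c(2,3) ev[OF K] ev[OF K']
  proof eventually_elim
    case (elim n)
    have "delta_minus \<Omega> p (t n) \<le> 1 / c * delta_plus \<Omega> p (t n)" "delta_plus \<Omega> p (t n) \<le> 1 / c * delta_minus \<Omega> p (t n)"
      using elim(1,2) c(1) by (simp_all add: field_simps)
    then have "K \<le> slope p (t n)" "slope p (t n) \<le> K'"
      using elim(3,4) by auto
    then show ?case
      by linarith
  qed
  then show "\<exists>K. \<forall>\<^sub>F n in G. \<bar>slope p (t n)\<bar> \<le> K"
    by blast
qed

lemma delta_at_0:
  shows "delta_plus \<Omega> p 0 = 0" and "delta_minus \<Omega> p 0 = 0"
proof -
  have "min (ereal 0) (INF z\<in>A. ereal (f z)) = 0" if "\<And>z. f z \<ge> 0" for A :: "complex set" and f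
    using that by (auto simp: min_def zero_ereal_def[symmetric] intro!: antisym INF_greatest)
  then show "delta_plus \<Omega> p 0 = 0" "delta_minus \<Omega> p 0 = 0"
    unfolding delta_plus_def delta_minus_def by simp_all
qed

lemma delta_comparable_iff:
  assumes p: "p \<in> \<Omega>" and t: "\<And>n::nat. t n \<ge> 0" and lim: "filterlim t at_top sequentially"
  shows "(\<exists>c C. 0 < c \<and> c < C \<and> (\<forall>n. c * delta_plus \<Omega> p (t n) \<le> delta_minus \<Omega> p (t n) \<and>
      delta_minus \<Omega> p (t n) \<le> C * delta_plus \<Omega> p (t n))) \<longleftrightarrow> (\<exists>K. \<forall>\<^sub>F n in sequentially. \<bar>slope p (t n)\<bar> \<le> K)"
proof -
  define f g where "f n = delta_plus \<Omega> p (t n)" and "g n = delta_minus \<Omega> p (t n)" for n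
  have pos: "f n > 0 \<and> g n > 0 \<or> f n = 0 \<and> g n = 0" for n
  proof (cases "t n = 0")
    case True
    then show ?thesis
      by (simp add: f_def g_def delta_at_0)
  next
    case False
    then have "t n > 0"
      using t[of n] by simp
    then show ?thesis
      using delta_plus_props(1)[OF p] delta_minus_props(1)[OF p] by (simp add: f_def g_def)
  qed
  have "(\<exists>c C. 0 < c \<and> c < C \<and> (\<forall>n. c * f n \<le> g n \<and> g n \<le> C * f n)) \<longleftrightarrow>
    (\<exists>c>0. (\<forall>\<^sub>F n in sequentially. c * f n \<le> g n) \<and> (\<forall>\<^sub>F n in sequentially. c * g n \<le> f n))"
  proof
    assume "\<exists>c C. 0 < c \<and> c < C \<and> (\<forall>n. c * f n \<le> g n \<and> g n \<le> C * f n)"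
    then obtain c C where cC: "0 < c" "c < C" "\<And>n. c * f n \<le> g n" "\<And>n. g n \<le> C * f n"
      by blast
    have f0: "f n \<ge> 0" "g n \<ge> 0" for n
      using pos[of n] by auto
    have "min c (1 / C) * f n \<le> g n" for n
      using cC(3)[of n] mult_right_mono[OF min.cobounded1[of c "1 / C"] f0(1)[of n]] by linarith
    moreover have "min c (1 / C) * g n \<le> f n" for n
    proof -
      have "1 / C * g n \<le> f n"
        using cC(1,2) cC(4)[of n] by (simp add: divide_le_eq mult.commute)
      then show ?thesis
        using mult_right_mono[OF min.cobounded2[of c "1 / C"] f0(2)[of n]] by linarith
    qed
    ultimately show "\<exists>c>0. (\<forall>\<^sub>F n in sequentially. c * f n \<le> g n) \<and> (\<forall>\<^sub>F n in sequentially. c * g n \<le> f n)"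
      using cC by (intro exI[of _ "min c (1 / C)"]) auto
  next
    assume "\<exists>c>0. (\<forall>\<^sub>F n in sequentially. c * f n \<le> g n) \<and> (\<forall>\<^sub>F n in sequentially. c * g n \<le> f n)"
    then obtain c where c: "c > 0" "\<forall>\<^sub>F n in sequentially. c * f n \<le> g n" "\<forall>\<^sub>F n in sequentially. c * g n \<le> f n"
      by blast
    obtain d where d: "d > 0" "\<And>n. d * f n \<le> g n"
      using eventually_le_imp_all_le[OF pos c(1,2)] by blast
    have "g n > 0 \<and> f n > 0 \<or> g n = 0 \<and> f n = 0" for n
      using pos[of n] by auto
    then obtain d' where d': "d' > 0" "\<And>n. d' * g n \<le> f n"
      using eventually_le_imp_all_le[OF _ c(1,3)] by blast
    \<comment> \<open>Adding \<open>d\<close> keeps the upper constant strictly above the lower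
      constant \<open>d\<close>.\<close>
    have "g n \<le> (1 / d' + d) * f n" for n
    proof -
      have "g n \<le> 1 / d' * f n"
        using d'(1) d'(2)[of n] by (simp add: le_divide_eq mult.commute)
      also have "\<dots> \<le> (1 / d' + d) * f n"
        using d(1) pos[of n] by (intro mult_right_mono) auto
      finally show ?thesis .
    qed
    then show "\<exists>c C. 0 < c \<and> c < C \<and> (\<forall>n. c * f n \<le> g n \<and> g n \<le> C * f n)"
      using d d'(1) by (intro exI[of _ d] exI[of _ "1 / d' + d"]) auto
  qed
  then show ?thesis
    using slope_bounded_iff[OF p lim] by (simp add: f_def g_def)
qed

end

text \<open>The Koenigs function turns the semigroup into upward translation of its image.
  Convergence to \<tau> becomes divergence of \<open>F\<close>, and this is the hypothesis under
  which Wolff's lemma gives the monotonicity of \<open>Re F\<close>.\<close>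

lemma half_plane_model_of_semigroup:
  assumes semi: "nonelliptic_semigroup \<phi> \<tau>" and koenigs: "koenigs_function \<phi> h"
  obtains F k where "half_plane_model (h ` ball 0 1) F k"
    "\<And>z. z \<in> ball 0 1 \<Longrightarrow> F (h z) = 1 / (1 - cnj \<tau> * z) - 1 / 2"
proof -
  have tau: "norm \<tau> = 1" "cnj \<tau> * \<tau> = 1"
    using semi complex_norm_square[of \<tau>] by (auto simp: nonelliptic_semigroup_def mult.commute)
  have self: "\<phi> t z \<in> ball 0 1" if "t \<ge> 0" "z \<in> ball 0 1" for t z
  proof -
    have "\<phi> t ` ball 0 1 \<subseteq> ball 0 1"
      using semi that(1) by (simp add: nonelliptic_semigroup_def holomorphic_semigroup_def)
    then show ?thesis
      using that(2) by blast
  qed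
  have h: "h holomorphic_on ball 0 1" "inj_on h (ball 0 1)"
    "\<And>t z. t \<ge> 0 \<Longrightarrow> z \<in> ball 0 1 \<Longrightarrow> h (\<phi> t z) = h z + \<i> * of_real t"
    using koenigs by (auto simp: koenigs_function_def)
  obtain g where g: "g holomorphic_on h ` ball 0 1" "\<And>z. z \<in> ball 0 1 \<Longrightarrow> g (h z) = z"
    using holomorphic_has_inverse[OF h(1) open_ball h(2)] by metis
  have small: "norm (cnj \<tau> * z) < 1" if "z \<in> ball 0 1" for z
    using that tau by (simp add: norm_mult)
  have ne: "1 - cnj \<tau> * z \<noteq> 0" if "z \<in> ball 0 1" for z
    using small[OF that] by auto
  define F where "F w = 1 / (1 - cnj \<tau> * g w) - 1 / 2" for w
  \<comment> \<open>The inverse of the Moebius map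
    \<open>z \<mapsto> 1 / (1 - cnj \<tau> * z) - 1 / 2\<close>.\<close>
  define m where "m \<zeta> = \<tau> * ((\<zeta> - 1 / 2) / (\<zeta> + 1 / 2))" for \<zeta> :: complex
  define k where "k \<zeta> = h (m \<zeta>)" for \<zeta>
  have Fh: "F (h z) = 1 / (1 - cnj \<tau> * z) - 1 / 2" if "z \<in> ball 0 1" for z
    using g(2)[OF that] by (simp add: F_def)
  have mne: "\<zeta> + 1 / 2 \<noteq> 0" if "Re \<zeta> > 0" for \<zeta> :: complex
  proof
    assume "\<zeta> + 1 / 2 = 0"
    then have "Re (\<zeta> + 1 / 2) = 0"
      by simp
    then show False
      using that by simp
  qed
  have m_in: "m \<zeta> \<in> ball 0 1" if "Re \<zeta> > 0" for \<zeta>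
    using right_half_plane_norm_less[of "1 / 2" \<zeta>] that tau mne[OF that]
    by (simp add: m_def norm_mult norm_divide divide_less_eq)
  have F_pos: "Re (F w) > 0" if "w \<in> h ` ball 0 1" for w
    using that Re_inverse_one_minus[OF small] by (auto simp: Fh)
  have holF: "F holomorphic_on h ` ball 0 1"
    unfolding F_def using ne g(2) by (intro holomorphic_intros g(1)) auto
  have "(\<lambda>\<zeta>. \<tau> * ((\<zeta> - 1 / 2) / (\<zeta> + 1 / 2))) holomorphic_on {\<zeta>. Re \<zeta> > 0}"
    using mne by (intro holomorphic_intros) auto
  then have holm: "m holomorphic_on {\<zeta>. Re \<zeta> > 0}"
    by (simp add: m_def[abs_def])
  have holk: "k holomorphic_on {\<zeta>. Re \<zeta> > 0}"
  proof -
    have "m ` {\<zeta>. Re \<zeta> > 0} \<subseteq> ball 0 1"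
      using m_in by blast
    from holomorphic_on_compose_gen[OF holm h(1) this] show ?thesis
      by (simp add: k_def[abs_def] o_def)
  qed
  have up: "vert w s \<in> h ` ball 0 1" if "w \<in> h ` ball 0 1" "s \<ge> 0" for w s
    using that h(3) self by (force simp: image_iff)
  have kF: "k (F w) = w" if "w \<in> h ` ball 0 1" for w
  proof -
    obtain z where z: "z \<in> ball 0 1" "w = h z"
      using \<open>w \<in> h ` ball 0 1\<close> by blast
    have "m (F (h z)) = \<tau> * (cnj \<tau> * z)"
      using ne[OF z(1)] by (simp add: m_def Fh[OF z(1)] field_simps)
    also have "\<dots> = z"
      using tau by (metis mult.assoc mult.commute mult_1)
    finally show ?thesis
      by (simp add: k_def z)
  qed
  have Fk: "F (k \<zeta>) = \<zeta>" if "Re \<zeta> > 0" for \<zeta>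
  proof -
    have "cnj \<tau> * m \<zeta> = (\<zeta> - 1 / 2) / (\<zeta> + 1 / 2)"
      using tau by (simp add: m_def mult.assoc[symmetric])
    moreover have "1 - (\<zeta> - c) / (\<zeta> + c) = (c + c) / (\<zeta> + c)" if "\<zeta> + c \<noteq> 0" for c
      using that by (simp add: field_simps)
    ultimately have "1 - cnj \<tau> * m \<zeta> = 1 / (\<zeta> + 1 / 2)"
      using mne[OF that] by fastforce
    then show ?thesis
      using Fh[OF m_in[OF that]] by (simp add: k_def)
  qed
  have k_in: "k \<zeta> \<in> h ` ball 0 1" if "Re \<zeta> > 0" for \<zeta>
    using m_in[OF that] by (simp add: k_def)
  have F_inf: "filterlim (\<lambda>s. F (vert w s)) at_infinity at_top" if "w \<in> h ` ball 0 1" for w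
  proof -
    obtain z where z: "z \<in> ball 0 1" "w = h z"
      using \<open>w \<in> h ` ball 0 1\<close> by blast
    have "compact {z} \<and> {z} \<subseteq> ball 0 1 \<longrightarrow> uniform_limit {z} \<phi> (\<lambda>z. \<tau>) at_top"
      using semi unfolding nonelliptic_semigroup_def by blast
    then have "((\<lambda>s. \<phi> s z) \<longlongrightarrow> \<tau>) at_top"
      using z by simp
    then have "((\<lambda>s. 1 - cnj \<tau> * \<phi> s z) \<longlongrightarrow> 1 - cnj \<tau> * \<tau>) at_top"
      by (intro tendsto_intros)
    then have "((\<lambda>s. 1 - cnj \<tau> * \<phi> s z) \<longlongrightarrow> 0) at_top"
      using tau by simp
    moreover have "\<forall>\<^sub>F s in at_top. 1 - cnj \<tau> * \<phi> s z \<noteq> 0"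
      using eventually_ge_at_top[of "0::real"] by eventually_elim (rule ne[OF self[OF _ z(1)]])
    ultimately have "filterlim (\<lambda>s. 1 - cnj \<tau> * \<phi> s z) (at 0) at_top"
      by (simp add: filterlim_at)
    then have "filterlim (\<lambda>s. inverse (1 - cnj \<tau> * \<phi> s z)) at_infinity at_top"
      by (rule filterlim_compose[OF filterlim_inverse_at_infinity])
    then have "filterlim (\<lambda>s. - (1 / 2) + inverse (1 - cnj \<tau> * \<phi> s z)) at_infinity at_top"
      by (rule tendsto_add_filterlim_at_infinity[OF tendsto_const])
    moreover have "\<forall>\<^sub>F s in at_top. F (vert w s) = - (1 / 2) + inverse (1 - cnj \<tau> * \<phi> s z)"
      using eventually_ge_at_top[of "0::real"]
    proof eventually_elim
      case (elim s)
      then show ?case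
        using h(3)[OF elim z(1)] Fh[OF self[OF elim z(1)]] by (simp add: z inverse_eq_divide)
    qed
    ultimately show ?thesis
      using filterlim_cong[OF refl refl] by force
  qed
  have "half_plane_model (h ` ball 0 1) F k"
  proof
    show "open (h ` ball 0 1)"
      by (rule open_mapping_thm3[OF h(1) open_ball h(2)])
    fix w and s :: real assume w: "w \<in> h ` ball 0 1" and s: "s \<ge> 0"
    show "Re (F w) \<le> Re (F (vert w s))"
    proof (cases "s = 0")
      case False
      then have "s > 0"
        using s by simp
      define \<Phi> where "\<Phi> \<zeta> = F (k \<zeta> + \<i> * of_real s)" for \<zeta>
      \<comment> \<open>The orbit of \<open>F w\<close> under \<Phi>, that is, at the multiples of
        the step \<open>s\<close>; it diverges because \<open>s > 0\<close>.\<close>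
      define b where "b n = F (w + \<i> * of_real (real n * s))" for n
      have "Re (F w) \<le> Re (\<Phi> (F w))"
      proof (rule Re_le_if_orbit_at_infinity[where b = b])
        have "(\<lambda>\<zeta>. k \<zeta> + \<i> * of_real s) holomorphic_on {\<zeta>. Re \<zeta> > 0}"
          by (intro holomorphic_intros holk)
        moreover have "(\<lambda>\<zeta>. k \<zeta> + \<i> * of_real s) ` {\<zeta>. Re \<zeta> > 0} \<subseteq> h ` ball 0 1"
          using up k_in s by blast
        ultimately show "\<Phi> holomorphic_on {\<zeta>. Re \<zeta> > 0}"
          unfolding \<Phi>_def using holomorphic_on_compose_gen[OF _ holF] by (simp add: o_def)
        show "Re (\<Phi> \<zeta>) > 0" if "Re \<zeta> > 0" for \<zeta>
          unfolding \<Phi>_def by (intro F_pos up k_in that s)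
        have wn: "w + \<i> * of_real (real n * s) \<in> h ` ball 0 1" for n
          by (rule up[OF w]) (use s in simp)
        then show "Re (b n) > 0" for n
          unfolding b_def by (rule F_pos)
        show "b (Suc n) = \<Phi> (b n)" for n
          unfolding b_def \<Phi>_def kF[OF wn] by (simp add: algebra_simps)
        have "filterlim (\<lambda>n. real n * s) at_top sequentially"
          using \<open>s > 0\<close> by (intro filterlim_at_top_mult_tendsto_pos[OF tendsto_const _ filterlim_real_sequentially]) auto
        from filterlim_compose[OF F_inf[OF w] this] show "filterlim b at_infinity sequentially"
          by (simp add: b_def[abs_def])
      qed (rule F_pos[OF w])
      then show ?thesis
        by (simp add: \<Phi>_def kF[OF w])
    qed simp
  qed (use holF holk F_pos k_in kF Fk up F_inf in auto)
  then show thesis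
    using that Fh by blast
qed

theorem theorem1p1:
  fixes \<phi> :: "real \<Rightarrow> complex \<Rightarrow> complex" and \<tau> :: complex
    and h :: "complex \<Rightarrow> complex" and \<Omega> :: "complex set" and t :: "nat \<Rightarrow> real"
  assumes "nonelliptic_semigroup \<phi> \<tau>"
    and "koenigs_function \<phi> h"
    and "\<Omega> = h ` ball 0 1"
    and "\<And>n. t n \<ge> 0"
    and "filterlim t at_top sequentially"
  shows
    "all_equivalent
       [\<exists>z\<in>ball 0 1. converges_nontangentially (\<lambda>n. \<phi> (t n) z) \<tau>,
        \<forall>z\<in>ball 0 1. converges_nontangentially (\<lambda>n. \<phi> (t n) z) \<tau>,
        \<exists>p\<in>\<Omega>. \<exists>c C. 0 < c \<and> c < C \<and>
          (\<forall>n. c * delta_plus \<Omega> p (t n) \<le> delta_minus \<Omega> p (t n) \<and>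
               delta_minus \<Omega> p (t n) \<le> C * delta_plus \<Omega> p (t n)),
        \<forall>p\<in>\<Omega>. \<exists>c C. 0 < c \<and> c < C \<and>
          (\<forall>n. c * delta_plus \<Omega> p (t n) \<le> delta_minus \<Omega> p (t n) \<and>
               delta_minus \<Omega> p (t n) \<le> C * delta_plus \<Omega> p (t n))]
     \<and>
     all_equivalent
       [\<exists>z\<in>ball 0 1. (\<lambda>n. Arg (1 - cnj \<tau> * \<phi> (t n) z)) \<longlonglongrightarrow> pi / 2,
        \<forall>z\<in>ball 0 1. (\<lambda>n. Arg (1 - cnj \<tau> * \<phi> (t n) z)) \<longlonglongrightarrow> pi / 2,
        \<exists>p\<in>\<Omega>. (\<lambda>n. delta_plus \<Omega> p (t n) / delta_minus \<Omega> p (t n)) \<longlonglongrightarrow> 0,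
        \<forall>p\<in>\<Omega>. (\<lambda>n. delta_plus \<Omega> p (t n) / delta_minus \<Omega> p (t n)) \<longlonglongrightarrow> 0]
     \<and>
     all_equivalent
       [\<exists>z\<in>ball 0 1. (\<lambda>n. Arg (1 - cnj \<tau> * \<phi> (t n) z)) \<longlonglongrightarrow> - (pi / 2),
        \<forall>z\<in>ball 0 1. (\<lambda>n. Arg (1 - cnj \<tau> * \<phi> (t n) z)) \<longlonglongrightarrow> - (pi / 2),
        \<exists>p\<in>\<Omega>. filterlim (\<lambda>n. delta_plus \<Omega> p (t n) / delta_minus \<Omega> p (t n)) at_top sequentially,
        \<forall>p\<in>\<Omega>. filterlim (\<lambda>n. delta_plus \<Omega> p (t n) / delta_minus \<Omega> p (t n)) at_top sequentially]
     \<and>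
     (\<forall>z\<in>ball 0 1.
        ((\<lambda>n. Arg (1 - cnj \<tau> * \<phi> (t n) z)) \<longlonglongrightarrow> pi / 2 \<or>
         (\<lambda>n. Arg (1 - cnj \<tau> * \<phi> (t n) z)) \<longlonglongrightarrow> - (pi / 2))
        \<longrightarrow> converges_tangentially (\<lambda>n. \<phi> (t n) z) \<tau>)"
proof -
  note semi = assms(1) and koenigs = assms(2) and \<Omega> = assms(3) and t = assms(4) and lim = assms(5)
  obtain F k where "half_plane_model (h ` ball 0 1) F k"
    and Fh: "\<And>z. z \<in> ball 0 1 \<Longrightarrow> F (h z) = 1 / (1 - cnj \<tau> * z) - 1 / 2"
    using half_plane_model_of_semigroup[OF semi koenigs] by blast
  then interpret half_plane_model \<Omega> F k
    by (simp add: \<Omega>)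
  have tau: "norm \<tau> = 1"
    using semi by (simp add: nonelliptic_semigroup_def)
  have self: "\<phi> (t n) z \<in> ball 0 1" if "z \<in> ball 0 1" for n z
  proof -
    have "\<phi> (t n) ` ball 0 1 \<subseteq> ball 0 1"
      using semi t by (simp add: nonelliptic_semigroup_def holomorphic_semigroup_def)
    then show ?thesis
      using that by blast
  qed
  have hz: "h z \<in> \<Omega>" if "z \<in> ball 0 1" for z
    using that by (simp add: \<Omega>)
  have conv: "(\<lambda>n. \<phi> (t n) z) \<longlonglongrightarrow> \<tau>" if z: "z \<in> ball 0 1" for z
  proof -
    have "compact {z} \<and> {z} \<subseteq> ball 0 1 \<longrightarrow> uniform_limit {z} \<phi> (\<lambda>z. \<tau>) at_top"
      using semi unfolding nonelliptic_semigroup_def by blast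
    then have "((\<lambda>s. \<phi> s z) \<longlongrightarrow> \<tau>) at_top"
      using z by simp
    then show ?thesis
      using lim by (rule filterlim_compose)
  qed
  have Arg_eq: "Arg (1 - cnj \<tau> * \<phi> (t n) z) = - arctan (slope (h z) (t n))" if z: "z \<in> ball 0 1" for n z
  proof -
    let ?v = "cnj \<tau> * \<phi> (t n) z"
    have "norm ?v < 1"
      using self[OF z, of n] tau by (simp add: norm_mult)
    moreover have "F (h z + \<i> * of_real (t n)) = 1 / (1 - ?v) - 1 / 2"
      using koenigs t z Fh[OF self[OF z, of n]] by (simp add: koenigs_function_def)
    then have "slope (h z) (t n) = Im (1 / (1 - ?v)) / Re (1 / (1 - ?v))"
      by (simp add: slope_def)
    ultimately show ?thesis
      using Arg_one_minus by simp
  qed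
  have nontangential: "converges_nontangentially (\<lambda>n. \<phi> (t n) z) \<tau> \<longleftrightarrow> (\<exists>K. \<forall>\<^sub>F n in sequentially. \<bar>slope (h z) (t n)\<bar> \<le> K)"
    if z: "z \<in> ball 0 1" for z
    using self[OF z] conv[OF z] cluster_points_arctan_iff[of "\<lambda>n. slope (h z) (t n)"]
    by (simp add: converges_nontangentially_def Arg_eq[OF z] del: mem_ball)
  \<comment> \<open>The sign in \<open>Arg_eq\<close> exchanges the two ends: slope tending to plus
    infinity corresponds to the argument tending to \<open>- (pi / 2)\<close>.\<close>
  have minus: "(\<lambda>n. Arg (1 - cnj \<tau> * \<phi> (t n) z)) \<longlonglongrightarrow> - (pi / 2) \<longleftrightarrow> filterlim (\<lambda>n. slope (h z) (t n)) at_top sequentially"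
    if z: "z \<in> ball 0 1" for z
    unfolding Arg_eq[OF z] tendsto_minus_cancel_left arctan_tendsto_pi_half_iff[symmetric] by simp
  have plus: "(\<lambda>n. Arg (1 - cnj \<tau> * \<phi> (t n) z)) \<longlonglongrightarrow> pi / 2 \<longleftrightarrow> filterlim (\<lambda>n. slope (h z) (t n)) at_bot sequentially"
    if z: "z \<in> ball 0 1" for z
    unfolding Arg_eq[OF z] arctan_minus[symmetric] arctan_tendsto_pi_half_iff
    by (simp add: filterlim_uminus_at_bot)
  have "all_equivalent
       [\<exists>z\<in>ball 0 1. converges_nontangentially (\<lambda>n. \<phi> (t n) z) \<tau>,
        \<forall>z\<in>ball 0 1. converges_nontangentially (\<lambda>n. \<phi> (t n) z) \<tau>,
        \<exists>p\<in>h ` ball 0 1. \<exists>c C. 0 < c \<and> c < C \<and>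
          (\<forall>n. c * delta_plus \<Omega> p (t n) \<le> delta_minus \<Omega> p (t n) \<and>
               delta_minus \<Omega> p (t n) \<le> C * delta_plus \<Omega> p (t n)),
        \<forall>p\<in>h ` ball 0 1. \<exists>c C. 0 < c \<and> c < C \<and>
          (\<forall>n. c * delta_plus \<Omega> p (t n) \<le> delta_minus \<Omega> p (t n) \<and>
               delta_minus \<Omega> p (t n) \<le> C * delta_plus \<Omega> p (t n))]"
  proof (rule all_equivalent_transfer)
    show "converges_nontangentially (\<lambda>n. \<phi> (t n) z') \<tau>"
      if "z \<in> ball 0 1" "z' \<in> ball 0 1" "converges_nontangentially (\<lambda>n. \<phi> (t n) z) \<tau>" for z z'
      using slope_bounded_transfer[where t = t and G = sequentially, OF hz[OF that(1)] hz[OF that(2)] t] that(3)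
      unfolding nontangential[OF that(1)] nontangential[OF that(2)] by blast
    show "converges_nontangentially (\<lambda>n. \<phi> (t n) z) \<tau> \<longleftrightarrow> (\<exists>c C. 0 < c \<and> c < C \<and>
          (\<forall>n. c * delta_plus \<Omega> (h z) (t n) \<le> delta_minus \<Omega> (h z) (t n) \<and>
               delta_minus \<Omega> (h z) (t n) \<le> C * delta_plus \<Omega> (h z) (t n)))" if "z \<in> ball 0 1" for z
      using nontangential[OF that] delta_comparable_iff[OF hz[OF that] t lim] by simp
  qed simp
  moreover have "all_equivalent
       [\<exists>z\<in>ball 0 1. (\<lambda>n. Arg (1 - cnj \<tau> * \<phi> (t n) z)) \<longlonglongrightarrow> pi / 2,
        \<forall>z\<in>ball 0 1. (\<lambda>n. Arg (1 - cnj \<tau> * \<phi> (t n) z)) \<longlonglongrightarrow> pi / 2,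
        \<exists>p\<in>h ` ball 0 1. (\<lambda>n. delta_plus \<Omega> p (t n) / delta_minus \<Omega> p (t n)) \<longlonglongrightarrow> 0,
        \<forall>p\<in>h ` ball 0 1. (\<lambda>n. delta_plus \<Omega> p (t n) / delta_minus \<Omega> p (t n)) \<longlonglongrightarrow> 0]"
  proof (rule all_equivalent_transfer)
    show "(\<lambda>n. Arg (1 - cnj \<tau> * \<phi> (t n) z')) \<longlonglongrightarrow> pi / 2"
      if "z \<in> ball 0 1" "z' \<in> ball 0 1" "(\<lambda>n. Arg (1 - cnj \<tau> * \<phi> (t n) z)) \<longlonglongrightarrow> pi / 2" for z z'
      using slope_tendsto_at_bot_transfer[where t = t and G = sequentially, OF hz[OF that(1)] hz[OF that(2)] t] that(3)
      unfolding plus[OF that(1)] plus[OF that(2)] by blast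
    show "(\<lambda>n. Arg (1 - cnj \<tau> * \<phi> (t n) z)) \<longlonglongrightarrow> pi / 2 \<longleftrightarrow>
      (\<lambda>n. delta_plus \<Omega> (h z) (t n) / delta_minus \<Omega> (h z) (t n)) \<longlonglongrightarrow> 0" if "z \<in> ball 0 1" for z
      using plus[OF that] slope_at_bot_iff[OF hz[OF that] lim] by simp
  qed simp
  moreover have "all_equivalent
       [\<exists>z\<in>ball 0 1. (\<lambda>n. Arg (1 - cnj \<tau> * \<phi> (t n) z)) \<longlonglongrightarrow> - (pi / 2),
        \<forall>z\<in>ball 0 1. (\<lambda>n. Arg (1 - cnj \<tau> * \<phi> (t n) z)) \<longlonglongrightarrow> - (pi / 2),
        \<exists>p\<in>h ` ball 0 1. filterlim (\<lambda>n. delta_plus \<Omega> p (t n) / delta_minus \<Omega> p (t n)) at_top sequentially,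
        \<forall>p\<in>h ` ball 0 1. filterlim (\<lambda>n. delta_plus \<Omega> p (t n) / delta_minus \<Omega> p (t n)) at_top sequentially]"
  proof (rule all_equivalent_transfer)
    show "(\<lambda>n. Arg (1 - cnj \<tau> * \<phi> (t n) z')) \<longlonglongrightarrow> - (pi / 2)"
      if "z \<in> ball 0 1" "z' \<in> ball 0 1" "(\<lambda>n. Arg (1 - cnj \<tau> * \<phi> (t n) z)) \<longlonglongrightarrow> - (pi / 2)" for z z'
      using slope_tendsto_at_top_transfer[where t = t and G = sequentially, OF hz[OF that(1)] hz[OF that(2)] t] that(3)
      unfolding minus[OF that(1)] minus[OF that(2)] by blast
    show "(\<lambda>n. Arg (1 - cnj \<tau> * \<phi> (t n) z)) \<longlonglongrightarrow> - (pi / 2) \<longleftrightarrow>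
      filterlim (\<lambda>n. delta_plus \<Omega> (h z) (t n) / delta_minus \<Omega> (h z) (t n)) at_top sequentially" if "z \<in> ball 0 1" for z
      using minus[OF that] slope_at_top_iff[OF hz[OF that] lim] by simp
  qed simp
  moreover have "converges_tangentially (\<lambda>n. \<phi> (t n) z) \<tau>"
    if z: "z \<in> ball 0 1" and "(\<lambda>n. Arg (1 - cnj \<tau> * \<phi> (t n) z)) \<longlonglongrightarrow> pi / 2 \<or>
         (\<lambda>n. Arg (1 - cnj \<tau> * \<phi> (t n) z)) \<longlonglongrightarrow> - (pi / 2)" for z
    using that(2) self[OF z] conv[OF z] cluster_points_convergent[of "\<lambda>n. Arg (1 - cnj \<tau> * \<phi> (t n) z)"]
    unfolding converges_tangentially_def by blast
  ultimately show ?thesis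
    by (simp add: \<Omega>[symmetric] del: mem_ball)
qed

end
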